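(* Let $G$ be either Thompson's group $F$ or, for some subring $A$ of $\mathbf{R}$, the group $H(A)$ of piecewise Möbius transformations of the line defined in the context. Then every action of $G$ by homeomorphisms on a dendrite is elementary.
   Context: Thompson's group $F$ is the group of orientation-preserving piecewise affine homeomorphisms of $[0,1]$ with finitely many breakpoints, all at dyadic rationals, and with all slopes powers of $2$. For a (unital) subring $A\subseteq\mathbf{R}$, let $P_A\subseteq \mathbf{P}^1(\mathbf{R})$ be the set of fixed points of hyperbolic elements of $\mathbf{PSL}_2(A)$. Let $G(A)$ be the group of homeomorphisms of $\mathbf{P}^1(\mathbf{R})=\mathbf{R}\cup\{\infty\}$ that are piecewise in $\mathbf{PSL}_2(A)$, with finitely many pieces, and with interval endpoints in $P_A$. Let $H(A)$ be the stabiliser of $\infty$ in $G(A)$; it acts on the line $\mathbf{R}$. A continuum is a non-empty connected compact metrisable space. A dendrite is a locally connected continuum containing no simple closed curve. An action of a group by homeomorphisms on a dendrite $X$ is elementary if the group fixes a point of $X$ or preserves (setwise) a pair of points of $X$. *)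

theory Defs
  imports
    "HOL-Analysis.Analysis"
    "HOL-Algebra.Group_Action"
    "HOL-Algebra.Subrings"
    "HOL-Decision_Procs.Algebra_Aux"
begin

definition homeo_group :: "'a topology \<Rightarrow> ('a \<Rightarrow> 'a) monoid" where
  "homeo_group X =
     (BijGroup (topspace X)) \<lparr>carrier := {f \<in> Bij (topspace X). homeomorphic_map X X f}\<rparr>"

definition homeo_action :: "('g, 'm) monoid_scheme \<Rightarrow> 'a topology \<Rightarrow> ('g \<Rightarrow> 'a \<Rightarrow> 'a) \<Rightarrow> bool" where
  "homeo_action G X \<phi> \<longleftrightarrow> \<phi> \<in> hom G (homeo_group X)"

definition elementary_action :: "('g, 'm) monoid_scheme \<Rightarrow> 'a topology \<Rightarrow> ('g \<Rightarrow> 'a \<Rightarrow> 'a) \<Rightarrow> bool" where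
  "elementary_action G X \<phi> \<longleftrightarrow>
     (\<exists>x \<in> topspace X. \<forall>g \<in> carrier G. \<phi> g x = x) \<or>
     (\<exists>x \<in> topspace X. \<exists>y \<in> topspace X. x \<noteq> y \<and> (\<forall>g \<in> carrier G. \<phi> g ` {x, y} = {x, y}))"

definition continuum :: "'a topology \<Rightarrow> bool" where
  "continuum X \<longleftrightarrow>
     topspace X \<noteq> {} \<and> connected_space X \<and> compact_space X \<and> metrizable_space X"

definition simple_closed_curve_in :: "'a topology \<Rightarrow> 'a set \<Rightarrow> bool" where
  "simple_closed_curve_in X C \<longleftrightarrow>
     C \<subseteq> topspace X \<and> subtopology X C homeomorphic_space top_of_set (sphere (0::complex) 1)"

definition dendrite :: "'a topology \<Rightarrow> bool" where
  "dendrite X \<longleftrightarrow>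
     continuum X \<and> locally_connected_space X \<and> (\<nexists>C. simple_closed_curve_in X C)"

text \<open>
  On the interval or the circle, the components of the complement of a finite set \<open>B\<close> are
  intervals with endpoints in \<open>B\<close> (or, for the interval, at its two ends). Values on \<open>B\<close> itself
  are left open: below, only homeomorphisms are considered, and continuity determines them.
  The case \<open>B = {}\<close> is that of a single piece, the whole space.
\<close>

definition piecewise_in :: "'a topology \<Rightarrow> ('a \<Rightarrow> 'a) set \<Rightarrow> 'a set \<Rightarrow> ('a \<Rightarrow> 'a) \<Rightarrow> bool" where
  "piecewise_in X \<Phi> P f \<longleftrightarrow>
     (\<exists>B. finite B \<and> B \<subseteq> P \<and>
        (\<forall>C \<in> connected_components_of (subtopology X (topspace X - B)).
           \<exists>\<phi> \<in> \<Phi>. \<forall>x \<in> C. f x = \<phi> x))"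

definition unit_interval :: "real topology" where
  "unit_interval = top_of_set {0..1}"

text \<open>
  The library's \<open>dyadics\<close> are the nonnegative dyadic rationals, which suffices inside \<open>[0,1]\<close>.
\<close>

definition thompson_F :: "(real \<Rightarrow> real) monoid" where
  "thompson_F =
     (homeo_group unit_interval)
       \<lparr>carrier := {f \<in> carrier (homeo_group unit_interval).
          strict_mono_on {0..1} f \<and>
          piecewise_in unit_interval {\<lambda>x. 2 powi k * x + c | (k :: int) (c :: real). True}
            ({0..1} \<inter> dyadics) f}\<rparr>"

text \<open>\<open>None\<close> is the point at infinity of the projective line.\<close>

definition P1 :: "real option topology" where
  "P1 = Alexandroff_compactification euclideanreal"

definition moebius_P1 :: "real^2^2 \<Rightarrow> real option \<Rightarrow> real option" where
  "moebius_P1 M z =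
     (case z of
        Some x \<Rightarrow> if M$2$1 * x + M$2$2 = 0 then None
                  else Some ((M$1$1 * x + M$1$2) / (M$2$1 * x + M$2$2))
      | None \<Rightarrow> if M$2$1 = 0 then None else Some (M$1$1 / M$2$1))"

definition SL2 :: "real set \<Rightarrow> (real^2^2) set" where
  "SL2 A = {M. (\<forall>i j. M$i$j \<in> A) \<and> det M = 1}"

text \<open>
  Two matrices in \<open>SL2\<close> induce the same transformation iff they agree up to sign, so
  \<open>PSL2\<close> is identified with its image in the group of transformations of the projective line.
\<close>

definition PSL2 :: "real set \<Rightarrow> (real option \<Rightarrow> real option) set" where
  "PSL2 A = moebius_P1 ` SL2 A"

definition hyperbolic_in_PSL2 :: "real set \<Rightarrow> (real option \<Rightarrow> real option) \<Rightarrow> bool" where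
  "hyperbolic_in_PSL2 A h \<longleftrightarrow> (\<exists>M \<in> SL2 A. h = moebius_P1 M \<and> \<bar>trace M\<bar> > 2)"

definition hyperbolic_fixpoints :: "real set \<Rightarrow> real option set" where
  "hyperbolic_fixpoints A = {z. \<exists>h. hyperbolic_in_PSL2 A h \<and> h z = z}"

definition piecewise_proj_group :: "real set \<Rightarrow> (real option \<Rightarrow> real option) monoid" where
  "piecewise_proj_group A =
     (homeo_group P1)
       \<lparr>carrier := {f \<in> carrier (homeo_group P1).
          piecewise_in P1 (PSL2 A) (hyperbolic_fixpoints A) f}\<rparr>"

definition piecewise_proj_line_group :: "real set \<Rightarrow> (real option \<Rightarrow> real option) monoid" where
  "piecewise_proj_line_group A =
     (piecewise_proj_group A)
       \<lparr>carrier := stabilizer (piecewise_proj_group A) (\<lambda>f. f) None\<rparr>"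

end

theory Submission
  imports Defs "HOL-Probability.Discrete_Topology"
begin

text \<open>
  The proof is a ping-pong argument against commutation.

  On the side of the groups: near each of the two ends of the interval or the line, an element
  of Thompson's group or of the piecewise projective group is an affine map. The affine group is
  metabelian, so an element of the form [[a,b],[c,d]] is the identity near both ends, and given
  two such elements n and m, some element h of the group moves a compact set that supports both
  off itself. Then the conjugates of n and m by h commute with both n and m
  (thompson_F_commuting_conjugates, piecewise_proj_line_group_commuting_conjugates).

  On the side of the dendrite X: an interior point of an arc in X separates the ends of the arc,
  since otherwise there would be a simple closed curve (dendrite_imp_dendron). So X can be
  studied through the sides of its points, which are unions of components of the complement of a
  point. Suppose that a group acts on X without invariant point or pair, and replace X by a
  minimal invariant subcontinuum. By compactness, each side A contains the image of its
  complement under some element (push_complement_into_side). Consequently, for disjoint sides U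
  and V, some element maps the complement of V into U, and ping-pong in smaller sides shows that
  double commutators with this property exist as well (pushing_comms). The smaller sides exist
  because X has at least three endpoints: the set of endpoints is invariant and has more than
  one element.

  The two sides are incompatible. Let n and m be double commutators that play ping-pong on four
  disjoint sides, and suppose that the conjugates of n and m by h commute with n and m. The
  limit points of the powers of the conjugate of n form a set that is invariant under n and m,
  hence meets at least three of the four sides; the same holds for the conjugate of m. But the
  limit points of the two conjugates lie on different sides of the boundary points of two
  translated sides, and each of three disjoint connected sets would have to contain one of these
  two points (pushing_conjugates_do_not_commute).
\<close>

section \<open>Paths in complete locally connected spaces\<close>

text \<open>
  Two points of S are linked at scale n when a connected subset of S of diameter at most 2^-n
  contains both. Local connectedness makes every point linked to all nearby ones.
\<close>

definition linked :: "'a::metric_space set \<Rightarrow> nat \<Rightarrow> 'a \<Rightarrow> 'a \<Rightarrow> bool" where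
  "linked S n x y \<longleftrightarrow>
     (\<exists>C\<subseteq>S. connected C \<and> x \<in> C \<and> y \<in> C \<and> (\<forall>u\<in>C. \<forall>v\<in>C. dist u v \<le> (1/2)^n))"

lemma linked_refl: "x \<in> S \<Longrightarrow> linked S n x x"
  unfolding linked_def by (intro exI[of _ "{x}"]) auto

lemma linked_sym: "linked S n x y \<Longrightarrow> linked S n y x"
  unfolding linked_def by blast

lemma linked_dist: "linked S n x y \<Longrightarrow> dist x y \<le> (1/2)^n"
  unfolding linked_def by blast

lemma linked_mem: "linked S n x y \<Longrightarrow> x \<in> S \<and> y \<in> S"
  unfolding linked_def by blast

lemma linked_neighbourhood:
  fixes S :: "'a::metric_space set"
  assumes "locally connected S" "openin (top_of_set S) V" "c \<in> V"
  obtains U where "openin (top_of_set S) U" "c \<in> U" "U \<subseteq> V" "\<And>v. v \<in> U \<Longrightarrow> linked S n c v"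
proof -
  define r :: real where "r = (1/2)^n / 2"
  have "r > 0" by (simp add: r_def)
  have "openin (top_of_set S) (V \<inter> (S \<inter> ball c r))"
    using assms(2) by (intro openin_Int openin_open_Int) auto
  moreover have "c \<in> V \<inter> (S \<inter> ball c r)"
    using assms \<open>r > 0\<close> openin_subset[OF assms(2)] by auto
  ultimately obtain U where U: "openin (top_of_set S) U" "connected U" "c \<in> U" "U \<subseteq> V \<inter> (S \<inter> ball c r)"
    using assms(1) unfolding locally_connected by blast
  have "dist u v \<le> (1/2)^n" if "u \<in> U" "v \<in> U" for u v
  proof -
    have "dist c u < r" "dist c v < r" using that U(4) by auto
    then have "dist u v \<le> r + r"
      using dist_triangle3[of u v c] by linarith
    then show ?thesis by (simp add: r_def)
  qed
  then have "linked S n c v" if "v \<in> U" for v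
    using U that unfolding linked_def by (intro exI[of _ U]) auto
  then show ?thesis using U that by blast
qed

text \<open>
  A connected set cannot be split into the points that are reachable by links of the finer scale
  and the other ones, because both parts are relatively open. All links stay inside the
  connected set that joins x to y, which bounds the distances from x.
\<close>

lemma linked_chain:
  fixes S :: "'a::metric_space set"
  assumes S: "locally connected S" and xy: "linked S n x y"
  obtains m p where "p 0 = x" "p m = y" "\<And>i. i \<le> m \<Longrightarrow> dist x (p i) \<le> (1/2)^n"
    "\<And>i. i < m \<Longrightarrow> linked S (Suc n) (p i) (p (Suc i))"
proof -
  obtain C where C: "C \<subseteq> S" "connected C" "x \<in> C" "y \<in> C" "\<And>u v. u \<in> C \<Longrightarrow> v \<in> C \<Longrightarrow> dist u v \<le> (1/2)^n"
    using xy unfolding linked_def by blast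
  define R where "R = (\<lambda>u v. u \<in> C \<and> v \<in> C \<and> linked S (Suc n) u v)"
  have "R\<^sup>*\<^sup>* x y"
  proof (rule connected_equivalence_relation[OF C(2-4)])
    show "R\<^sup>*\<^sup>* v u" if "R\<^sup>*\<^sup>* u v" "u \<in> C" "v \<in> C" for u v
    proof -
      have "symp R" by (auto simp: R_def symp_def intro: linked_sym)
      then show ?thesis using that(1) symp_rtranclp sympD by metis
    qed
    show "R\<^sup>*\<^sup>* u w" if "R\<^sup>*\<^sup>* u v" "R\<^sup>*\<^sup>* v w" "u \<in> C" "v \<in> C" "w \<in> C" for u v w
      using that by simp
    show "\<exists>T. openin (top_of_set C) T \<and> a \<in> T \<and> (\<forall>v\<in>T. R\<^sup>*\<^sup>* a v)" if a: "a \<in> C" for a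
    proof -
      obtain U where U: "openin (top_of_set S) U" "a \<in> U" "\<And>v. v \<in> U \<Longrightarrow> linked S (Suc n) a v"
        using linked_neighbourhood[OF S, of S a "Suc n"] a C(1) by (metis openin_subtopology_self subsetD)
      have "openin (top_of_set C) (C \<inter> U)"
        using U(1) C(1) by (metis openin_subtopology_Int2 inf.absorb_iff2 subtopology_subtopology)
      moreover have "R\<^sup>*\<^sup>* a v" if "v \<in> C \<inter> U" for v
        using that a U(3) by (auto simp: R_def)
      ultimately show ?thesis using a U(2) by blast
    qed
  qed
  then obtain m where "(R ^^ m) x y" using rtranclp_imp_relpowp by fastforce
  then obtain p where p: "p 0 = x" "p m = y" "\<And>i. i < m \<Longrightarrow> R (p i) (p (Suc i))"
    unfolding relpowp_fun_conv by blast
  have "p i \<in> C" if "i \<le> m" for i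
  proof (cases "i = m")
    case False then show ?thesis using p(3)[of i] that by (auto simp: R_def)
  qed (use p C in simp)
  then show ?thesis using that[of p m] p C by (auto simp: R_def)
qed

text \<open>
  One step of the construction of a path: every link of a chain is replaced by a chain of finer
  links. The new chains have different lengths; padding them with copies of their last points
  gives all of them the common length M, so that index i of the old chain becomes index M * i of
  the new one.
\<close>

lemma linked_chain_refine:
  fixes S :: "'a::metric_space set"
  assumes S: "locally connected S" and N: "N > 0"
    and p: "\<And>i. i < N \<Longrightarrow> linked S n (p i) (p (Suc i))"
  obtains M q where "M > 0" "\<And>i. i \<le> N \<Longrightarrow> q (M * i) = p i"
    "\<And>i j. i < N \<Longrightarrow> j < M \<Longrightarrow> dist (p i) (q (M * i + j)) \<le> (1/2)^n"
    "\<And>k. k < N * M \<Longrightarrow> linked S (Suc n) (q k) (q (Suc k))"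
proof -
  have "\<forall>i. \<exists>m c. i < N \<longrightarrow> c 0 = p i \<and> c m = p (Suc i) \<and> (\<forall>j\<le>m. dist (p i) (c j) \<le> (1/2)^n)
      \<and> (\<forall>j<m. linked S (Suc n) (c j) (c (Suc j)))"
    using linked_chain[OF S p] by (metis (full_types))
  then obtain m c where c: "\<And>i. i < N \<Longrightarrow> c i 0 = p i"  "\<And>i. i < N \<Longrightarrow> c i (m i) = p (Suc i)"
     "\<And>i j. i < N \<Longrightarrow> j \<le> m i \<Longrightarrow> dist (p i) (c i j) \<le> (1/2)^n"
     "\<And>i j. i < N \<Longrightarrow> j < m i \<Longrightarrow> linked S (Suc n) (c i j) (c i (Suc j))"
    by metis
  define M where "M = Suc (\<Sum>i<N. m i)"
  have M0: "M > 0" by (simp add: M_def)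
  have mM: "m i < M" if "i < N" for i
    using member_le_sum[of i "{..<N}" m] that by (simp add: M_def less_Suc_eq_le)
  define q where "q = (\<lambda>k. if k div M < N then c (k div M) (min (k mod M) (m (k div M))) else p N)"
  have q1: "q (M * i + j) = c i (min j (m i))" if "i < N" "j < M" for i j
    using that by (simp add: q_def)
  have q2: "q (M * i) = p i" if "i \<le> N" for i
  proof (cases "i = N")
    case True then show ?thesis using M0 by (simp add: q_def)
  next
    case False then show ?thesis using q1[of i 0] c(1)[of i] that by (simp add: M_def)
  qed
  show ?thesis
  proof (rule that[of M q])
    show "M > 0" by (fact M0)
    show "q (M * i) = p i" if "i \<le> N" for i using q2 that .
    show "dist (p i) (q (M * i + j)) \<le> (1/2)^n" if "i < N" "j < M" for i j
      using q1[OF that] c(3)[OF that(1)] by simp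
    show "linked S (Suc n) (q k) (q (Suc k))" if k: "k < N * M" for k
    proof -
      define i j where "i = k div M" and "j = k mod M"
      have ij: "k = M * i + j" "j < M" "i < N"
        using k M0 by (auto simp: i_def j_def less_mult_imp_div_less)
      have pS: "p (Suc i) \<in> S" using p[OF ij(3)] linked_mem by blast
      show ?thesis
      proof (cases "Suc j < M")
        case True
        have "q (Suc k) = c i (min (Suc j) (m i))" using q1[OF ij(3) True] ij(1) by simp
        moreover have "q k = c i (min j (m i))" using q1[OF ij(3,2)] ij(1) by simp
        ultimately show ?thesis
          using c(4)[OF ij(3), of j] c(2)[OF ij(3)] linked_refl[OF pS]
          by (cases "j < m i") (auto simp: min_def not_less le_Suc_eq)
      next
        case False
        then have j: "Suc j = M" using ij(2) by simp
        then have "Suc k = M * Suc i" using ij(1) by simp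
        then have "q (Suc k) = p (Suc i)" using q2[of "Suc i"] ij(3) by simp
        moreover have "min j (m i) = m i" using mM[OF ij(3)] j by simp
        then have "q k = p (Suc i)" using q1[OF ij(3,2)] ij(1) c(2)[OF ij(3)] by simp
        ultimately show ?thesis using linked_refl[OF pS] by simp
      qed
    qed
  qed
qed

lemma div_floor_mult:
  assumes "r \<ge> 0" "M > 0"
  shows "nat \<lfloor>r * real M\<rfloor> div M = nat \<lfloor>r\<rfloor>"
proof -
  have "\<lfloor>r\<rfloor> = \<lfloor>(r * real M) / real_of_int (int M)\<rfloor>" using assms by simp
  also have "\<dots> = \<lfloor>r * real M\<rfloor> div int M" by (rule floor_divide_real_eq_div) simp
  finally show ?thesis using assms by (simp add: nat_div_distrib)
qed

text \<open>
  A Peano-type construction. Chains from x to y with ever finer links, each refining the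
  previous one, are read as step functions on [0,1]. They form a uniform Cauchy sequence, and
  although the step functions jump, their jumps at stage n are at most 2^-(n0+n), so the limit
  is continuous.
\<close>

lemma linked_imp_path:
  fixes S :: "'a::complete_space set"
  assumes S: "locally connected S" "closed S" and xy: "linked S n0 x y"
  obtains g where "path g" "path_image g \<subseteq> S" "pathstart g = x" "pathfinish g = y"
    "\<And>z. z \<in> path_image g \<Longrightarrow> dist x z \<le> 4 * (1/2)^n0"
proof -
  define P where "P = (\<lambda>n (N::nat, p :: nat \<Rightarrow> 'a). N > 0 \<and> p 0 = x \<and> p N = y \<and>
      (\<forall>i<N. linked S (n0 + n) (p i) (p (Suc i))) \<and> (n = 0 \<longrightarrow> N = 1))"
  define Q where "Q = (\<lambda>n (N::nat, p :: nat \<Rightarrow> 'a) (N'::nat, q :: nat \<Rightarrow> 'a). \<exists>M>0. N' = N * M \<and>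
      (\<forall>i<N. \<forall>j<M. dist (p i) (q (M * i + j)) \<le> (1/2)^(n0 + n)))"
  have "\<exists>s. \<forall>n. P n (s n) \<and> Q n (s n) (s (Suc n))"
  proof (rule dependent_nat_choice)
    show "\<exists>a. P 0 a"
      using xy by (intro exI[of _ "(1, \<lambda>i. if i = 0 then x else y)"]) (simp add: P_def)
    show "\<exists>b. P (Suc n) b \<and> Q n a b" if "P n a" for a n
    proof -
      obtain N p where a: "a = (N, p)" by force
      have Np: "N > 0" "p 0 = x" "p N = y" "\<And>i. i < N \<Longrightarrow> linked S (n0 + n) (p i) (p (Suc i))"
        using that by (auto simp: a P_def)
      obtain M q where Mq: "M > 0" "\<And>i. i \<le> N \<Longrightarrow> q (M * i) = p i"
        "\<And>i j. i < N \<Longrightarrow> j < M \<Longrightarrow> dist (p i) (q (M * i + j)) \<le> (1/2)^(n0 + n)"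
        "\<And>k. k < N * M \<Longrightarrow> linked S (Suc (n0 + n)) (q k) (q (Suc k))"
        using linked_chain_refine[where p=p and n="n0+n", OF S(1) Np(1) Np(4)] by metis
      have "P (Suc n) (N * M, q)"
        using Np Mq(1,4) Mq(2)[of 0] Mq(2)[of N] by (simp add: P_def mult.commute)
      moreover have "Q n a (N * M, q)" using Mq(1,3) by (auto simp: a Q_def)
      ultimately show ?thesis by blast
    qed
  qed
  then obtain s where s: "\<And>n. P n (s n)" "\<And>n. Q n (s n) (s (Suc n))" by blast
  define N p where "N = (\<lambda>n. fst (s n))" and "p = (\<lambda>n. snd (s n))"
  have N: "N n > 0" "p n 0 = x" "p n (N n) = y" "\<And>i. i < N n \<Longrightarrow> linked S (n0 + n) (p n i) (p n (Suc i))" for n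
    using s(1)[of n] by (auto simp: P_def N_def p_def split: prod.splits)
  have N0: "N 0 = 1" using s(1)[of 0] by (auto simp: P_def N_def split: prod.splits)
  have Q: "\<exists>M>0. N (Suc n) = N n * M \<and>
      (\<forall>i<N n. \<forall>j<M. dist (p n i) (p (Suc n) (M * i + j)) \<le> (1/2)^(n0 + n))" for n
    using s(2)[of n] by (auto simp: Q_def N_def p_def split: prod.splits)
  \<comment> \<open>The chain of stage n is traversed at constant speed; multiplying its number of links by M
    refines the grid, so that the old index of t is the new one divided by M.\<close>
  define f where "f = (\<lambda>n t. p n (nat \<lfloor>t * real (N n)\<rfloor>))"
  have idx: "nat \<lfloor>t * real (N n)\<rfloor> < N n \<or> t = 1 \<and> nat \<lfloor>t * real (N n)\<rfloor> = N n" if "t \<in> {0..1}" for t n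
  proof (cases "t = 1")
    case False
    then have "t * real (N n) < 1 * real (N n)" using that N(1)[of n] by (intro mult_strict_right_mono) auto
    then have "\<lfloor>t * real (N n)\<rfloor> < int (N n)" by linarith
    then show ?thesis using N(1)[of n] by linarith
  qed simp
  have f1: "f n 1 = y" and f0: "f n 0 = x" for n by (simp_all add: f_def N)
  have fS: "f n t \<in> S" if "t \<in> {0..1}" for n t
  proof (cases "t = 1")
    case True
    have "y \<in> S" using xy linked_mem by blast
    then show ?thesis using True f1 by simp
  next
    case False
    then show ?thesis using idx[OF that, of n] N(4) linked_mem unfolding f_def by blast
  qed
  have step: "dist (f n t) (f (Suc n) t) \<le> (1/2)^(n0 + n)" if t: "t \<in> {0..1}" for n t
  proof (cases "t = 1")
    case True then show ?thesis using f1 by simp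
  next
    case False
    obtain M where M: "M > 0" "N (Suc n) = N n * M"
      "\<And>i j. i<N n \<Longrightarrow> j<M \<Longrightarrow> dist (p n i) (p (Suc n) (M * i + j)) \<le> (1/2)^(n0 + n)"
      using Q[of n] by blast
    define k where "k = nat \<lfloor>t * real (N (Suc n))\<rfloor>"
    have "k div M = nat \<lfloor>t * real (N n)\<rfloor>"
      using div_floor_mult[of "t * real (N n)" M] t M(1,2) by (simp add: k_def mult.assoc)
    then have "f n t = p n (k div M)" "k div M < N n"
      using idx[OF t, of n] False by (auto simp: f_def)
    moreover have "f (Suc n) t = p (Suc n) (M * (k div M) + k mod M)"
      by (simp add: f_def k_def)
    ultimately show ?thesis using M(3)[of "k div M" "k mod M"] M(1) by simp
  qed
  have far: "dist (f n t) (f (n + k) t) \<le> 2 * (1/2)^(n0 + n) - 2 * (1/2)^(n0 + n + k)" if t: "t \<in> {0..1}" for n k t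
  proof (induction k)
    case (Suc k)
    have "dist (f n t) (f (n + Suc k) t) \<le> dist (f n t) (f (n + k) t) + dist (f (n + k) t) (f (Suc (n + k)) t)"
      using dist_triangle by simp
    also have "\<dots> \<le> 2 * (1/2)^(n0 + n) - 2 * (1/2)^(n0 + n + k) + (1/2)^(n0 + (n + k))"
      using Suc step[OF t, of "n + k"] by linarith
    finally show ?case by (simp add: algebra_simps)
  qed simp
  have far': "dist (f n t) (f m t) \<le> 2 * (1/2)^(n0 + n)" if t: "t \<in> {0..1}" "n \<le> m" for n m t
  proof -
    have "(0::real) \<le> (1/2)^(n0 + n + (m - n))" by simp
    moreover have "n + (m - n) = m" using t(2) by simp
    ultimately show ?thesis using far[OF t(1), of n "m - n"] by (smt (verit))
  qed
  have half: "(\<lambda>n. c * (1/2::real)^(n0 + n)) \<longlonglongrightarrow> 0" for c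
  proof -
    have "(\<lambda>n. (c * (1/2)^n0) * (1/2::real)^n) \<longlonglongrightarrow> (c * (1/2)^n0) * 0"
      by (intro tendsto_mult tendsto_const LIMSEQ_power_zero) simp
    then show ?thesis by (simp add: power_add mult.assoc)
  qed
  have small: "\<exists>n. c * (1/2::real)^(n0 + n) < e" if "e > 0" for e c
    using order_tendstoD(2)[OF half that] by (auto simp: eventually_sequentially)
  have conv: "convergent (\<lambda>n. f n t)" if t: "t \<in> {0..1}" for t
  proof -
    have "Cauchy (\<lambda>n. f n t)"
    proof (rule metric_CauchyI)
      fix e :: real assume "e > 0"
      then obtain n where n: "4 * (1/2)^(n0 + n) < e" using small by blast
      have "dist (f i t) (f j t) < e" if "i \<ge> n" "j \<ge> n" for i j
        using dist_triangle3[of "f i t" "f j t" "f n t"] far'[OF t that(1)] far'[OF t that(2)] n by linarith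
      then show "\<exists>M. \<forall>m\<ge>M. \<forall>n\<ge>M. dist (f m t) (f n t) < e" by blast
    qed
    then show ?thesis by (rule Cauchy_convergent)
  qed
  define g where "g = (\<lambda>t. lim (\<lambda>n. f n t))"
  have lim: "(\<lambda>n. f n t) \<longlonglongrightarrow> g t" if "t \<in> {0..1}" for t
    using conv[OF that] by (simp add: g_def convergent_LIMSEQ_iff)
  have gf: "dist (f n t) (g t) \<le> 2 * (1/2)^(n0 + n)" if t: "t \<in> {0..1}" for n t
  proof (rule Lim_bounded)
    show "(\<lambda>m. dist (f n t) (f m t)) \<longlonglongrightarrow> dist (f n t) (g t)"
      using lim[OF t] by (intro tendsto_intros)
    show "\<forall>m\<ge>n. dist (f n t) (f m t) \<le> 2 * (1/2)^(n0 + n)" using far'[OF t] by blast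
  qed
  have gS: "g t \<in> S" if "t \<in> {0..1}" for t
    using closed_sequentially[OF S(2) _ lim[OF that]] fS[OF that] by blast
  \<comment> \<open>Parameters that differ by less than one grid step have equal or adjacent indices.\<close>
  have fclose: "dist (f n t) (f n u) \<le> (1/2)^(n0 + n)"
    if tu: "t \<in> {0..1}" "u \<in> {0..1}" "t \<le> u" "u - t < 1 / real (N n)" for n t u
  proof -
    define i j where "i = nat \<lfloor>t * real (N n)\<rfloor>" and "j = nat \<lfloor>u * real (N n)\<rfloor>"
    have "u * real (N n) - t * real (N n) < 1"
      using tu(4) N(1)[of n] by (simp add: field_simps)
    moreover have "t * real (N n) \<le> u * real (N n)" using tu(3) by (simp add: mult_right_mono)
    moreover have "0 \<le> t * real (N n)" using tu(1) by simp
    ultimately have ij: "i \<le> j" "j \<le> Suc i" unfolding i_def j_def by linarith+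
    have "j \<le> N n" using idx[OF tu(2), of n] by (auto simp: j_def)
    show ?thesis
    proof (cases "i = j")
      case False
      then have "j = Suc i" "i < N n" using ij \<open>j \<le> N n\<close> by auto
      then show ?thesis using linked_dist[OF N(4)] by (simp add: f_def i_def[symmetric] j_def[symmetric])
    qed (simp add: f_def i_def[symmetric] j_def[symmetric])
  qed
  have cont: "continuous_on {0..1} g"
    unfolding continuous_on_iff
  proof (intro ballI allI impI)
    fix t :: real and e :: real assume t: "t \<in> {0..1}" and "e > 0"
    then obtain n where n: "5 * (1/2)^(n0 + n) < e" using small by blast
    have "dist (g u) (g t) < e" if u: "u \<in> {0..1}" "dist u t < 1 / real (N n)" for u
    proof -
      have "dist (f n u) (f n t) \<le> (1/2)^(n0 + n)"
        using fclose[OF u(1) t] fclose[OF t u(1)] u(2)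
        by (cases "u \<le> t") (auto simp: dist_real_def dist_commute)
      then show ?thesis
        using gf[OF t, of n] gf[OF u(1), of n] n dist_triangle[of "g u" "g t" "f n u"]
          dist_triangle[of "f n u" "g t" "f n t"] dist_commute[of "g u" "f n u"] by linarith
    qed
    moreover have "1 / real (N n) > 0" using N(1) by simp
    ultimately show "\<exists>d>0. \<forall>x'\<in>{0..1}. dist x' t < d \<longrightarrow> dist (g x') (g t) < e" by blast
  qed
  show ?thesis
  proof (rule that[of g])
    show "path g" using cont by (simp add: path_def)
    show "path_image g \<subseteq> S" using gS by (auto simp: path_image_def)
    show "pathstart g = x" "pathfinish g = y"
      by (simp_all add: pathstart_def pathfinish_def g_def f0 f1)
    show "dist x z \<le> 4 * (1/2)^n0" if "z \<in> path_image g" for z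
    proof -
      have "z \<in> g ` {0..1}" using that by (simp add: path_image_def)
      then obtain t where t: "t \<in> {0..1}" "z = g t" by blast
      have "f 0 t = x \<or> f 0 t = y" using idx[OF t(1), of 0] N(2)[of 0] N(3)[of 0] N0 by (auto simp: f_def)
      then have "dist x (f 0 t) \<le> (1/2)^n0" using linked_dist[OF xy] by auto
      moreover have "dist (f 0 t) z \<le> 2 * (1/2)^n0" using gf[OF t(1), of 0] t(2) by simp
      moreover have "(0::real) \<le> (1/2)^n0" by simp
      ultimately show ?thesis using dist_triangle[of x z "f 0 t"] by linarith
    qed
  qed
qed

lemma complete_locally_connected_imp_locally_path_connected:
  fixes S :: "'a::complete_space set"
  assumes S: "locally connected S" "closed S"
  shows "locally path_connected S"
  unfolding locally_path_connected_im_kleinen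
proof (intro allI impI)
  fix V x assume V: "openin (top_of_set S) V \<and> x \<in> V"
  obtain e where e: "e > 0" "ball x e \<inter> S \<subseteq> V"
    using V unfolding openin_contains_ball by (auto simp: Int_commute)
  obtain n where "(1/2::real)^n < e / 4" 
    using real_arch_pow_inv[of "e/4" "1/2"] e(1) by auto
  then have n: "4 * (1/2::real)^n < e" by simp
  obtain U where U: "openin (top_of_set S) U" "x \<in> U" "U \<subseteq> V" "\<And>v. v \<in> U \<Longrightarrow> linked S n x v"
    using linked_neighbourhood[OF S(1), of V x n] V by blast
  have "\<exists>p. path p \<and> path_image p \<subseteq> V \<and> pathstart p = x \<and> pathfinish p = y" if y: "y \<in> U" for y
  proof -
    obtain g where g: "path g" "path_image g \<subseteq> S" "pathstart g = x" "pathfinish g = y"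
      "\<And>z. z \<in> path_image g \<Longrightarrow> dist x z \<le> 4 * (1/2)^n"
      using linked_imp_path[OF S U(4)[OF y]] by blast
    have "z \<in> V" if "z \<in> path_image g" for z
      using g(2) g(5)[OF that] that n e(2) by (meson IntI le_less_trans mem_ball subsetD)
    then have "path_image g \<subseteq> V" by blast
    then show ?thesis using g by blast
  qed
  then show "\<exists>U. openin (top_of_set S) U \<and> x \<in> U \<and> U \<subseteq> V \<and>
      (\<forall>y. y \<in> U \<longrightarrow> (\<exists>p. path p \<and> path_image p \<subseteq> V \<and> pathstart p = x \<and> pathfinish p = y))"
    using U by blast
qed

lemma complete_locally_connected_arc:
  fixes S :: "'a::{complete_space,real_normed_vector} set"
  assumes S: "locally connected S" "closed S"
    and U: "openin (top_of_set S) U" "connected U" "x \<in> U" "y \<in> U" "x \<noteq> y"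
  obtains g where "arc g" "path_image g \<subseteq> U" "pathstart g = x" "pathfinish g = y"
proof -
  have "locally path_connected U"
    using locally_open_subset[OF complete_locally_connected_imp_locally_path_connected[OF S] U(1)] .
  then have "path_connected U"
    using U(2) by (simp add: path_connected_component_set path_component_eq_connected_component_set
        connected_component_eq_self)
  then show ?thesis using that U(3-5) unfolding path_connected_arcwise by blast
qed

section \<open>Interior points of arcs in a dendrite are separating\<close>

text \<open>
  Around the parameter of z there is a maximal open interval on which g stays off k. At its ends
  g meets k, so that this piece of g, together with the piece of k between the same two points,
  closes up.
\<close>

lemma two_arcs_simple_closed_curve:
  fixes g k :: "real \<Rightarrow> 'a::{complete_space,real_normed_vector}"
  assumes g: "arc g" and k: "arc k"
    and ends: "pathstart g = pathstart k" "pathfinish g = pathfinish k"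
    and z: "z \<in> path_image g" "z \<notin> path_image k"
  obtains \<gamma> where "simple_path \<gamma>" "pathfinish \<gamma> = pathstart \<gamma>" "path_image \<gamma> \<subseteq> path_image g \<union> path_image k"
proof -
  have "z \<in> g ` {0..1}" using z(1) by (simp add: path_image_def)
  then obtain t0 where t0: "t0 \<in> {0..1}" "g t0 = z" by blast
  define J where "J = {t \<in> {0..1}. g t \<in> path_image k}"
  have "continuous_on {0..1} g" using arc_imp_path[OF g] by (simp add: path_def)
  moreover have "closed (path_image k)" using closed_path_image[OF arc_imp_path[OF k]] .
  ultimately have "closed J"
    using continuous_closed_preimage[of "{0..1}" g "path_image k"]
    by (simp add: J_def Int_def vimage_def)
  have J01: "0 \<in> J" "1 \<in> J"
    using ends pathstart_in_path_image[of k] pathfinish_in_path_image[of k]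
    by (auto simp: J_def pathstart_def pathfinish_def)
  have "J \<subseteq> {0..1}" by (auto simp: J_def)
  then have "bounded J" by (rule bounded_subset[OF bounded_closed_interval])
  then have "compact J" using \<open>closed J\<close> by (simp add: compact_eq_bounded_closed)
  then have "compact (J \<inter> {..t0})" "compact (J \<inter> {t0..})"
    by (simp_all only: compact_Int_closed closed_atMost closed_atLeast)
  moreover have "J \<inter> {..t0} \<noteq> {}" "J \<inter> {t0..} \<noteq> {}" using J01 t0(1) by auto
  ultimately obtain a b where a: "a \<in> J" "a \<le> t0" "\<And>t. t \<in> J \<Longrightarrow> t \<le> t0 \<Longrightarrow> t \<le> a"
    and b: "b \<in> J" "t0 \<le> b" "\<And>t. t \<in> J \<Longrightarrow> t0 \<le> t \<Longrightarrow> b \<le> t"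
  proof -
    assume *: "compact (J \<inter> {..t0})" "compact (J \<inter> {t0..})" "J \<inter> {..t0} \<noteq> {}" "J \<inter> {t0..} \<noteq> {}"
    obtain a where "a \<in> J \<inter> {..t0}" "\<forall>t\<in>J \<inter> {..t0}. t \<le> a" using compact_attains_sup[OF *(1,3)] by blast
    moreover obtain b where "b \<in> J \<inter> {t0..}" "\<forall>t\<in>J \<inter> {t0..}. b \<le> t" using compact_attains_inf[OF *(2,4)] by blast
    ultimately show ?thesis using that[of a b] by simp
  qed
  have "t0 \<notin> J" using t0 z(2) by (simp add: J_def)
  then have ab: "a < t0" "t0 < b" using a(1,2) b(1,2) by (metis order_less_le)+
  have ab01: "a \<in> {0..1}" "b \<in> {0..1}" using a(1) b(1) by (simp_all add: J_def)
  obtain u v where uv: "u \<in> {0..1}" "k u = g b" "v \<in> {0..1}" "k v = g a"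
  proof -
    have "g b \<in> k ` {0..1}" "g a \<in> k ` {0..1}" using a(1) b(1) by (simp_all add: J_def path_image_def)
    then show ?thesis using that by (elim imageE) metis
  qed
  have ginj: "inj_on g {0..1}" using g by (simp add: arc_def)
  have gab: "g a \<noteq> g b" using ab ab01 inj_onD[OF ginj, of a b] by linarith
  then have "u \<noteq> v" using uv by auto
  have "arc (subpath a b g)" "arc (subpath u v k)"
    using arc_subpath_arc[OF g ab01] arc_subpath_arc[OF k uv(1,3)] ab \<open>u \<noteq> v\<close> by simp_all
  moreover have gi: "path_image (subpath a b g) = g ` {a..b}" using ab by (simp add: path_image_subpath)
  have ki: "path_image (subpath u v k) \<subseteq> path_image k" using path_image_subpath_subset[OF uv(1,3)] .
  have "path_image (subpath a b g) \<inter> path_image (subpath u v k) \<subseteq> {g a, g b}"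
  proof
    fix w assume w: "w \<in> path_image (subpath a b g) \<inter> path_image (subpath u v k)"
    then obtain t where t: "t \<in> {a..b}" "w = g t" using gi by auto
    then have "t \<in> J" using w ki ab01 by (auto simp: J_def)
    then have "t \<le> a \<or> b \<le> t" using a(3)[of t] b(3)[of t] by linarith
    then show "w \<in> {g a, g b}" using t by force
  qed
  ultimately have "simple_path (subpath a b g +++ subpath u v k)"
    by (intro simple_path_join_loop) (simp_all add: uv)
  moreover have "path_image (subpath a b g +++ subpath u v k) \<subseteq> path_image g \<union> path_image k"
    using ki path_image_subpath_subset[OF ab01, of g] by (subst path_image_join) (auto simp: uv)
  ultimately show ?thesis using that[of "subpath a b g +++ subpath u v k"] by (simp add: uv)
qed

text \<open>
  If an interior point z of an arc from x to y did not separate x from y, then x and y would lie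
  in one component of S - {z}. That component is open, hence arcwise connected, and a second arc
  from x to y inside it would produce a simple closed curve.
\<close>

lemma no_simple_closed_curve_arc_points_separate:
  fixes S :: "'a::{complete_space,real_normed_vector} set"
  assumes S: "locally connected S" "closed S" "connected S"
    and no_curve: "\<And>\<gamma>. simple_path \<gamma> \<Longrightarrow> pathfinish \<gamma> = pathstart \<gamma> \<Longrightarrow> \<not> path_image \<gamma> \<subseteq> S"
    and xy: "x \<in> S" "y \<in> S" "x \<noteq> y"
  obtains I where "connected I" "compact I" "I \<subseteq> S" "x \<in> I" "y \<in> I"
    "\<And>z. z \<in> I - {x, y} \<Longrightarrow> \<exists>A. openin (top_of_set S) A \<and> openin (top_of_set S) (S - insert z A) \<and>
       z \<notin> A \<and> x \<in> A \<and> y \<in> S - insert z A"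
proof -
  obtain g where g: "arc g" "path_image g \<subseteq> S" "pathstart g = x" "pathfinish g = y"
    using complete_locally_connected_arc[OF S(1,2) _ S(3) xy] by auto
  have "\<exists>A. openin (top_of_set S) A \<and> openin (top_of_set S) (S - insert z A) \<and>
       z \<notin> A \<and> x \<in> A \<and> y \<in> S - insert z A" if z: "z \<in> path_image g - {x, y}" for z
  proof -
    define A where "A = connected_component_set (S - {z}) x"
    have V: "openin (top_of_set S) (S - {z})" by (simp add: openin_delete)
    have comp: "openin (top_of_set S) (connected_component_set (S - {z}) w)" for w
      using S(1) V unfolding locally_connected_open_connected_component
      by (metis connected_component_eq_empty openin_empty)
    have "x \<noteq> z" using z by blast
    then have "x \<in> A" using xy by (simp add: A_def)
    have "z \<notin> A" unfolding A_def using connected_component_subset by fastforce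
    have "openin (top_of_set S) (S - insert z A)"
    proof (subst openin_subopen, intro ballI)
      fix w assume w: "w \<in> S - insert z A"
      have "connected_component_set (S - {z}) w \<inter> A = {}"
        using w connected_component_nonoverlap[of "S - {z}" w x] by (auto simp: A_def)
      then have "connected_component_set (S - {z}) w \<subseteq> S - insert z A"
        using connected_component_subset[of "S - {z}" w] by blast
      then show "\<exists>T. openin (top_of_set S) T \<and> w \<in> T \<and> T \<subseteq> S - insert z A"
        using comp[of w] w by (intro exI[of _ "connected_component_set (S - {z}) w"]) auto
    qed
    moreover have "y \<notin> A"
    proof
      assume "y \<in> A"
      then obtain k where k: "arc k" "path_image k \<subseteq> A" "pathstart k = x" "pathfinish k = y"
        using complete_locally_connected_arc[OF S(1,2) comp[of x, folded A_def] _ \<open>x \<in> A\<close> _ xy(3)]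
        by (auto simp: A_def)
      obtain \<gamma> where "simple_path \<gamma>" "pathfinish \<gamma> = pathstart \<gamma>" "path_image \<gamma> \<subseteq> path_image g \<union> path_image k"
        using two_arcs_simple_closed_curve[OF g(1) k(1), of z] g(3,4) k z \<open>z \<notin> A\<close> by auto
      moreover have "A \<subseteq> S" using connected_component_subset by (force simp: A_def)
      ultimately show False using no_curve[of \<gamma>] g(2) k(2) by blast
    qed
    ultimately show ?thesis
      using comp[of x, folded A_def] \<open>x \<in> A\<close> \<open>z \<notin> A\<close> xy z by auto
  qed
  then show ?thesis
    using that[of "path_image g"] g pathstart_in_path_image[of g] pathfinish_in_path_image[of g]
      connected_arc_image[OF g(1)] compact_arc_image[OF g(1)] by auto
qed

text \<open>
  The Kuratowski embedding, which sends x to the function d x - d b for a base point b. It moves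
  an abstract metrizable space into a Banach space, where the preceding results on arcs apply.
  The functions are indexed by the points with their discrete topology, which makes all of them
  continuous.
\<close>

lemma Metric_space_isometric_embedding:
  fixes M :: "'x set"
  assumes "Metric_space M d"
  obtains e :: "'x \<Rightarrow> ('x discrete, real) bcontfun"
  where "\<And>x y. x \<in> M \<Longrightarrow> y \<in> M \<Longrightarrow> dist (e x) (e y) = d x y"
proof (cases "M = {}")
  case True then show ?thesis using that by auto
next
  case False
  interpret Metric_space M d by fact
  obtain b where b: "b \<in> M" using False by blast
  define f where "f = (\<lambda>x a. if of_discrete a \<in> M then d x (of_discrete a) - d b (of_discrete a) else 0)"
  have bound: "\<bar>d x a - d y a\<bar> \<le> d x y" if "x \<in> M" "y \<in> M" "a \<in> M" for x y a
    using triangle[of x y a] triangle[of y x a] commute[of x y] that by auto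
  have f: "f x \<in> bcontfun" if "x \<in> M" for x
  proof (rule bcontfun_normI)
    show "continuous_on UNIV (f x)" by (simp add: continuous_on_open_vimage open_discrete)
    show "norm (f x a) \<le> d x b" for a using bound[OF that b] by (simp add: f_def)
  qed
  have app: "apply_bcontfun (Bcontfun (f x)) = f x" if "x \<in> M" for x
    by (simp add: Bcontfun_inverse f that)
  have "dist (Bcontfun (f x)) (Bcontfun (f y)) = d x y" if "x \<in> M" "y \<in> M" for x y
  proof (rule antisym)
    show "dist (Bcontfun (f x)) (Bcontfun (f y)) \<le> d x y"
    proof (rule dist_bound)
      show "dist (apply_bcontfun (Bcontfun (f x)) a) (apply_bcontfun (Bcontfun (f y)) a) \<le> d x y" for a
        unfolding app[OF that(1)] app[OF that(2)] using bound[OF that] nonneg by (simp add: dist_real_def f_def)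
    qed
    have "d x y = dist (apply_bcontfun (Bcontfun (f x)) (discrete y)) (apply_bcontfun (Bcontfun (f y)) (discrete y))"
      unfolding app[OF that(1)] app[OF that(2)] using that by (simp add: dist_real_def f_def discrete_inverse)
    also have "\<dots> \<le> dist (Bcontfun (f x)) (Bcontfun (f y))" by (rule dist_bounded)
    finally show "d x y \<le> dist (Bcontfun (f x)) (Bcontfun (f y))" .
  qed
  then show ?thesis using that[of "\<lambda>x. Bcontfun (f x)"] by blast
qed

text \<open>
  A side of z is a union of some, but not all, of the components of the complement of z: sides
  need not be connected, which avoids all discussion of the components themselves. Its frontier
  is exactly z.
\<close>

definition side :: "'a topology \<Rightarrow> 'a \<Rightarrow> 'a set \<Rightarrow> bool" where
  "side X z A \<longleftrightarrow> z \<in> topspace X \<and> z \<notin> A \<and> A \<noteq> {} \<and> topspace X - insert z A \<noteq> {} \<and>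
     openin X A \<and> openin X (topspace X - insert z A)"

text \<open>
  The part of the theory of dendrites that the dynamical argument needs. In contrast to local
  connectedness, it visibly passes to subcontinua.
\<close>

definition dendron :: "'a topology \<Rightarrow> bool" where
  "dendron X \<longleftrightarrow> compact_space X \<and> Hausdorff_space X \<and> connected_space X \<and>
     (\<forall>x\<in>topspace X. \<forall>y\<in>topspace X. \<exists>I. closedin X I \<and> connectedin X I \<and> x \<in> I \<and> y \<in> I \<and>
        (\<forall>z\<in>I - {x, y}. \<exists>A. side X z A \<and> x \<in> A \<and> y \<notin> insert z A))"

lemma compact_metrizable_Banach_embedding:
  assumes "compact_space X" "metrizable_space X"
  obtains e :: "'x \<Rightarrow> ('x discrete, real) bcontfun" and S
  where "homeomorphic_map X (top_of_set S) e"
proof -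
  obtain M d where Md: "Metric_space M d" and X: "X = Metric_space.mtopology M d"
    using assms(2) unfolding metrizable_space_def by metis
  interpret Metric_space M d by fact
  obtain e :: "'x \<Rightarrow> ('x discrete, real) bcontfun" where e: "\<And>x y. x \<in> M \<Longrightarrow> y \<in> M \<Longrightarrow> dist (e x) (e y) = d x y"
    using Metric_space_isometric_embedding[OF Md] by metis
  have "\<exists>U. openin X U \<and> x \<in> U \<and> (\<forall>y\<in>U. e y \<in> ball (e x) r)" if "x \<in> M" "r > 0" for x r
    using that e unfolding X by (intro exI[of _ "mball x r"]) auto
  then have "continuous_map X (Met_TC.mtopology) e"
    unfolding Met_TC.continuous_map_to_metric by (simp add: X)
  then have "continuous_map X (top_of_set (e ` M)) e"
    by (auto simp: continuous_map_in_subtopology X)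
  moreover have "Hausdorff_space (top_of_set (e ` M))"
    by (simp add: Hausdorff_space_subtopology)
  moreover have "inj_on e M"
    by (metis e inj_onI zero)
  ultimately have "homeomorphic_map X (top_of_set (e ` M)) e"
    using assms(1) by (intro continuous_imp_homeomorphic_map) (auto simp: X)
  then show ?thesis by (rule that)
qed

theorem dendrite_imp_dendron:
  fixes X :: "'x topology"
  assumes "dendrite X"
  shows "dendron X"
proof -
  have X: "compact_space X" "metrizable_space X" "connected_space X" "locally_connected_space X"
    and no_curve: "\<nexists>C. simple_closed_curve_in X C"
    using assms by (auto simp: dendrite_def continuum_def)
  obtain e :: "'x \<Rightarrow> ('x discrete, real) bcontfun" and S where e: "homeomorphic_map X (top_of_set S) e"
    using compact_metrizable_Banach_embedding[OF X(1,2)] by metis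
  have hs: "X homeomorphic_space top_of_set S"
    using e homeomorphic_map_imp_homeomorphic_space by blast
  obtain f where f: "homeomorphic_maps X (top_of_set S) e f"
    using e homeomorphic_map_maps by blast
  then have fe: "homeomorphic_map (top_of_set S) X f"
    using homeomorphic_maps_map homeomorphic_maps_sym by blast
  have ef: "\<And>x. x \<in> topspace X \<Longrightarrow> f (e x) = x" "\<And>y. y \<in> S \<Longrightarrow> e (f y) = y"
    using f by (auto simp: homeomorphic_maps_def)
  have eS: "e ` topspace X = S" using homeomorphic_imp_surjective_map[OF e] by simp
  have fX: "f ` S = topspace X" using homeomorphic_imp_surjective_map[OF fe] by simp
  have "compact_space (top_of_set S)" using hs X(1) homeomorphic_compact_space by blast
  then have "compact S" by (simp add: compact_space_subtopology compact_space_def compactin_subtopology)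
  then have S: "closed S" by (rule compact_imp_closed)
  have "connected_space (top_of_set S)" using hs X(3) homeomorphic_connected_space by blast
  then have "connected S" using connectedin_topspace[of "top_of_set S"] by (simp add: connectedin_subtopology)
  have "locally_connected_space (top_of_set S)" using hs X(4) homeomorphic_locally_connected_space by blast
  then have "locally connected S"
    unfolding locally_connected locally_connected_space by (simp add: connectedin_subtopology) metis
  have no: "\<not> path_image \<gamma> \<subseteq> S" if "simple_path \<gamma>" "pathfinish \<gamma> = pathstart \<gamma>" for \<gamma>
  proof
    assume sub: "path_image \<gamma> \<subseteq> S"
    have "path_image \<gamma> homeomorphic sphere (0::complex) 1"
      using homeomorphic_simple_path_image_circle[OF that] by simp
    then obtain p q where "homeomorphism (path_image \<gamma>) (sphere (0::complex) 1) p q"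
      by (auto simp: homeomorphic_def)
    then have "homeomorphic_maps (top_of_set (path_image \<gamma>)) (top_of_set (sphere (0::complex) 1)) p q"
      by (auto simp: homeomorphism_def homeomorphic_maps_def)
    then have h1: "top_of_set (path_image \<gamma>) homeomorphic_space top_of_set (sphere (0::complex) 1)"
      unfolding homeomorphic_space_def by blast
    have "homeomorphic_map (subtopology (top_of_set S) (path_image \<gamma>)) (subtopology X (f ` path_image \<gamma>)) f"
      using homeomorphic_map_subtopologies[OF fe, of "path_image \<gamma>" "f ` path_image \<gamma>"] sub fX by auto
    then have "top_of_set (path_image \<gamma>) homeomorphic_space subtopology X (f ` path_image \<gamma>)"
      using sub homeomorphic_map_imp_homeomorphic_space by (metis inf.absorb_iff2 subtopology_subtopology)
    then have "simple_closed_curve_in X (f ` path_image \<gamma>)"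
      using h1 sub fX unfolding simple_closed_curve_in_def
      by (metis homeomorphic_space_sym homeomorphic_space_trans image_mono)
    then show False using no_curve by blast
  qed
  have "\<exists>I. closedin X I \<and> connectedin X I \<and> x \<in> I \<and> y \<in> I \<and>
        (\<forall>z\<in>I - {x, y}. \<exists>A. side X z A \<and> x \<in> A \<and> y \<notin> insert z A)"
    if xy: "x \<in> topspace X" "y \<in> topspace X" for x y
  proof (cases "x = y")
    case True
    then show ?thesis using xy using closedin_Hausdorff_sing_eq[OF metrizable_imp_Hausdorff_space[OF X(2)]]
      by (intro exI[of _ "{x}"]) auto
  next
    case False
    have exy: "e x \<in> S" "e y \<in> S" using xy eS by auto
    have exy': "e x \<noteq> e y" using xy False ef(1) by metis
    obtain I where I: "connected I" "compact I" "I \<subseteq> S" "e x \<in> I" "e y \<in> I"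
      "\<And>z. z \<in> I - {e x, e y} \<Longrightarrow> \<exists>A. openin (top_of_set S) A \<and> openin (top_of_set S) (S - insert z A) \<and>
       z \<notin> A \<and> e x \<in> A \<and> e y \<in> S - insert z A"
      by (rule no_simple_closed_curve_arc_points_separate[OF \<open>locally connected S\<close> S \<open>connected S\<close> no exy exy'], assumption, assumption, rule that)
    have "connectedin X (f ` I)"
      using homeomorphic_map_connectedness_eq[OF fe, of I] I(1,3) by (auto simp: connectedin_subtopology)
    moreover have "closedin X (f ` I)"
      using homeomorphic_map_closedness_eq[OF fe, of I] I(2,3) by (auto simp: closed_subset compact_imp_closed)
    moreover have "x \<in> f ` I" "y \<in> f ` I" using I(4,5) ef(1) xy by (metis image_eqI)+
    moreover have "\<exists>A. side X z A \<and> x \<in> A \<and> y \<notin> insert z A" if z: "z \<in> f ` I - {x, y}" for z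
    proof -
      obtain w where w: "w \<in> I" "z = f w" using z by blast
      have wS: "w \<in> S" using w I(3) by blast
      have "w \<noteq> e x" "w \<noteq> e y" using z w ef(1) xy by auto
      then obtain A where A: "openin (top_of_set S) A" "openin (top_of_set S) (S - insert w A)"
        "w \<notin> A" "e x \<in> A" "e y \<in> S - insert w A" using I(6)[of w] w by blast
      have AS: "A \<subseteq> S" using A(1) openin_imp_subset by blast
      have inj: "inj_on f S" using ef(2) by (metis inj_onI)
      have img: "f ` (S - insert w A) = topspace X - insert z (f ` A)"
        using inj_on_image_set_diff[OF inj, of S "insert w A"] AS wS fX w by auto
      have "openin X (f ` A)" "openin X (topspace X - insert z (f ` A))"
        using homeomorphic_map_openness_eq[OF fe] A(1,2) img AS by (metis, metis)
      moreover have "x \<in> f ` A" using A(4) ef(1) xy by (metis image_eqI)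
      moreover have "y \<in> topspace X - insert z (f ` A)" using A(5) ef(1) xy img by (metis image_eqI)
      moreover have "z \<notin> f ` A" using A(3) AS wS inj w by (auto simp: inj_on_def)
      ultimately show ?thesis
        unfolding side_def using wS fX w by blast
    qed
    ultimately show ?thesis by blast
  qed
  then show ?thesis
    unfolding dendron_def using X(1,3) metrizable_imp_Hausdorff_space[OF X(2)] by simp
qed

section \<open>Sides, arcs and subcontinua\<close>

lemma side_subset_topspace: "side X z A \<Longrightarrow> insert z A \<subseteq> topspace X"
  unfolding side_def using openin_subset by blast

lemma side_opposite: "side X z A \<Longrightarrow> side X z (topspace X - insert z A)"
proof -
  assume A: "side X z A"
  have "topspace X - insert z (topspace X - insert z A) = A"
    using side_subset_topspace[OF A] A by (auto simp: side_def)
  then show ?thesis using A by (simp add: side_def)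
qed

lemma closedin_side: "side X z A \<Longrightarrow> closedin X (insert z A)"
  using side_subset_topspace[of X z A] by (simp add: side_def closedin_def)

text \<open>
  If insert z A split into two closed parts, the part without z would be clopen in the whole
  space.
\<close>

lemma connectedin_side:
  assumes X: "connected_space X" and A: "side X z A"
  shows "connectedin X (insert z A)"
proof -
  have *: False
    if E: "closedin X E1" "closedin X E2" "insert z A \<subseteq> E1 \<union> E2" "E1 \<inter> E2 \<inter> insert z A = {}"
      "z \<in> E1" "E2 \<inter> insert z A \<noteq> {}" for E1 E2
  proof -
    define Q where "Q = insert z A \<inter> E2"
    have "closedin X Q" unfolding Q_def using closedin_side[OF A] E(2) by blast
    moreover have "Q = A - E1" using E by (auto simp: Q_def)
    then have "openin X Q" using A E(1) by (simp add: side_def openin_diff)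
    ultimately have "Q = {} \<or> Q = topspace X"
      using X connected_space_clopen_in by blast
    moreover have "z \<notin> Q" using E by (auto simp: Q_def)
    ultimately show False using E(6) A by (auto simp: Q_def side_def)
  qed
  show ?thesis
    unfolding connectedin_closedin
  proof (intro conjI notI)
    show "insert z A \<subseteq> topspace X" using side_subset_topspace[OF A] .
    assume "\<exists>E1 E2. closedin X E1 \<and> closedin X E2 \<and> insert z A \<subseteq> E1 \<union> E2 \<and>
      E1 \<inter> E2 \<inter> insert z A = {} \<and> E1 \<inter> insert z A \<noteq> {} \<and> E2 \<inter> insert z A \<noteq> {}"
    then obtain E1 E2 where E: "closedin X E1" "closedin X E2" "insert z A \<subseteq> E1 \<union> E2"
      "E1 \<inter> E2 \<inter> insert z A = {}" "E1 \<inter> insert z A \<noteq> {}" "E2 \<inter> insert z A \<noteq> {}" by blast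
    have "z \<in> E1 \<or> z \<in> E2" using E(3) by blast
    then show False
    proof
      assume "z \<in> E1" then show False using *[of E1 E2] E by blast
    next
      assume "z \<in> E2" then show False using *[of E2 E1] E by (simp add: Un_commute Int_commute)
    qed
  qed
qed

text \<open>
  The frontier of A is z, so a connected set can only leave A through z.
\<close>

lemma connectedin_subset_side:
  assumes "connectedin X C" "side X z A" "z \<notin> C" "C \<inter> A \<noteq> {}"
  shows "C \<subseteq> A"
proof (rule ccontr)
  assume "\<not> C \<subseteq> A"
  then have "(topspace X - insert z A) \<inter> C \<noteq> {}"
    using connectedin_subset_topspace[OF assms(1)] assms(3) by blast
  then show False
    using connectedinD[OF assms(1), of A "topspace X - insert z A"] assms connectedin_subset_topspace[OF assms(1)]
    by (auto simp: side_def)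
qed

lemma side_subset_side:
  assumes "connected_space X" "side X w B" "side X b E" "b \<in> B" "w \<notin> insert b E"
  shows "insert b E \<subseteq> B"
  using connectedin_subset_side[OF connectedin_side[OF assms(1,3)] assms(2,5)] assms(4) by blast

text \<open>
  The continuum I is the arc between x and y. It lies in every connected set C that contains x
  and y, since a point of I outside C would separate x from y, and C would have to stay on one
  side of it.
\<close>

lemma dendron_interval:
  assumes "dendron X" "x \<in> topspace X" "y \<in> topspace X"
  obtains I where "connectedin X I" "closedin X I" "x \<in> I" "y \<in> I"
    "\<And>z. z \<in> I \<Longrightarrow> z \<noteq> x \<Longrightarrow> z \<noteq> y \<Longrightarrow> \<exists>A. side X z A \<and> x \<in> A \<and> y \<notin> insert z A"
    "\<And>C. connectedin X C \<Longrightarrow> x \<in> C \<Longrightarrow> y \<in> C \<Longrightarrow> I \<subseteq> C"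
proof -
  obtain I where I: "connectedin X I" "x \<in> I" "y \<in> I"
    "\<And>z. z \<in> I \<Longrightarrow> z \<noteq> x \<Longrightarrow> z \<noteq> y \<Longrightarrow> \<exists>A. side X z A \<and> x \<in> A \<and> y \<notin> insert z A"
    "closedin X I"
    using assms unfolding dendron_def by (metis DiffI empty_iff insert_iff)
  have "I \<subseteq> C" if C: "connectedin X C" "x \<in> C" "y \<in> C" for C
  proof
    fix z assume "z \<in> I"
    show "z \<in> C"
    proof (rule ccontr)
      assume "z \<notin> C"
      then have "z \<noteq> x" "z \<noteq> y" using C by auto
      then obtain A where "side X z A" "x \<in> A" "y \<notin> insert z A" using I(4)[OF \<open>z \<in> I\<close>] by blast
      then show False using connectedin_subset_side[OF C(1), of z A] \<open>z \<notin> C\<close> C by blast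
    qed
  qed
  then show ?thesis using I that by blast
qed

text \<open>
  Two common points of the family are joined by an arc that lies in every member.
\<close>

lemma dendron_connectedin_Inter:
  assumes X: "dendron X" and "\<C> \<noteq> {}" and conn: "\<And>C. C \<in> \<C> \<Longrightarrow> connectedin X C"
  shows "connectedin X (\<Inter>\<C>)"
proof (cases "\<Inter>\<C> = {}")
  case True then show ?thesis by simp
next
  case False
  then obtain x where x: "x \<in> \<Inter>\<C>" by blast
  have top: "\<Inter>\<C> \<subseteq> topspace X" using assms(2) conn connectedin_subset_topspace by blast
  define \<I> where "\<I> = {I. connectedin X I \<and> x \<in> I \<and> I \<subseteq> \<Inter>\<C>}"
  have "\<Union>\<I> = \<Inter>\<C>"
  proof
    show "\<Inter>\<C> \<subseteq> \<Union>\<I>"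
    proof
      fix y assume y: "y \<in> \<Inter>\<C>"
      have xX: "x \<in> topspace X" "y \<in> topspace X" using x y top by auto
      obtain I where I: "connectedin X I" "closedin X I" "x \<in> I" "y \<in> I"
    "\<And>z. z \<in> I \<Longrightarrow> z \<noteq> x \<Longrightarrow> z \<noteq> y \<Longrightarrow> \<exists>A. side X z A \<and> x \<in> A \<and> y \<notin> insert z A"
    "\<And>C. connectedin X C \<Longrightarrow> x \<in> C \<Longrightarrow> y \<in> C \<Longrightarrow> I \<subseteq> C"
        by (rule dendron_interval[OF X xX]) (rule that)
      have "I \<subseteq> \<Inter>\<C>" using I(6) conn x y by blast
      then show "y \<in> \<Union>\<I>" using I by (auto simp: \<I>_def)
    qed
  qed (auto simp: \<I>_def)
  moreover have "connectedin X (\<Union>\<I>)"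
    by (rule connectedin_Union) (use x in \<open>auto simp: \<I>_def\<close>)
  ultimately show ?thesis by simp
qed

lemma dendron_subtopology:
  assumes X: "dendron X" and C: "closedin X C" "connectedin X C"
  shows "dendron (subtopology X C)"
proof -
  have CX: "C \<subseteq> topspace X" using C(1) closedin_subset by blast
  then have top: "topspace (subtopology X C) = C" by auto
  have "compact_space (subtopology X C)" 
    using X C(1) closedin_compact_space compact_space_subtopology unfolding dendron_def by blast
  moreover have "Hausdorff_space (subtopology X C)"
    using X Hausdorff_space_subtopology unfolding dendron_def by blast
  moreover have "connected_space (subtopology X C)" using C(2) by (simp add: connectedin_def)
  moreover have "\<exists>I. closedin (subtopology X C) I \<and> connectedin (subtopology X C) I \<and> x \<in> I \<and> y \<in> I \<and>
        (\<forall>z\<in>I - {x, y}. \<exists>A. side (subtopology X C) z A \<and> x \<in> A \<and> y \<notin> insert z A)"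
    if xy: "x \<in> C" "y \<in> C" for x y
  proof -
    have xX: "x \<in> topspace X" "y \<in> topspace X" using xy CX by auto
    obtain I where I: "connectedin X I" "closedin X I" "x \<in> I" "y \<in> I"
    "\<And>z. z \<in> I \<Longrightarrow> z \<noteq> x \<Longrightarrow> z \<noteq> y \<Longrightarrow> \<exists>A. side X z A \<and> x \<in> A \<and> y \<notin> insert z A"
    "\<And>C. connectedin X C \<Longrightarrow> x \<in> C \<Longrightarrow> y \<in> C \<Longrightarrow> I \<subseteq> C"
      by (rule dendron_interval[OF X xX]) (rule that)
    have "I \<subseteq> C" using I(6) C(2) xy by blast
    moreover have "\<exists>A. side (subtopology X C) z A \<and> x \<in> A \<and> y \<notin> insert z A" if z: "z \<in> I - {x, y}" for z
    proof -
      obtain A where A: "side X z A" "x \<in> A" "y \<notin> insert z A" using I(5) z by blast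
      have "openin (subtopology X C) (C \<inter> A)" "openin (subtopology X C) (C \<inter> (topspace X - insert z A))"
        using A(1) by (auto simp: side_def intro: openin_subtopology_Int2)
      moreover have "C \<inter> (topspace X - insert z A) = C - insert z (C \<inter> A)" using CX by auto
      ultimately have "side (subtopology X C) z (C \<inter> A)"
        using A xy z \<open>I \<subseteq> C\<close> top by (auto simp: side_def)
      then show ?thesis using A xy by blast
    qed
    ultimately show ?thesis using I(1-4) by (intro exI[of _ I]) (auto simp: connectedin_subtopology closedin_subset_topspace)
  qed
  ultimately show ?thesis using top unfolding dendron_def by simp
qed

lemma compact_chain_Inter_nonempty:
  assumes X: "compact_space X" and closed: "\<And>C. C \<in> \<C> \<Longrightarrow> closedin X C" and ne: "{} \<notin> \<C>"
    and chain: "\<And>C D. C \<in> \<C> \<Longrightarrow> D \<in> \<C> \<Longrightarrow> C \<subseteq> D \<or> D \<subseteq> C"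
  shows "\<Inter>\<C> \<noteq> {}"
proof -
  have "\<Inter>\<F> \<in> \<F>" if "finite \<F>" "\<F> \<noteq> {}" "\<F> \<subseteq> \<C>" for \<F>
    using that
  proof (induction \<F> rule: finite_ne_induct)
    case (insert C \<F>)
    then have "C \<subseteq> \<Inter>\<F> \<or> \<Inter>\<F> \<subseteq> C" using chain[of C "\<Inter>\<F>"] by blast
    then show ?case using insert by (auto simp: Int_absorb1 Int_absorb2)
  qed simp
  then have "\<Inter>\<F> \<noteq> {}" if "finite \<F>" "\<F> \<subseteq> \<C>" for \<F>
    using that ne by (cases "\<F> = {}") (simp, metis subsetD)
  then have "(\<forall>C\<in>\<C>. closedin X C) \<and> (\<forall>\<F>. finite \<F> \<and> \<F> \<subseteq> \<C> \<longrightarrow> \<Inter>\<F> \<noteq> {})"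
    using closed by simp
  then show ?thesis using X[unfolded compact_space_fip, THEN spec, THEN mp] by simp
qed

section \<open>Endpoints\<close>

text \<open>
  Equivalently, the complement of e is connected.
\<close>

definition endpoint :: "'a topology \<Rightarrow> 'a \<Rightarrow> bool" where
  "endpoint X e \<longleftrightarrow> e \<in> topspace X \<and> (\<nexists>A. side X e A)"

text \<open>
  Shrink the side. If A had no endpoint, then every point b of a side inside A would bound a
  strictly smaller side, so that Zorn's lemma needs only lower bounds of chains. The closures in
  a chain without least element have a common point y, which lies in all the sides of the chain;
  one of the two sides of y is then contained in all of them.
\<close>

lemma side_contains_endpoint:
  assumes X: "dendron X" and A: "side X z A"
  shows "\<exists>e\<in>A. endpoint X e"
proof (rule ccontr)
  assume no_end: "\<not> (\<exists>e\<in>A. endpoint X e)"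
  then have no: "\<exists>E. side X a E" if "a \<in> A" for a
    using that side_subset_topspace[OF A]  no_end unfolding endpoint_def by blast
  have conn: "connected_space X" and comp: "compact_space X" using X by (auto simp: dendron_def)
  define \<S> where "\<S> = {(w, B). side X w B \<and> B \<subseteq> A}"
  \<comment> \<open>Smaller means that the closure is contained in the larger side. Plain inclusion would not
    do: a chain of sides of one and the same point can have an empty intersection.\<close>
  define P where "P = (\<lambda>(w::'a, B) (w'::'a, B'). (w, B) = (w', B') \<or> insert w' B' \<subseteq> B)"
  have notin: "fst a \<notin> snd a" if "a \<in> \<S>" for a using that by (auto simp: \<S>_def side_def)
  have inS: "side X (fst a) (snd a)" "snd a \<subseteq> A" if "a \<in> \<S>" for a using that by (auto simp: \<S>_def)
  have P: "P a b \<longleftrightarrow> a = b \<or> insert (fst b) (snd b) \<subseteq> snd a" for a b by (auto simp: P_def split: prod.splits)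
  have po: "partial_order_on \<S> (relation_of P \<S>)"
  proof (rule partial_order_on_relation_ofI)
    show "P a a" for a by (simp add: P)
    show "P a c" if "P a b" "P b c" for a b c using that by (auto simp: P)
    show "a = b" if "a \<in> \<S>" "b \<in> \<S>" "P a b" "P b a" for a b
      using that notin[of a] notin[of b] by (auto simp: P)
  qed
  have "\<exists>u\<in>\<S>. \<forall>a\<in>C. P a u" if C: "C \<in> Chains (relation_of P \<S>)" for C
  proof -
    have CS: "C \<subseteq> \<S>" and tot: "\<And>a b. a \<in> C \<Longrightarrow> b \<in> C \<Longrightarrow> P a b \<or> P b a"
      using C by (auto simp: Chains_def relation_of_def)
    show ?thesis
    proof (cases "C = {} \<or> (\<exists>m\<in>C. \<forall>a\<in>C. P a m)")
      case True
      have "(z, A) \<in> \<S>" using A by (simp add: \<S>_def)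
      then show ?thesis using True CS by blast
    next
      case False
      then have next_: "\<exists>b\<in>C. insert (fst b) (snd b) \<subseteq> snd a" if "a \<in> C" for a
        using tot that P by metis
      have "\<Inter>((\<lambda>a. insert (fst a) (snd a)) ` C) \<noteq> {}"
      proof (rule compact_chain_Inter_nonempty[OF comp])
        show "closedin X K" if "K \<in> (\<lambda>a. insert (fst a) (snd a)) ` C" for K
          using that CS closedin_side[OF inS(1)] by blast
        show "K \<subseteq> L \<or> L \<subseteq> K" if "K \<in> (\<lambda>a. insert (fst a) (snd a)) ` C" "L \<in> (\<lambda>a. insert (fst a) (snd a)) ` C" for K L
          using that tot by (auto simp: P) blast+
      qed auto
      then obtain y where "\<And>a. a \<in> C \<Longrightarrow> y \<in> insert (fst a) (snd a)" by blast
      then have y: "y \<in> snd a" if "a \<in> C" for a using next_[OF that] by blast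
      obtain a0 where a0: "a0 \<in> C" using False by blast
      then have "y \<in> A" using y[OF a0] inS(2) a0 CS by blast
      then obtain E1 where E1: "side X y E1" using no by blast
      define E2 where "E2 = topspace X - insert y E1"
      have E2: "side X y E2" using side_opposite[OF E1] by (simp add: E2_def)
      have sd: "side X (fst a) (snd a)" "snd a \<subseteq> A" if "a \<in> C" for a using inS that CS by blast+
      have E12: "fst a \<in> E1 \<union> E2" if "a \<in> C" for a
        using y[OF that] sd[OF that] side_subset_topspace[OF sd(1)[OF that]] by (auto simp: E2_def side_def)
      have sub1: "insert y E2 \<subseteq> snd a" if "a \<in> C" "fst a \<in> E1" for a
        using side_subset_side[OF conn sd(1)[OF that(1)] E2 y[OF that(1)]] that E1 by (auto simp: E2_def side_def)
      have sub2: "insert y E1 \<subseteq> snd a" if "a \<in> C" "fst a \<in> E2" for a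
        using side_subset_side[OF conn sd(1)[OF that(1)] E1 y[OF that(1)]] that E2 by (auto simp: E2_def)
      \<comment> \<open>All boundary points of the chain lie on the same side of y; otherwise two of the sides would
        each contain the boundary point of the other.\<close>
      have "\<not> (\<exists>a\<in>C. \<exists>b\<in>C. fst a \<in> E1 \<and> fst b \<in> E2)"
      proof
        assume "\<exists>a\<in>C. \<exists>b\<in>C. fst a \<in> E1 \<and> fst b \<in> E2"
        then obtain a b where ab: "a \<in> C" "b \<in> C" "fst a \<in> E1" "fst b \<in> E2" by blast
        have "fst a \<in> snd b" "fst b \<in> snd a" using sub1[OF ab(1,3)] sub2[OF ab(2,4)] ab by auto
        moreover have "fst a \<notin> snd a" "fst b \<notin> snd b" using notin ab CS by blast+
        ultimately show False using tot[OF ab(1,2)] by (auto simp: P)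
      qed
      then have "(\<forall>a\<in>C. fst a \<in> E1) \<or> (\<forall>a\<in>C. fst a \<in> E2)" using E12 by blast
      then have "\<exists>E. side X y E \<and> (\<forall>a\<in>C. insert y E \<subseteq> snd a)"
      proof (elim disjE)
        assume "\<forall>a\<in>C. fst a \<in> E1"
        then show ?thesis using sub1 E2 by (intro exI[of _ E2]) simp
      next
        assume "\<forall>a\<in>C. fst a \<in> E2"
        then show ?thesis using sub2 E1 by (intro exI[of _ E1]) simp
      qed
      then obtain E where E: "side X y E" "\<And>a. a \<in> C \<Longrightarrow> insert y E \<subseteq> snd a" by metis
      have "(y, E) \<in> \<S>" using E(1) E(2)[OF a0] sd(2)[OF a0] by (auto simp: \<S>_def)
      then show ?thesis using E(2) by (intro bexI[of _ "(y, E)"]) (simp_all add: P)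
    qed
  qed
  then have "\<exists>m\<in>\<S>. \<forall>a\<in>\<S>. P m a \<longrightarrow> a = m"
    by (rule predicate_Zorn[OF po])
  then obtain m where m: "m \<in> \<S>" "\<And>a. a \<in> \<S> \<Longrightarrow> P m a \<Longrightarrow> a = m" by metis
  obtain w B where wB: "m = (w, B)" by force
  have B: "side X w B" "B \<subseteq> A" using m(1) by (auto simp: wB \<S>_def)
  then obtain b where b: "b \<in> B" by (auto simp: side_def)
  then obtain E1 where E1: "side X b E1" using no B by blast
  obtain E where E: "side X b E" "w \<notin> insert b E"
  proof (cases "w \<in> E1")
    case True
    then show ?thesis using that[OF side_opposite[OF E1]] b B(1) E1 by (auto simp: side_def)
  next
    case False
    then show ?thesis using that[OF E1] b B(1) by (auto simp: side_def)
  qed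
  have "insert b E \<subseteq> B" using side_subset_side[OF conn B(1) E(1) b E(2)] .
  then have "(b, E) = m" using m(2)[of "(b, E)"] E(1) B(2) by (auto simp: \<S>_def P wB)
  then show False using b B(1) by (auto simp: wB side_def)
qed

text \<open>
  The arc from e to a point of J is connected, so that it is not the disjoint union of e and its
  part in J. Any other point of the arc separates e from J.
\<close>

lemma dendron_separate_point_continuum:
  assumes X: "dendron X" and J: "closedin X J" "connectedin X J" "J \<noteq> {}" and e: "e \<in> topspace X" "e \<notin> J"
  obtains z A where "side X z A" "e \<in> A" "J \<inter> insert z A = {}"
proof -
  obtain f where f: "f \<in> J" using J(3) by blast
  have fX: "f \<in> topspace X" using f J(1) closedin_subset by blast
  obtain I where I: "connectedin X I" "closedin X I" "e \<in> I" "f \<in> I"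
    "\<And>z. z \<in> I \<Longrightarrow> z \<noteq> e \<Longrightarrow> z \<noteq> f \<Longrightarrow> \<exists>A. side X z A \<and> e \<in> A \<and> f \<notin> insert z A"
    "\<And>C. connectedin X C \<Longrightarrow> e \<in> C \<Longrightarrow> f \<in> C \<Longrightarrow> I \<subseteq> C"
    by (rule dendron_interval[OF X e(1) fX]) (rule that)
  have "closedin X {e}" using X e(1) closedin_Hausdorff_sing_eq[of X e] by (simp add: dendron_def)
  have "\<not> I \<subseteq> {e} \<union> J"
  proof
    assume "I \<subseteq> {e} \<union> J"
    then show False using I(1,3,4) \<open>closedin X {e}\<close> J(1) e(2) f unfolding connectedin_closedin by blast
  qed
  then obtain z where z: "z \<in> I" "z \<noteq> e" "z \<notin> J" by blast
  then obtain A where A: "side X z A" "e \<in> A" "f \<notin> insert z A" using I(5)[of z] f by blast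
  then have "J \<inter> A = {}" using connectedin_subset_side[OF J(2) A(1) z(3)] f by blast
  then show ?thesis using that A z by blast
qed

text \<open>
  No endpoint lies on the arc between the other two. Therefore the endpoints can be cut off one
  after another, each time from the arc between the other two and from the sides that were cut
  off before.
\<close>

lemma three_endpoints_disjoint_sides:
  assumes X: "dendron X" and e: "endpoint X e1" "endpoint X e2" "endpoint X e3"
    "e1 \<noteq> e2" "e1 \<noteq> e3" "e2 \<noteq> e3"
  obtains w1 W1 w2 W2 w3 W3 where "side X w1 W1" "side X w2 W2" "side X w3 W3"
    "insert w1 W1 \<inter> insert w2 W2 = {}" "insert w1 W1 \<inter> insert w3 W3 = {}" "insert w2 W2 \<inter> insert w3 W3 = {}"
proof -
  have conn: "connected_space X" using X by (simp add: dendron_def)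
  have cont: "\<exists>I. closedin X I \<and> connectedin X I \<and> a \<in> I \<and> b \<in> I \<and> c \<notin> I"
    if "endpoint X a" "endpoint X b" "endpoint X c" "c \<noteq> a" "c \<noteq> b" for a b c
  proof -
    have ab: "a \<in> topspace X" "b \<in> topspace X" using that by (auto simp: endpoint_def)
    obtain I where I: "connectedin X I" "closedin X I" "a \<in> I" "b \<in> I"
    "\<And>z. z \<in> I \<Longrightarrow> z \<noteq> a \<Longrightarrow> z \<noteq> b \<Longrightarrow> \<exists>A. side X z A \<and> a \<in> A \<and> b \<notin> insert z A"
    "\<And>C. connectedin X C \<Longrightarrow> a \<in> C \<Longrightarrow> b \<in> C \<Longrightarrow> I \<subseteq> C"
      by (rule dendron_interval[OF X ab]) (rule that)
    have "c \<notin> I" using I(5)[of c] that by (auto simp: endpoint_def)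
    then show ?thesis using I by blast
  qed
  have eX: "e1 \<in> topspace X" "e2 \<in> topspace X" "e3 \<in> topspace X" using e by (auto simp: endpoint_def)
  obtain I12 I13 I23 where
    I12: "closedin X I12" "connectedin X I12" "e1 \<in> I12" "e2 \<in> I12" "e3 \<notin> I12" and
    I13: "closedin X I13" "connectedin X I13" "e1 \<in> I13" "e3 \<in> I13" "e2 \<notin> I13" and
    I23: "closedin X I23" "connectedin X I23" "e2 \<in> I23" "e3 \<in> I23" "e1 \<notin> I23"
    using cont[of e1 e2 e3] cont[of e1 e3 e2] cont[of e2 e3 e1] e by metis
  obtain w1 W1 where W1: "side X w1 W1" "e1 \<in> W1" "I23 \<inter> insert w1 W1 = {}"
    using dendron_separate_point_continuum[OF X I23(1,2) _ eX(1) I23(5)] I23(3) by (metis empty_iff)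
  define K1 where "K1 = insert w1 W1"
  have K1: "closedin X K1" "connectedin X K1" "e1 \<in> K1" "I23 \<inter> K1 = {}"
    using closedin_side[OF W1(1)] connectedin_side[OF conn W1(1)] W1(2,3) by (simp_all add: K1_def)
  have "connectedin X (K1 \<union> I13)" using K1 I13 by (intro connectedin_Un) auto
  note J = closedin_Un[OF K1(1) I13(1)] this
  have ne: "K1 \<union> I13 \<noteq> {}" "e2 \<notin> K1 \<union> I13" using K1 I13 I23 by auto
  obtain w2 W2 where W2: "side X w2 W2" "e2 \<in> W2" "(K1 \<union> I13) \<inter> insert w2 W2 = {}"
    by (rule dendron_separate_point_continuum[OF X J ne(1) eX(2) ne(2)]) (rule that)
  define K2 where "K2 = insert w2 W2"
  have K2: "closedin X K2" "connectedin X K2" "e2 \<in> K2" "(K1 \<union> I13) \<inter> K2 = {}"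
    using closedin_side[OF W2(1)] connectedin_side[OF conn W2(1)] W2(2,3) by (simp_all add: K2_def)
  have "connectedin X (K1 \<union> I12)" using K1 I12 by (intro connectedin_Un) auto
  then have "connectedin X (K1 \<union> I12 \<union> K2)" using K2(2,3) I12(4) by (intro connectedin_Un[of X "K1 \<union> I12" K2]) auto
  note J = closedin_Un[OF closedin_Un[OF K1(1) I12(1)] K2(1)] this
  have ne: "K1 \<union> I12 \<union> K2 \<noteq> {}" "e3 \<notin> K1 \<union> I12 \<union> K2" using K1 K2 I12 I13 I23 by auto
  obtain w3 W3 where W3: "side X w3 W3" "e3 \<in> W3" "(K1 \<union> I12 \<union> K2) \<inter> insert w3 W3 = {}"
    by (rule dendron_separate_point_continuum[OF X J ne(1) eX(3) ne(2)]) (rule that)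
  show ?thesis using that[OF W1(1) W2(1) W3(1)] W2(3) W3(3) unfolding K1_def K2_def by blast
qed

section \<open>Pushing sides into sides\<close>

definition (in monoid) comm :: "'a \<Rightarrow> 'a \<Rightarrow> 'a" where
  "comm a b = a \<otimes> b \<otimes> inv a \<otimes> inv b"

text \<open>
  One element h has to serve all four pairs: this is what elements with displaceable supports
  satisfy and elements with a ping-pong dynamics do not.
\<close>

definition (in monoid) has_commuting_conjugates :: "'a \<Rightarrow> 'a \<Rightarrow> bool" where
  "has_commuting_conjugates n m \<longleftrightarrow> (\<exists>h\<in>carrier G. \<forall>x\<in>{n, m}. \<forall>y\<in>{n, m}.
     (h \<otimes> x \<otimes> inv h) \<otimes> y = y \<otimes> (h \<otimes> x \<otimes> inv h))"

definition (in monoid) comms :: "'a set \<Rightarrow> 'a set" where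
  "comms S = {comm a b | a b. a \<in> S \<and> b \<in> S}"

locale homeo_acting_group = group G for G (structure) +
  fixes X :: "'x topology" and \<phi> :: "'a \<Rightarrow> 'x \<Rightarrow> 'x"
  assumes homeo: "g \<in> carrier G \<Longrightarrow> homeomorphic_map X X (\<phi> g)"
    and act_mult: "g \<in> carrier G \<Longrightarrow> h \<in> carrier G \<Longrightarrow> x \<in> topspace X \<Longrightarrow> \<phi> (g \<otimes> h) x = \<phi> g (\<phi> h x)"
begin

lemma act_image_topspace: "g \<in> carrier G \<Longrightarrow> \<phi> g ` topspace X = topspace X"
  using homeomorphic_imp_surjective_map[OF homeo] .

lemma act_closed: "g \<in> carrier G \<Longrightarrow> x \<in> topspace X \<Longrightarrow> \<phi> g x \<in> topspace X"
  using act_image_topspace by blast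

lemma act_inj: "g \<in> carrier G \<Longrightarrow> inj_on (\<phi> g) (topspace X)"
  using homeomorphic_imp_injective_map[OF homeo] .

lemma act_one: "x \<in> topspace X \<Longrightarrow> \<phi> \<one> x = x"
  using act_mult[of \<one> \<one> x] act_inj[of \<one>] act_closed[of \<one> x] by (simp add: inj_on_eq_iff)

lemma act_inv: "g \<in> carrier G \<Longrightarrow> x \<in> topspace X \<Longrightarrow> \<phi> (inv g) (\<phi> g x) = x"
  "g \<in> carrier G \<Longrightarrow> x \<in> topspace X \<Longrightarrow> \<phi> g (\<phi> (inv g) x) = x"
  using act_mult[of "inv g" g x] act_mult[of g "inv g" x] act_one by auto

lemma act_image_Diff: "g \<in> carrier G \<Longrightarrow> A \<subseteq> topspace X \<Longrightarrow> \<phi> g ` (topspace X - A) = topspace X - \<phi> g ` A"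
  using inj_on_image_set_diff[OF act_inj, of g "topspace X" A] act_image_topspace by auto

lemma act_inv_image_complement:
  assumes g: "g \<in> carrier G" "A \<subseteq> topspace X" "B \<subseteq> topspace X" "\<phi> g ` (topspace X - A) \<subseteq> B"
  shows "\<phi> (inv g) ` (topspace X - B) \<subseteq> A"
proof clarify
  fix x assume x: "x \<in> topspace X" "x \<notin> B"
  have ix: "\<phi> (inv g) x \<in> topspace X" using act_closed[of "inv g" x] g(1) x(1) by simp
  show "\<phi> (inv g) x \<in> A"
  proof (rule ccontr)
    assume "\<phi> (inv g) x \<notin> A"
    then have "\<phi> g (\<phi> (inv g) x) \<in> B" using ix g(4) by blast
    then show False using act_inv(2)[OF g(1) x(1)] x(2) by simp
  qed
qed

lemma side_image:
  assumes g: "g \<in> carrier G" and A: "side X z A"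
  shows "side X (\<phi> g z) (\<phi> g ` A)"
proof -
  have sub: "insert z A \<subseteq> topspace X" using side_subset_topspace[OF A] .
  have eq: "topspace X - insert (\<phi> g z) (\<phi> g ` A) = \<phi> g ` (topspace X - insert z A)"
    using act_image_Diff[OF g sub] by simp
  have "openin X (\<phi> g ` A)" "openin X (\<phi> g ` (topspace X - insert z A))"
    using homeomorphic_map_openness_eq[OF homeo[OF g], of A] A
      homeomorphic_map_openness_eq[OF homeo[OF g], of "topspace X - insert z A"] by (auto simp: side_def)
  moreover have "\<phi> g z \<notin> \<phi> g ` A" 
    using A sub inj_on_image_mem_iff[OF act_inj[OF g], of z A] by (auto simp: side_def)
  moreover have "\<phi> g ` A \<noteq> {}" "\<phi> g ` (topspace X - insert z A) \<noteq> {}" using A by (auto simp: side_def)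
  ultimately show ?thesis using act_closed[OF g] sub unfolding side_def eq by blast
qed

text \<open>
  Some element of S acts like a hyperbolic isometry with attracting side U and repelling side V,
  for any choice of disjoint U and V.
\<close>

definition pushing :: "'a set \<Rightarrow> bool" where
  "pushing S \<longleftrightarrow> (\<forall>u U v V. side X u U \<and> side X v V \<and> U \<inter> V = {} \<longrightarrow>
     (\<exists>g\<in>S. \<phi> g ` (topspace X - V) \<subseteq> U))"

end

text \<open>
  Minimality is only required with respect to subcontinua, not with respect to all closed sets.
\<close>

locale minimal_dendron_action = homeo_acting_group +
  assumes dendron: "dendron X"
    and minimal: "closedin X C \<Longrightarrow> connectedin X C \<Longrightarrow> C \<noteq> {} \<Longrightarrow>
      (\<And>g. g \<in> carrier G \<Longrightarrow> \<phi> g ` C \<subseteq> C) \<Longrightarrow> C = topspace X"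
begin

lemma connX: "connected_space X" and compX: "compact_space X"
  using dendron by (auto simp: dendron_def)

text \<open>
  The points whose orbit avoids A form an intersection of translates of the complement of A.
  This is an invariant subcontinuum different from X, so by minimality it is empty.
\<close>

lemma orbit_meets_side:
  assumes A: "side X z A" and y: "y \<in> topspace X"
  shows "\<exists>g\<in>carrier G. \<phi> g y \<in> A"
proof (rule ccontr)
  assume "\<not> (\<exists>g\<in>carrier G. \<phi> g y \<in> A)"
  then have no: "\<phi> g y \<notin> A" if "g \<in> carrier G" for g using that by blast
  define B where "B = topspace X - A"
  have A_sub: "A \<subseteq> topspace X" using side_subset_topspace[OF A] by blast
  have "B = insert z (topspace X - insert z A)" using A side_subset_topspace[OF A] by (auto simp: B_def side_def)
  then have B: "closedin X B" "connectedin X B"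
    using closedin_side[OF side_opposite[OF A]] connectedin_side[OF connX side_opposite[OF A]] by auto
  define C where "C = \<Inter>((\<lambda>g. \<phi> g ` B) ` carrier G)"
  have "closedin X (\<phi> g ` B)" "connectedin X (\<phi> g ` B)" if "g \<in> carrier G" for g
    using homeomorphic_map_closedness_eq[OF homeo[OF that], of B]
      homeomorphic_map_connectedness_eq[OF homeo[OF that], of B] B by auto
  then have \<C>: "\<And>K. K \<in> (\<lambda>g. \<phi> g ` B) ` carrier G \<Longrightarrow> closedin X K"
    "\<And>K. K \<in> (\<lambda>g. \<phi> g ` B) ` carrier G \<Longrightarrow> connectedin X K" by auto
  have \<C>_ne: "(\<lambda>g. \<phi> g ` B) ` carrier G \<noteq> {}" using one_closed by blast
  have "closedin X C" unfolding C_def by (rule closedin_Inter[OF \<C>_ne \<C>(1)])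
  have "connectedin X C" unfolding C_def by (rule dendron_connectedin_Inter[OF dendron \<C>_ne \<C>(2)])
  have C_iff: "x \<in> C \<longleftrightarrow> x \<in> topspace X \<and> (\<forall>g\<in>carrier G. \<phi> g x \<in> B)" for x
  proof
    assume x: "x \<in> C"
    have "x \<in> \<phi> \<one> ` B" using x one_closed by (auto simp: C_def)
    then have "x \<in> topspace X" using act_closed[OF one_closed] by (auto simp: B_def)
    moreover have "\<phi> g x \<in> B" if "g \<in> carrier G" for g
    proof -
      have "x \<in> \<phi> (inv g) ` B" using x that by (auto simp: C_def)
      then show ?thesis using act_inv(2)[OF that] by (auto simp: B_def)
    qed
    ultimately show "x \<in> topspace X \<and> (\<forall>g\<in>carrier G. \<phi> g x \<in> B)" by blast
  next
    assume x: "x \<in> topspace X \<and> (\<forall>g\<in>carrier G. \<phi> g x \<in> B)"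
    show "x \<in> C" unfolding C_def
    proof clarify
      fix g assume g: "g \<in> carrier G"
      show "x \<in> \<phi> g ` B" using x act_inv(2)[OF g, of x] g by (metis image_eqI inv_closed)
    qed
  qed
  have "y \<in> C" using y no act_closed by (auto simp: C_iff B_def)
  moreover have "\<phi> g ` C \<subseteq> C" if g: "g \<in> carrier G" for g
  proof clarify
    fix x assume x: "x \<in> C"
    then have xX: "x \<in> topspace X" by (simp add: C_iff)
    have "\<phi> h (\<phi> g x) \<in> B" if "h \<in> carrier G" for h
      using x act_mult[OF that g xX] that g by (metis C_iff m_closed)
    then show "\<phi> g x \<in> C" using act_closed[OF g xX] by (simp add: C_iff)
  qed
  ultimately have "C = topspace X" using minimal \<open>closedin X C\<close> \<open>connectedin X C\<close> by blast
  moreover obtain a where "a \<in> A" using A by (auto simp: side_def)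
  ultimately have "\<phi> \<one> a \<in> B" "\<phi> \<one> a = a" using A_sub C_iff[of a] act_one by auto
  then show False using \<open>a \<in> A\<close> by (simp add: B_def)
qed

text \<open>
  The closure of the opposite side is connected and misses the point k z, so it lies on one side
  of k z, which is either k A or the translate of the opposite side.
\<close>

lemma side_dichotomy:
  assumes A: "side X z A" and k: "k \<in> carrier G" "\<phi> k z \<in> A"
  shows "\<phi> k ` (topspace X - A) \<subseteq> A \<or> \<phi> k ` A \<subseteq> A"
proof -
  define B where "B = topspace X - insert z A"
  have B: "side X z B" using side_opposite[OF A] by (simp add: B_def)
  have sub: "insert z A \<subseteq> topspace X" using side_subset_topspace[OF A] .
  have kA: "side X (\<phi> k z) (\<phi> k ` A)" and kB: "side X (\<phi> k z) (\<phi> k ` B)"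
    using side_image[OF k(1)] A B by auto
  have kB_eq: "\<phi> k ` B = topspace X - insert (\<phi> k z) (\<phi> k ` A)"
    using act_image_Diff[OF k(1) sub] by (simp add: B_def)
  have avoid: "\<phi> k z \<notin> insert z B" using k(2) A by (auto simp: B_def side_def)
  show ?thesis
  proof (cases "z \<in> \<phi> k ` A")
    case True
    then have "insert z B \<subseteq> \<phi> k ` A"
      using side_subset_side[OF connX kA B _ avoid] by blast
    moreover have "\<phi> k ` (topspace X - A) = topspace X - \<phi> k ` A"
      using act_image_Diff[OF k(1)] sub by simp
    ultimately show ?thesis using A sub by (auto simp: B_def)
  next
    case False
    then have "z \<in> \<phi> k ` B" using avoid sub by (auto simp: kB_eq)
    then have "insert z B \<subseteq> \<phi> k ` B"
      using side_subset_side[OF connX kB B _ avoid] by blast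
    then have "\<phi> k ` A \<inter> insert z B = {}" using kB_eq by auto
    moreover have "\<phi> k ` A \<subseteq> topspace X" using side_subset_topspace[OF kA] by blast
    ultimately show ?thesis by (auto simp: B_def)
  qed
qed

text \<open>
  The translates of A cover X, and finitely many of them suffice. If the first alternative of
  the dichotomy never occurred, then, as soon as the boundary point of g A lies in h A, the
  whole of g A would, and g could be dropped from the cover. A cover of least size therefore
  leads to a contradiction.
\<close>

lemma push_complement_into_side:
  assumes A: "side X z A"
  shows "\<exists>g\<in>carrier G. \<phi> g ` (topspace X - A) \<subseteq> A"
proof (rule ccontr)
  assume "\<not> (\<exists>g\<in>carrier G. \<phi> g ` (topspace X - A) \<subseteq> A)"
  then have no: "\<not> \<phi> g ` (topspace X - A) \<subseteq> A" if "g \<in> carrier G" for g using that by blast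
  have sub: "insert z A \<subseteq> topspace X" using side_subset_topspace[OF A] .
  then have zX: "z \<in> topspace X" and AX: "A \<subseteq> topspace X" by auto
  define good where "good = (\<lambda>F. finite F \<and> F \<subseteq> carrier G \<and> topspace X \<subseteq> (\<Union>g\<in>F. \<phi> g ` A))"
  have "\<exists>F. good F"
  proof -
    have op: "openin X U" if "U \<in> (\<lambda>g. \<phi> g ` A) ` carrier G" for U
      using that side_image[OF _ A] by (auto simp: side_def)
    have "topspace X \<subseteq> \<Union>((\<lambda>g. \<phi> g ` A) ` carrier G)"
    proof
      fix y assume y: "y \<in> topspace X"
      obtain g where g: "g \<in> carrier G" "\<phi> g y \<in> A" using orbit_meets_side[OF A y] by blast
      then have "y \<in> \<phi> (inv g) ` A" using act_inv(1)[OF g(1) y] by (metis image_eqI)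
      then show "y \<in> \<Union>((\<lambda>g. \<phi> g ` A) ` carrier G)" using g(1) by blast
    qed
    then obtain \<F> where "finite \<F>" "\<F> \<subseteq> (\<lambda>g. \<phi> g ` A) ` carrier G" "topspace X \<subseteq> \<Union>\<F>"
      using compactinD[OF compX[unfolded compact_space_def] op] by metis
    then obtain F where "F \<subseteq> carrier G" "finite F" "\<F> = (\<lambda>g. \<phi> g ` A) ` F"
      using finite_subset_image by metis
    then show ?thesis using \<open>topspace X \<subseteq> \<Union>\<F>\<close> by (auto simp: good_def)
  qed
  then obtain F where F: "good F" "\<And>F'. good F' \<Longrightarrow> card F \<le> card F'"
    using ex_has_least_nat[of good _ card] by metis
  have fin: "finite F" "F \<subseteq> carrier G" "topspace X \<subseteq> (\<Union>g\<in>F. \<phi> g ` A)" using F(1) by (auto simp: good_def)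
  then obtain g where g: "g \<in> F" using zX by blast
  then have gG: "g \<in> carrier G" using fin by blast
  then obtain h where h: "h \<in> F" "\<phi> g z \<in> \<phi> h ` A" using fin(3) act_closed[OF gG zX] by blast
  then have hG: "h \<in> carrier G" using fin by blast
  have "\<phi> g z \<notin> \<phi> g ` A" using side_image[OF gG A] by (simp add: side_def)
  then have "g \<noteq> h" using h by auto
  define k where "k = inv h \<otimes> g"
  have k: "k \<in> carrier G" using gG hG by (simp add: k_def)
  have kx: "\<phi> k x = \<phi> (inv h) (\<phi> g x)" if "x \<in> topspace X" for x
    using act_mult that gG hG by (simp add: k_def)
  obtain a where a: "a \<in> A" "\<phi> g z = \<phi> h a" using h(2) by blast
  then have "\<phi> k z \<in> A" using kx[OF zX] act_inv(1)[OF hG, of a] AX by auto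
  then have "\<phi> k ` A \<subseteq> A" using side_dichotomy[OF A k] no[OF k] by blast
  then have "\<phi> g ` A \<subseteq> \<phi> h ` A"
  proof -
    have "\<phi> h (\<phi> k x) = \<phi> g x" if "x \<in> A" for x
      using that AX kx act_inv(2)[OF hG] act_closed[OF gG] by auto
    then show ?thesis using \<open>\<phi> k ` A \<subseteq> A\<close> by (metis image_eqI image_subset_iff)
  qed
  then have "good (F - {g})" using fin h(1) \<open>g \<noteq> h\<close> by (fastforce simp: good_def)
  then have "card F \<le> card (F - {g})" by (rule F(2))
  then show False using g fin(1) by (metis card_Diff1_less not_le)
qed

lemma pushing_carrier: "pushing (carrier G)"
  unfolding pushing_def
proof (intro allI impI, elim conjE)
  fix u U v V assume U: "side X u U" and V: "side X v V" and disj: "U \<inter> V = {}"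
  obtain g where g: "g \<in> carrier G" "\<phi> g ` (topspace X - U) \<subseteq> U"
    using push_complement_into_side[OF U] by blast
  obtain k where k: "k \<in> carrier G" "\<phi> k ` (topspace X - V) \<subseteq> V"
    using push_complement_into_side[OF V] by blast
  have "V \<subseteq> topspace X - U" using disj side_subset_topspace[OF V] by blast
  then have "\<phi> g (\<phi> k x) \<in> U" if "x \<in> topspace X - V" for x using that g(2) k(2) by blast
  then have "\<phi> (g \<otimes> k) ` (topspace X - V) \<subseteq> U" using act_mult[OF g(1) k(1)] by auto
  then show "\<exists>g\<in>carrier G. \<phi> g ` (topspace X - V) \<subseteq> U" using g k by blast
qed

end

context minimal_dendron_action
begin

lemma endpoint_image:
  assumes g: "g \<in> carrier G" and e: "endpoint X e"
  shows "endpoint X (\<phi> g e)"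
proof -
  have eX: "e \<in> topspace X" and no: "\<not> side X e A" for A using e by (auto simp: endpoint_def)
  have "\<not> side X (\<phi> g e) A" for A
  proof
    assume "side X (\<phi> g e) A"
    then have "side X (\<phi> (inv g) (\<phi> g e)) (\<phi> (inv g) ` A)" using side_image g by simp
    then show False using no act_inv(1)[OF g eX] by simp
  qed
  then show ?thesis using act_closed[OF g eX] by (simp add: endpoint_def)
qed

text \<open>
  The set of endpoints is invariant and has at least two elements, one on each side of some
  point. If it had exactly two, they would form an invariant pair.
\<close>

lemma three_disjoint_sides:
  assumes ne: "topspace X \<noteq> {}"
    and nonelem: "\<And>x y. x \<in> topspace X \<Longrightarrow> y \<in> topspace X \<Longrightarrow> \<exists>g\<in>carrier G. \<phi> g ` {x, y} \<noteq> {x, y}"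
  obtains w1 W1 w2 W2 w3 W3 where "side X w1 W1" "side X w2 W2" "side X w3 W3"
    "insert w1 W1 \<inter> insert w2 W2 = {}" "insert w1 W1 \<inter> insert w3 W3 = {}" "insert w2 W2 \<inter> insert w3 W3 = {}"
proof -
  obtain x where x: "x \<in> topspace X" using ne by blast
  obtain g where "g \<in> carrier G" "\<phi> g ` {x, x} \<noteq> {x, x}" using nonelem[OF x x] by blast
  then obtain y where y: "y \<in> topspace X" "y \<noteq> x" using act_closed[of g x] x by auto
  have "closedin X {y}" using dendron y(1) closedin_Hausdorff_sing_eq[of X y] by (simp add: dendron_def)
  moreover have "connectedin X {y}" using y(1) by simp
  ultimately obtain z A where A: "side X z A"
    using dendron_separate_point_continuum[OF dendron _ _ _ x] y by (metis insert_not_empty singletonD)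
  obtain e1 where e1: "e1 \<in> A" "endpoint X e1" using side_contains_endpoint[OF dendron A] by blast
  obtain e2 where e2: "e2 \<in> topspace X - insert z A" "endpoint X e2"
    using side_contains_endpoint[OF dendron side_opposite[OF A]] by blast
  have eX: "e1 \<in> topspace X" "e2 \<in> topspace X" using e1 e2 by (auto simp: endpoint_def)
  have "e1 \<noteq> e2" using e1 e2 by blast
  obtain g where g: "g \<in> carrier G" "\<phi> g ` {e1, e2} \<noteq> {e1, e2}" using nonelem[OF eX] by blast
  have "\<phi> g e1 \<noteq> \<phi> g e2" using act_inj[OF g(1)] eX \<open>e1 \<noteq> e2\<close> by (simp add: inj_on_eq_iff)
  then have "\<exists>e\<in>{e1, e2}. \<phi> g e \<notin> {e1, e2}" using g(2) by force
  then obtain e where "e \<in> {e1, e2}" "\<phi> g e \<noteq> e1" "\<phi> g e \<noteq> e2" by blast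
  then have "\<exists>e3. endpoint X e3 \<and> e1 \<noteq> e3 \<and> e2 \<noteq> e3"
    using endpoint_image[OF g(1), of e] e1 e2 by (intro exI[of _ "\<phi> g e"]) auto
  then obtain e3 where e3: "endpoint X e3" "e1 \<noteq> e3" "e2 \<noteq> e3" by blast
  show ?thesis
    by (rule three_endpoints_disjoint_sides[OF dendron e1(2) e2(2) e3(1) \<open>e1 \<noteq> e2\<close> e3(2,3)]) (rule that)
qed

text \<open>
  At most one of the three sides has u in its closure, so the closures of the others lie in U or
  miss U. If two lie in U, nothing is to be done. If one misses U, an element that pushes its
  complement into U brings the two others into U.
\<close>

lemma side_splits:
  assumes W: "side X w1 W1" "side X w2 W2" "side X w3 W3"
    "insert w1 W1 \<inter> insert w2 W2 = {}" "insert w1 W1 \<inter> insert w3 W3 = {}" "insert w2 W2 \<inter> insert w3 W3 = {}"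
    and U: "side X u U"
  shows "\<exists>a A b B. side X a A \<and> side X b B \<and> insert a A \<subseteq> U \<and> insert b B \<subseteq> U \<and> insert a A \<inter> insert b B = {}"
proof -
  have claim: ?thesis
    if V: "side X v1 V1" "side X v2 V2" "side X v3 V3" "insert v1 V1 \<inter> insert v2 V2 = {}"
      "insert v1 V1 \<inter> insert v3 V3 = {}" "insert v2 V2 \<inter> insert v3 V3 = {}" and d: "insert v1 V1 \<inter> U = {}"
    for v1 V1 v2 V2 v3 V3
  proof -
    have "U \<inter> V1 = {}" using d by blast
    then obtain g where g: "g \<in> carrier G" "\<phi> g ` (topspace X - V1) \<subseteq> U"
      using pushing_carrier U V(1) unfolding pushing_def by metis
    have sub: "insert v2 V2 \<subseteq> topspace X - V1" "insert v3 V3 \<subseteq> topspace X - V1"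
      using V(4,5) side_subset_topspace[OF V(2)] side_subset_topspace[OF V(3)] by blast+
    have "\<phi> g ` insert v2 V2 \<inter> \<phi> g ` insert v3 V3 = {}"
      using inj_on_image_Int[OF act_inj[OF g(1)], of "insert v2 V2" "insert v3 V3"] sub V(6) by auto
    moreover have "\<phi> g ` insert v2 V2 \<subseteq> U" "\<phi> g ` insert v3 V3 \<subseteq> U" using sub g(2) by blast+
    ultimately show ?thesis
      using side_image[OF g(1) V(2)] side_image[OF g(1) V(3)] unfolding image_insert by blast
  qed
  have pos: "insert w W \<subseteq> U \<or> insert w W \<inter> U = {}" if "side X w W" "u \<notin> insert w W" for w W
    using connectedin_subset_side[OF connectedin_side[OF connX that(1)] U that(2)] by blast
  have two: ?thesis
    if V: "side X v1 V1" "side X v2 V2" "side X v3 V3" "insert v1 V1 \<inter> insert v2 V2 = {}"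
      "insert v1 V1 \<inter> insert v3 V3 = {}" "insert v2 V2 \<inter> insert v3 V3 = {}"
      "u \<notin> insert v1 V1" "u \<notin> insert v2 V2"
    for v1 V1 v2 V2 v3 V3
  proof -
    consider "insert v1 V1 \<inter> U = {}" | "insert v2 V2 \<inter> U = {}" | "insert v1 V1 \<subseteq> U" "insert v2 V2 \<subseteq> U"
      using pos[OF V(1,7)] pos[OF V(2,8)] by blast
    then show ?thesis
    proof cases
      case 1 then show ?thesis by (rule claim[OF V(1-6)])
    next
      case 2
      show ?thesis by (rule claim[OF V(2,1,3) _ V(6,5) 2]) (use V(4) in blast)
    next
      case 3 then show ?thesis using V(1,2,4) by blast
    qed
  qed
  consider "u \<notin> insert w1 W1" "u \<notin> insert w2 W2" | "u \<notin> insert w1 W1" "u \<notin> insert w3 W3"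
    | "u \<notin> insert w2 W2" "u \<notin> insert w3 W3"
    using W(4-6) by blast
  then show ?thesis
  proof cases
    case 1 then show ?thesis by (rule two[OF W])
  next
    case 2
    show ?thesis by (rule two[OF W(1,3,2,5,4) _ 2]) (use W(6) in blast)
  next
    case 3
    show ?thesis by (rule two[OF W(2,3,1,6) _ _ 3]) (use W(4,5) in blast)+
  qed
qed

text \<open>
  Ping-pong. Take disjoint sides A1, A2 of U and B1, B2 of V, an element a with attracting side
  A1 and repelling side A2, and b likewise with B1 and B2. The four letters of the commutator
  successively move the complement of V into B2, A2, B1 and A1.
\<close>

lemma pushing_comms:
  assumes S: "pushing S" "S \<subseteq> carrier G"
    and split: "\<And>u U. side X u U \<Longrightarrow> \<exists>a A b B. side X a A \<and> side X b B \<and>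
      insert a A \<subseteq> U \<and> insert b B \<subseteq> U \<and> insert a A \<inter> insert b B = {}"
  shows "pushing (comms S)"
  unfolding pushing_def
proof (intro allI impI, elim conjE)
  fix u U v V assume U: "side X u U" and V: "side X v V" and disj: "U \<inter> V = {}"
  obtain a1 A1 a2 A2 where A: "side X a1 A1" "side X a2 A2" "insert a1 A1 \<subseteq> U" "insert a2 A2 \<subseteq> U"
    "insert a1 A1 \<inter> insert a2 A2 = {}" using split[OF U] by (elim exE conjE) (rule that)
  obtain b1 B1 b2 B2 where B: "side X b1 B1" "side X b2 B2" "insert b1 B1 \<subseteq> V" "insert b2 B2 \<subseteq> V"
    "insert b1 B1 \<inter> insert b2 B2 = {}" using split[OF V] by (elim exE conjE) (rule that)
  have dA: "A1 \<inter> A2 = {}" and dB: "B1 \<inter> B2 = {}" using A(5) B(5) by blast+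
  obtain a where a: "a \<in> S" "\<phi> a ` (topspace X - A2) \<subseteq> A1"
    using S(1) A(1,2) dA unfolding pushing_def by metis
  obtain b where b: "b \<in> S" "\<phi> b ` (topspace X - B2) \<subseteq> B1"
    using S(1) B(1,2) dB unfolding pushing_def by metis
  have aG: "a \<in> carrier G" and bG: "b \<in> carrier G" using a b S(2) by auto
  have sub: "A1 \<subseteq> topspace X" "A2 \<subseteq> topspace X" "B1 \<subseteq> topspace X" "B2 \<subseteq> topspace X" "V \<subseteq> topspace X"
    using side_subset_topspace[OF A(1)] side_subset_topspace[OF A(2)] side_subset_topspace[OF B(1)]
      side_subset_topspace[OF B(2)] side_subset_topspace[OF V] by simp_all
  have ia: "\<phi> (inv a) ` (topspace X - A1) \<subseteq> A2" using act_inv_image_complement[OF aG sub(2,1) a(2)] .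
  have ib: "\<phi> (inv b) ` (topspace X - B1) \<subseteq> B2" using act_inv_image_complement[OF bG sub(4,3) b(2)] .
  have cross: "A1 \<inter> B2 = {}" "A2 \<inter> B2 = {}" "A2 \<inter> B1 = {}" using A(3,4) B(3,4) disj by blast+
  have "\<phi> (comm a b) x \<in> U" if x: "x \<in> topspace X - V" for x
  proof -
    have xX: "x \<in> topspace X" using x by blast
    have 1: "\<phi> (inv b) x \<in> B2" using ib x B(3) by blast
    then have 2: "\<phi> (inv a) (\<phi> (inv b) x) \<in> A2" using ia cross(1) sub by blast
    then have 3: "\<phi> b (\<phi> (inv a) (\<phi> (inv b) x)) \<in> B1" using b(2) cross(2) sub by blast
    then have 4: "\<phi> a (\<phi> b (\<phi> (inv a) (\<phi> (inv b) x))) \<in> A1" using a(2) cross(3) sub A(5) by blast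
    have "\<phi> (comm a b) x = \<phi> a (\<phi> b (\<phi> (inv a) (\<phi> (inv b) x)))"
      using aG bG xX 1 2 sub act_closed by (simp add: comm_def act_mult subset_iff)
    then show ?thesis using 4 A(3) by auto
  qed
  then show "\<exists>g\<in>comms S. \<phi> g ` (topspace X - V) \<subseteq> U"
    using a(1) b(1) by (intro bexI[of _ "comm a b"]) (auto simp: comms_def)
qed

end

section \<open>Limit points of ping-pong elements\<close>

text \<open>
  The union of the omega-limit sets of all points. A homeomorphism that commutes with f
  preserves it, and in a compact space it is never empty.
\<close>

definition limit_points :: "'a topology \<Rightarrow> ('a \<Rightarrow> 'a) \<Rightarrow> 'a set" where
  "limit_points X f =
     {q. \<exists>p\<in>topspace X. \<forall>k::nat. q \<in> X closure_of ((\<lambda>n. (f ^^ n) p) ` {k..})}"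

lemma limit_points_subset_topspace: "limit_points X f \<subseteq> topspace X"
  unfolding limit_points_def using closure_of_subset_topspace by fastforce

lemma funpow_topspace: "f ` T \<subseteq> T \<Longrightarrow> p \<in> T \<Longrightarrow> (f ^^ n) p \<in> T"
  by (induction n) auto

lemma limit_points_nonempty:
  assumes X: "compact_space X" "topspace X \<noteq> {}" and f: "f ` topspace X \<subseteq> topspace X"
  shows "limit_points X f \<noteq> {}"
proof -
  obtain p where p: "p \<in> topspace X" using X(2) by blast
  define K where "K = (\<lambda>k::nat. X closure_of ((\<lambda>n. (f ^^ n) p) ` {k..}))"
  have anti: "K l \<subseteq> K k" if "k \<le> l" for k l
    unfolding K_def using that by (intro closure_of_mono image_mono) auto
  have "\<Inter>(range K) \<noteq> {}"
  proof (rule compact_chain_Inter_nonempty[OF X(1)])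
    show "closedin X C" if "C \<in> range K" for C using that by (auto simp: K_def)
    have "(\<lambda>n. (f ^^ n) p) ` {k..} \<subseteq> K k" for k
      unfolding K_def using funpow_topspace[OF f p] by (intro closure_of_subset) auto
    then show "{} \<notin> range K" by fastforce
    show "C \<subseteq> D \<or> D \<subseteq> C" if "C \<in> range K" "D \<in> range K" for C D
      using that anti by (metis image_iff nat_le_linear)
  qed
  then show ?thesis using p by (auto simp: K_def limit_points_def)
qed

text \<open>
  An orbit stays in V forever, or else from some time on it stays in U.
\<close>

lemma limit_points_subset_sides:
  assumes U: "side X u U" and V: "side X v V" and disj: "U \<inter> V = {}" and f: "f ` (topspace X - V) \<subseteq> U"
    and fX: "f ` topspace X \<subseteq> topspace X"
  shows "limit_points X f \<subseteq> insert u U \<union> insert v V"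
proof
  fix q assume "q \<in> limit_points X f"
  then obtain p where p: "p \<in> topspace X" "\<And>k. q \<in> X closure_of ((\<lambda>n. (f ^^ n) p) ` {k..})"
    by (auto simp: limit_points_def)
  have TX: "(f ^^ n) p \<in> topspace X" for n using funpow_topspace[OF fX p(1)] .
  have UX: "U \<subseteq> topspace X" using side_subset_topspace[OF U] by blast
  show "q \<in> insert u U \<union> insert v V"
  proof (cases "\<exists>n. (f ^^ n) p \<notin> V")
    case True
    then obtain n where n: "(f ^^ n) p \<notin> V" by blast
    have "(f ^^ (Suc n + m)) p \<in> U" for m
    proof (induction m)
      case 0 show ?case using f n TX[of n] by auto
    next
      case (Suc m)
      then have "(f ^^ (Suc n + m)) p \<in> topspace X - V" using disj UX by blast
      then show ?case using f by auto
    qed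
    then have "(\<lambda>n. (f ^^ n) p) ` {Suc n..} \<subseteq> U" by (metis atLeast_iff image_subsetI le_Suc_ex)
    then have "X closure_of ((\<lambda>n. (f ^^ n) p) ` {Suc n..}) \<subseteq> insert u U"
      by (intro closure_of_minimal closedin_side[OF U]) blast
    then show ?thesis using p(2) by blast
  next
    case False
    then have "X closure_of ((\<lambda>n. (f ^^ n) p) ` {0..}) \<subseteq> insert v V"
      by (intro closure_of_minimal closedin_side[OF V]) auto
    then show ?thesis using p(2) by blast
  qed
qed

lemma limit_points_invariant:
  assumes h: "homeomorphic_map X X h" and fX: "f ` topspace X \<subseteq> topspace X"
    and comm: "\<And>x. x \<in> topspace X \<Longrightarrow> h (f x) = f (h x)"
  shows "h ` limit_points X f \<subseteq> limit_points X f"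
proof clarify
  fix q assume "q \<in> limit_points X f"
  then obtain p where p: "p \<in> topspace X" "\<And>k. q \<in> X closure_of ((\<lambda>n. (f ^^ n) p) ` {k..})"
    by (auto simp: limit_points_def)
  have TX: "(f ^^ n) p \<in> topspace X" for n using funpow_topspace[OF fX p(1)] .
  have pow: "h ((f ^^ n) p) = (f ^^ n) (h p)" for n by (induction n) (simp_all add: comm TX)
  have "h q \<in> X closure_of ((\<lambda>n. (f ^^ n) (h p)) ` {k..})" for k
  proof -
    have "(\<lambda>n. (f ^^ n) (h p)) ` {k..} = h ` (\<lambda>n. (f ^^ n) p) ` {k..}" by (simp add: image_image pow)
    moreover have "(\<lambda>n. (f ^^ n) p) ` {k..} \<subseteq> topspace X" using TX by blast
    ultimately have "X closure_of ((\<lambda>n. (f ^^ n) (h p)) ` {k..}) = h ` (X closure_of ((\<lambda>n. (f ^^ n) p) ` {k..}))"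
      using homeomorphic_map_closure_of[OF h] by simp
    then show ?thesis using p(2) by simp
  qed
  moreover have "h p \<in> topspace X" using homeomorphic_imp_surjective_map[OF h] p(1) by blast
  ultimately show "h q \<in> limit_points X f" by (auto simp: limit_points_def)
qed

context homeo_acting_group
begin

lemma act_commute_inv:
  assumes "c \<in> carrier G" "n \<in> carrier G" "c \<otimes> n = n \<otimes> c"
  shows "c \<otimes> inv n = inv n \<otimes> c"
proof -
  have "inv n \<otimes> c = inv n \<otimes> (c \<otimes> n) \<otimes> inv n" using assms(1,2) by (simp add: m_assoc)
  also have "\<dots> = inv n \<otimes> (n \<otimes> c) \<otimes> inv n" using assms(3) by simp
  also have "\<dots> = (inv n \<otimes> n) \<otimes> (c \<otimes> inv n)" using assms(1,2) by (simp only: m_assoc inv_closed m_closed)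
  also have "\<dots> = c \<otimes> inv n" using assms(1,2) by simp
  finally show ?thesis by simp
qed

lemma limit_points_act_invariant:
  assumes "c \<in> carrier G" "n \<in> carrier G" "c \<otimes> n = n \<otimes> c"
  shows "\<phi> n ` limit_points X (\<phi> c) \<subseteq> limit_points X (\<phi> c)"
  using assms act_image_topspace by (intro limit_points_invariant homeo) (auto simp flip: act_mult)

text \<open>
  Suppose that the conjugates by h of n and m commute with n and m. Then the limit points of
  either conjugate form a set that is invariant under n and m, and the ping-pong between the
  four sides makes this set meet W1, W2 and W3. On the other hand, the limit points of the
  conjugate of n lie in the closures of h W1 and h W2, those of the conjugate of m in the
  closures of h W3 and h W4, and these four closures are disjoint. So the closure of each of W1,
  W2, W3 is a connected set that meets the closure of h W1 or h W2 without being contained in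
  it, and must contain h w1 or h w2. But three disjoint sets cannot all contain one of two
  points.
\<close>

lemma pushing_conjugates_do_not_commute:
  assumes X: "dendron X" "topspace X \<noteq> {}"
    and W: "side X w1 W1" "side X w2 W2" "side X w3 W3" "side X w4 W4"
    and disj: "insert w1 W1 \<inter> insert w2 W2 = {}" "insert w1 W1 \<inter> insert w3 W3 = {}"
      "insert w1 W1 \<inter> insert w4 W4 = {}" "insert w2 W2 \<inter> insert w3 W3 = {}"
      "insert w2 W2 \<inter> insert w4 W4 = {}" "insert w3 W3 \<inter> insert w4 W4 = {}"
    and n: "n \<in> carrier G" "\<phi> n ` (topspace X - W2) \<subseteq> W1"
    and m: "m \<in> carrier G" "\<phi> m ` (topspace X - W4) \<subseteq> W3"
    and h: "h \<in> carrier G"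
    and commute: "\<And>x y. x \<in> {n, m} \<Longrightarrow> y \<in> {n, m} \<Longrightarrow>
      (h \<otimes> x \<otimes> inv h) \<otimes> y = y \<otimes> (h \<otimes> x \<otimes> inv h)"
  shows False
proof -
  have connX: "connected_space X" and compX: "compact_space X" using X(1) by (auto simp: dendron_def)
  have sub: "insert w1 W1 \<subseteq> topspace X" "insert w2 W2 \<subseteq> topspace X"
    "insert w3 W3 \<subseteq> topspace X" "insert w4 W4 \<subseteq> topspace X"
    using W[THEN side_subset_topspace] by simp_all
  define c where "c = (\<lambda>x. h \<otimes> x \<otimes> inv h)"
  have cG: "c x \<in> carrier G" if "x \<in> {n, m}" for x using that n m h by (auto simp: c_def)
  have in_nm: "n \<in> {n, m}" "m \<in> {n, m}" by auto
  have meets: "limit_points X (\<phi> (c x)) \<inter> W1 \<noteq> {} \<and> limit_points X (\<phi> (c x)) \<inter> W2 \<noteq> {} \<and>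
      limit_points X (\<phi> (c x)) \<inter> W3 \<noteq> {}" if x: "x \<in> {n, m}" for x
  proof -
    define F where "F = limit_points X (\<phi> (c x))"
    have "F \<noteq> {}" unfolding F_def
      using limit_points_nonempty[OF compX X(2)] act_image_topspace[OF cG[OF x]] by simp
    then obtain p where p: "p \<in> F" by blast
    have FX: "F \<subseteq> topspace X" unfolding F_def by (rule limit_points_subset_topspace)
    have inv_n: "\<phi> n q \<in> F" and inv_m: "\<phi> m q \<in> F" and inv_in: "\<phi> (inv n) q \<in> F" if "q \<in> F" for q
    proof -
      have "c x \<otimes> n = n \<otimes> c x" "c x \<otimes> m = m \<otimes> c x" using commute[OF x] by (auto simp: c_def)
      then show "\<phi> n q \<in> F" "\<phi> m q \<in> F" "\<phi> (inv n) q \<in> F"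
        using limit_points_act_invariant[OF cG[OF x]] act_commute_inv[OF cG[OF x]] n(1) m(1) that
        unfolding F_def by blast+
    qed
    have "\<exists>q\<in>F. q \<notin> W2"
    proof (cases "p \<in> W2")
      case True
      then have "p \<in> topspace X - W4" using disj(5) sub by blast
      then have "\<phi> m p \<in> W3" using m(2) by blast
      then show ?thesis using inv_m[OF p] disj(4) by blast
    qed (use p in blast)
    then obtain q where q: "q \<in> F" "q \<notin> W2" by blast
    have q1: "\<phi> n q \<in> F" "\<phi> n q \<in> W1" using inv_n[OF q(1)] q n(2) FX by auto
    then have "\<phi> n q \<in> topspace X - W4" using disj(3) sub by blast
    then have q3: "\<phi> m (\<phi> n q) \<in> F" "\<phi> m (\<phi> n q) \<in> W3" using inv_m[OF q1(1)] m(2) by auto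
    have "\<phi> (inv n) ` (topspace X - W1) \<subseteq> W2"
      using act_inv_image_complement[OF n(1) _ _ n(2)] sub by blast
    moreover have "\<phi> m (\<phi> n q) \<in> topspace X - W1" using q3(2) disj(2) sub by blast
    ultimately have q2: "\<phi> (inv n) (\<phi> m (\<phi> n q)) \<in> F" "\<phi> (inv n) (\<phi> m (\<phi> n q)) \<in> W2"
      using inv_in[OF q3(1)] by auto
    show ?thesis using q1 q2 q3 unfolding F_def by blast
  qed
  have conj_push: "\<phi> (c x) ` (topspace X - \<phi> h ` B) \<subseteq> \<phi> h ` A"
    if x: "x \<in> {n, m}" and push: "\<phi> x ` (topspace X - B) \<subseteq> A" for x A B
  proof clarify
    fix p assume p: "p \<in> topspace X" "p \<notin> \<phi> h ` B"
    have xG: "x \<in> carrier G" using x n m by auto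
    have ih: "\<phi> (inv h) p \<in> topspace X" using act_closed[of "inv h" p] h p by simp
    have "\<phi> (inv h) p \<notin> B" using act_inv(2)[OF h p(1)] p(2) by (metis image_eqI)
    then have "\<phi> x (\<phi> (inv h) p) \<in> A" using ih push by blast
    moreover have "\<phi> (c x) p = \<phi> h (\<phi> x (\<phi> (inv h) p))"
      using h xG p(1) ih act_closed[OF xG ih] by (simp add: c_def act_mult)
    ultimately show "\<phi> (c x) p \<in> \<phi> h ` A" by simp
  qed
  define K where "K = (\<lambda>w W. insert (\<phi> h w) (\<phi> h ` W))"
  have K_disj: "K w W \<inter> K v V = {}" if "insert w W \<inter> insert v V = {}" "insert w W \<subseteq> topspace X" "insert v V \<subseteq> topspace X"
    for w W v V
  proof -
    have "K w W = \<phi> h ` insert w W" "K v V = \<phi> h ` insert v V" by (simp_all add: K_def)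
    then show ?thesis using inj_on_image_Int[OF act_inj[OF h] that(2,3)] that(1) by simp
  qed
  have Fn: "limit_points X (\<phi> (c n)) \<subseteq> K w1 W1 \<union> K w2 W2"
  proof -
    have "\<phi> h ` W1 \<inter> \<phi> h ` W2 = {}" using K_disj[OF disj(1) sub(1,2)] by (auto simp: K_def)
    then show ?thesis unfolding K_def
      using limit_points_subset_sides[OF side_image[OF h W(1)] side_image[OF h W(2)] _ conj_push[OF in_nm(1) n(2)]]
        act_image_topspace[OF cG[OF in_nm(1)]] by simp
  qed
  have Fm: "limit_points X (\<phi> (c m)) \<subseteq> K w3 W3 \<union> K w4 W4"
  proof -
    have "\<phi> h ` W3 \<inter> \<phi> h ` W4 = {}" using K_disj[OF disj(6) sub(3,4)] by (auto simp: K_def)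
    then show ?thesis unfolding K_def
      using limit_points_subset_sides[OF side_image[OF h W(3)] side_image[OF h W(4)] _ conj_push[OF in_nm(2) m(2)]]
        act_image_topspace[OF cG[OF in_nm(2)]] by simp
  qed
  have far: "(K w1 W1 \<union> K w2 W2) \<inter> (K w3 W3 \<union> K w4 W4) = {}"
    using K_disj[OF disj(2) sub(1,3)] K_disj[OF disj(3) sub(1,4)] K_disj[OF disj(4) sub(2,3)]
      K_disj[OF disj(5) sub(2,4)] by blast
  have boundary: "\<phi> h w1 \<in> insert w W \<or> \<phi> h w2 \<in> insert w W"
    if w: "side X w W" and meet: "limit_points X (\<phi> (c n)) \<inter> W \<noteq> {}" "limit_points X (\<phi> (c m)) \<inter> W \<noteq> {}" for w W
  proof -
    have conn: "connectedin X (insert w W)" using connectedin_side[OF connX w] .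
    obtain q' where q': "q' \<in> W" "q' \<notin> K w1 W1" "q' \<notin> K w2 W2" using meet(2) Fm far by blast
    have "\<phi> h v \<in> insert w W" if v: "side X v V" and q: "q \<in> W" "q \<in> K v V" and q'V: "q' \<notin> K v V" for v V q
    proof (rule ccontr)
      assume "\<phi> h v \<notin> insert w W"
      moreover from this have "insert w W \<inter> \<phi> h ` V \<noteq> {}" using q by (auto simp: K_def)
      ultimately have "insert w W \<subseteq> \<phi> h ` V" using connectedin_subset_side[OF conn side_image[OF h v]] by blast
      then show False using q'(1) q'V by (auto simp: K_def)
    qed
    moreover obtain q where "q \<in> W" "q \<in> K w1 W1 \<or> q \<in> K w2 W2" using meet(1) Fn by blast
    ultimately show ?thesis using W(1,2) q' by blast
  qed
  have "\<phi> h w1 \<in> insert w1 W1 \<or> \<phi> h w2 \<in> insert w1 W1" using boundary[OF W(1)] meets in_nm by blast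
  moreover have "\<phi> h w1 \<in> insert w2 W2 \<or> \<phi> h w2 \<in> insert w2 W2" using boundary[OF W(2)] meets in_nm by blast
  moreover have "\<phi> h w1 \<in> insert w3 W3 \<or> \<phi> h w2 \<in> insert w3 W3" using boundary[OF W(3)] meets in_nm by blast
  ultimately show False using disj(1,2,4) by blast
qed

end

section \<open>A criterion for elementary actions on dendrites\<close>

lemma (in homeo_acting_group) minimal_invariant_continuum:
  assumes X: "dendron X" "topspace X \<noteq> {}"
  obtains Y where "closedin X Y" "connectedin X Y" "Y \<noteq> {}" "\<And>g. g \<in> carrier G \<Longrightarrow> \<phi> g ` Y \<subseteq> Y"
    "\<And>C. closedin X C \<Longrightarrow> connectedin X C \<Longrightarrow> C \<noteq> {} \<Longrightarrow> \<forall>g\<in>carrier G. \<phi> g ` C \<subseteq> C \<Longrightarrow>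
      C \<subseteq> Y \<Longrightarrow> C = Y"
proof -
  have compX: "compact_space X" using X(1) by (simp add: dendron_def)
  define \<Y> where "\<Y> = {C. closedin X C \<and> connectedin X C \<and> C \<noteq> {} \<and> (\<forall>g\<in>carrier G. \<phi> g ` C \<subseteq> C)}"
  have "\<exists>m\<in>\<Y>. \<forall>a\<in>\<Y>. m \<supseteq> a \<longrightarrow> a = m"
  proof (rule predicate_Zorn)
    show "partial_order_on \<Y> (relation_of (\<supseteq>) \<Y>)"
      by (rule partial_order_on_relation_ofI) auto
    fix \<C> assume C: "\<C> \<in> Chains (relation_of (\<supseteq>) \<Y>)"
    then have sub: "\<C> \<subseteq> \<Y>" and chain: "\<And>K L. K \<in> \<C> \<Longrightarrow> L \<in> \<C> \<Longrightarrow> K \<subseteq> L \<or> L \<subseteq> K"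
      by (auto simp: Chains_def relation_of_def)
    show "\<exists>u\<in>\<Y>. \<forall>a\<in>\<C>. a \<supseteq> u"
    proof (cases "\<C> = {}")
      case True
      have "topspace X \<in> \<Y>"
        using X act_image_topspace unfolding \<Y>_def dendron_def by (simp add: connectedin_topspace)
      then show ?thesis using True by blast
    next
      case False
      have mem: "closedin X K" "connectedin X K" "K \<noteq> {}" "\<And>g. g \<in> carrier G \<Longrightarrow> \<phi> g ` K \<subseteq> K" if "K \<in> \<C>" for K
        using that sub by (auto simp: \<Y>_def)
      have "closedin X (\<Inter>\<C>)" by (rule closedin_Inter[OF False mem(1)])
      moreover have "connectedin X (\<Inter>\<C>)" by (rule dendron_connectedin_Inter[OF X(1) False mem(2)])
      moreover have "\<Inter>\<C> \<noteq> {}"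
        using compact_chain_Inter_nonempty[OF compX mem(1) _ chain] mem(3) by metis
      moreover have "\<phi> g ` \<Inter>\<C> \<subseteq> \<Inter>\<C>" if "g \<in> carrier G" for g using mem(4)[OF _ that] by blast
      ultimately have "\<Inter>\<C> \<in> \<Y>" by (simp add: \<Y>_def)
      then show ?thesis by blast
    qed
  qed
  then obtain Y where Y: "Y \<in> \<Y>" "\<And>C. C \<in> \<Y> \<Longrightarrow> C \<subseteq> Y \<Longrightarrow> C = Y" by metis
  show ?thesis
  proof (rule that[of Y])
    show "\<phi> g ` Y \<subseteq> Y" if "g \<in> carrier G" for g
      using Y(1) that by (auto simp: \<Y>_def)
    show "closedin X Y" "connectedin X Y" "Y \<noteq> {}" using Y(1) by (auto simp: \<Y>_def)
    show "C = Y" if "closedin X C" "connectedin X C" "C \<noteq> {}" "\<forall>g\<in>carrier G. \<phi> g ` C \<subseteq> C" "C \<subseteq> Y" for C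
      using Y(2)[of C] that by (simp add: \<Y>_def)
  qed
qed

text \<open>
  The elements n and m are found among the double commutators by ping-pong; the third side is
  split in order to have the four sides that two ping-pong elements need.
\<close>

lemma (in minimal_dendron_action) no_nonelementary_action:
  assumes ne: "topspace X \<noteq> {}"
    and nonelem: "\<And>x y. x \<in> topspace X \<Longrightarrow> y \<in> topspace X \<Longrightarrow> \<exists>g\<in>carrier G. \<phi> g ` {x, y} \<noteq> {x, y}"
    and commuting: "\<And>n m. n \<in> comms (comms (carrier G)) \<Longrightarrow> m \<in> comms (comms (carrier G)) \<Longrightarrow>
      has_commuting_conjugates n m"
  shows False
proof -
  obtain w1 W1 w2 W2 w3 W3 where W: "side X w1 W1" "side X w2 W2" "side X w3 W3"
    "insert w1 W1 \<inter> insert w2 W2 = {}" "insert w1 W1 \<inter> insert w3 W3 = {}" "insert w2 W2 \<inter> insert w3 W3 = {}"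
    by (rule three_disjoint_sides[OF ne nonelem]) (assumption, assumption, rule that)
  note split = side_splits[OF W]
  have sub: "comms S \<subseteq> carrier G" if "S \<subseteq> carrier G" for S
    using that by (auto simp: comms_def comm_def)
  have sub1: "comms (carrier G) \<subseteq> carrier G" and sub2: "comms (comms (carrier G)) \<subseteq> carrier G"
    using sub by blast+
  have push: "pushing (comms (comms (carrier G)))"
    using pushing_comms[OF pushing_comms[OF pushing_carrier subset_refl split] sub1 split] .
  obtain a A b B where AB: "side X a A" "side X b B" "insert a A \<subseteq> W3" "insert b B \<subseteq> W3" "insert a A \<inter> insert b B = {}"
    using split[OF W(3)] by (elim exE conjE) (rule that)
  have "W1 \<inter> W2 = {}" "A \<inter> B = {}" using W(4) AB(5) by blast+
  then obtain n m where n: "n \<in> comms (comms (carrier G))" "\<phi> n ` (topspace X - W2) \<subseteq> W1"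
    and m: "m \<in> comms (comms (carrier G))" "\<phi> m ` (topspace X - B) \<subseteq> A"
    using push W(1,2) AB(1,2) unfolding pushing_def by metis
  obtain h where h: "h \<in> carrier G"
    "\<And>x y. x \<in> {n, m} \<Longrightarrow> y \<in> {n, m} \<Longrightarrow> (h \<otimes> x \<otimes> inv h) \<otimes> y = y \<otimes> (h \<otimes> x \<otimes> inv h)"
    using commuting[OF n(1) m(1)] unfolding has_commuting_conjugates_def by metis
  have d: "insert w1 W1 \<inter> insert a A = {}" "insert w1 W1 \<inter> insert b B = {}"
    "insert w2 W2 \<inter> insert a A = {}" "insert w2 W2 \<inter> insert b B = {}"
    using W(5,6) AB(3,4) by blast+
  have nG: "n \<in> carrier G" and mG: "m \<in> carrier G" using n(1) m(1) sub2 by auto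
  show False
    by (rule pushing_conjugates_do_not_commute[OF dendron ne W(1,2) AB(1,2) W(4) d AB(5) nG n(2) mG m(2) h])
qed

text \<open>
  Everything happens in a minimal invariant subcontinuum; an invariant point or pair there is
  also one of X.
\<close>

theorem elementary_action_of_commuting_conjugates:
  fixes G (structure) and X :: "'x topology"
  assumes G: "group G" and X: "dendrite X" and act: "homeo_action G X \<phi>"
    and commuting: "\<And>n m. n \<in> monoid.comms G (monoid.comms G (carrier G)) \<Longrightarrow> m \<in> monoid.comms G (monoid.comms G (carrier G)) \<Longrightarrow>
      monoid.has_commuting_conjugates G n m"
  shows "elementary_action G X \<phi>"
proof (rule ccontr)
  assume nonelem: "\<not> elementary_action G X \<phi>"
  have D: "dendron X" and ne: "topspace X \<noteq> {}"
    using dendrite_imp_dendron[OF X] X by (auto simp: dendrite_def continuum_def)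
  interpret group G by (rule G)
  have hom: "\<phi> \<in> hom G (homeo_group X)" using act by (simp add: homeo_action_def)
  have Bij: "\<phi> g \<in> Bij (topspace X)" "homeomorphic_map X X (\<phi> g)" if "g \<in> carrier G" for g
    using hom_in_carrier[OF hom that] by (auto simp: homeo_group_def)
  have mult: "\<phi> (g \<otimes> h) x = \<phi> g (\<phi> h x)" if "g \<in> carrier G" "h \<in> carrier G" "x \<in> topspace X" for g h x
    using hom_mult[OF hom that(1,2)] Bij that by (simp add: homeo_group_def BijGroup_def compose_def)
  interpret A: homeo_acting_group G X \<phi>
    by unfold_locales (use Bij mult in auto)
  have pair: "\<exists>g\<in>carrier G. \<phi> g ` {x, y} \<noteq> {x, y}" if xy: "x \<in> topspace X" "y \<in> topspace X" for x y
  proof (rule ccontr)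
    assume "\<not> (\<exists>g\<in>carrier G. \<phi> g ` {x, y} \<noteq> {x, y})"
    then have inv: "\<forall>g\<in>carrier G. \<phi> g ` {x, y} = {x, y}" by blast
    have "elementary_action G X \<phi>"
    proof (cases "x = y")
      case True
      then have "\<forall>g\<in>carrier G. \<phi> g x = x" using inv by simp
      then show ?thesis using xy unfolding elementary_action_def by blast
    next
      case False
      then show ?thesis using inv xy unfolding elementary_action_def by blast
    qed
    then show False using nonelem by blast
  qed
  obtain Y where Y: "closedin X Y" "connectedin X Y" "Y \<noteq> {}" "\<And>g. g \<in> carrier G \<Longrightarrow> \<phi> g ` Y \<subseteq> Y"
    "\<And>C. closedin X C \<Longrightarrow> connectedin X C \<Longrightarrow> C \<noteq> {} \<Longrightarrow> \<forall>g\<in>carrier G. \<phi> g ` C \<subseteq> C \<Longrightarrow>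
      C \<subseteq> Y \<Longrightarrow> C = Y"
    by (rule A.minimal_invariant_continuum[OF D ne]) (rule that)
  define Z where "Z = subtopology X Y"
  have YX: "Y \<subseteq> topspace X" using Y(1) closedin_subset by blast
  then have topZ: "topspace Z = Y" by (auto simp: Z_def)
  have img: "\<phi> g ` Y = Y" if g: "g \<in> carrier G" for g
  proof
    show "Y \<subseteq> \<phi> g ` Y"
    proof
      fix y assume y: "y \<in> Y"
      then have "\<phi> (inv g) y \<in> Y" using Y(4)[of "inv g"] g by auto
      moreover have "\<phi> g (\<phi> (inv g) y) = y" using A.act_inv(2)[OF g] y YX by auto
      ultimately show "y \<in> \<phi> g ` Y" by (metis image_eqI)
    qed
  qed (rule Y(4)[OF g])
  interpret Z: minimal_dendron_action G Z \<phi>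
  proof unfold_locales
    show "homeomorphic_map Z Z (\<phi> g)" if "g \<in> carrier G" for g
      unfolding Z_def using homeomorphic_map_subtopologies[OF Bij(2)[OF that], of Y Y] img[OF that] YX
      by (simp add: Int_absorb1)
    show "\<phi> (g \<otimes> h) x = \<phi> g (\<phi> h x)" if "g \<in> carrier G" "h \<in> carrier G" "x \<in> topspace Z" for g h x
      using mult that topZ YX by blast
    show "dendron Z" unfolding Z_def by (rule dendron_subtopology[OF D Y(1,2)])
    show "C = topspace Z" if "closedin Z C" "connectedin Z C" "C \<noteq> {}" "\<And>g. g \<in> carrier G \<Longrightarrow> \<phi> g ` C \<subseteq> C" for C
      using that Y(5)[of C] Y(1) topZ by (auto simp: Z_def connectedin_subtopology closedin_closed_subtopology)
  qed
  show False
  proof (rule Z.no_nonelementary_action)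
    show "topspace Z \<noteq> {}" using Y(3) topZ by simp
    show "\<exists>g\<in>carrier G. \<phi> g ` {x, y} \<noteq> {x, y}" if "x \<in> topspace Z" "y \<in> topspace Z" for x y
      using pair[of x y] that YX topZ by blast
  qed (rule commuting)
qed

section \<open>Piecewise maps\<close>

text \<open>
  Quantifying over all connected sets that avoid the breakpoints, instead of the components,
  lets images of pieces be used directly: the image of a piece need not be a component, but it
  is connected.
\<close>

lemma piecewise_in_connected_iff:
  assumes "\<Phi> \<noteq> {}"
  shows "piecewise_in X \<Phi> P f \<longleftrightarrow>
     (\<exists>B. finite B \<and> B \<subseteq> P \<and>
        (\<forall>C. connectedin X C \<and> C \<inter> B = {} \<longrightarrow> (\<exists>\<phi>\<in>\<Phi>. \<forall>x\<in>C. f x = \<phi> x)))"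
proof -
  have "(\<forall>C \<in> connected_components_of (subtopology X (topspace X - B)). \<exists>\<phi> \<in> \<Phi>. \<forall>x \<in> C. f x = \<phi> x) \<longleftrightarrow>
      (\<forall>C. connectedin X C \<and> C \<inter> B = {} \<longrightarrow> (\<exists>\<phi>\<in>\<Phi>. \<forall>x\<in>C. f x = \<phi> x))" (is "?L \<longleftrightarrow> ?R") for B
  proof
    assume L: ?L
    show ?R
    proof (intro allI impI)
      fix C assume C: "connectedin X C \<and> C \<inter> B = {}"
      show "\<exists>\<phi>\<in>\<Phi>. \<forall>x\<in>C. f x = \<phi> x"
      proof (cases "C = {}")
        case True then show ?thesis using assms by blast
      next
        case False
        then obtain x where x: "x \<in> C" by blast
        have con: "connectedin (subtopology X (topspace X - B)) C"
          using C connectedin_subset_topspace by (fastforce simp: connectedin_subtopology)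
        let ?K = "connected_component_of_set (subtopology X (topspace X - B)) x"
        have sub: "C \<subseteq> ?K" using connected_component_of_maximal[OF con x] .
        have "x \<in> topspace (subtopology X (topspace X - B))"
          using con x connectedin_subset_topspace by blast
        then have "?K \<in> connected_components_of (subtopology X (topspace X - B))"
          by (simp add: connected_component_in_connected_components_of)
        then show ?thesis using L sub by (meson subsetD)
      qed
    qed
  next
    assume R: ?R
    show ?L
    proof
      fix C assume "C \<in> connected_components_of (subtopology X (topspace X - B))"
      then have "connectedin (subtopology X (topspace X - B)) C"
        by (rule connectedin_connected_components_of)
      then have "connectedin X C \<and> C \<inter> B = {}" by (auto simp: connectedin_subtopology)
      then show "\<exists>\<phi> \<in> \<Phi>. \<forall>x \<in> C. f x = \<phi> x" using R by blast
    qed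
  qed
  then show ?thesis unfolding piecewise_in_def by simp
qed

lemma piecewise_in_cong:
  assumes "\<And>x. x \<in> topspace X \<Longrightarrow> f x = g x" "piecewise_in X \<Phi> P f"
  shows "piecewise_in X \<Phi> P g"
proof -
  have "C \<subseteq> topspace X" if "C \<in> connected_components_of (subtopology X (topspace X - B))" for B C
    using connected_components_of_subset[OF that] by auto
  then show ?thesis using assms unfolding piecewise_in_def by (metis (no_types, lifting) subsetD)
qed

text \<open>
  The breakpoints of the composite are those of g and the preimages of those of f. This is where
  the set P of admissible breakpoints has to be invariant.
\<close>

lemma piecewise_in_compose:
  assumes g: "homeomorphic_map X X g" and pf: "piecewise_in X \<Phi> P f" and pg: "piecewise_in X \<Phi> P g"
    and P: "\<And>x. x \<in> topspace X \<Longrightarrow> g x \<in> P \<Longrightarrow> x \<in> P"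
    and \<Phi>: "\<Phi> \<noteq> {}" "\<And>\<phi> \<psi>. \<phi> \<in> \<Phi> \<Longrightarrow> \<psi> \<in> \<Phi> \<Longrightarrow> (\<lambda>x. \<phi> (\<psi> x)) \<in> \<Phi>"
  shows "piecewise_in X \<Phi> P (\<lambda>x. f (g x))"
proof -
  obtain Bf where Bf: "finite Bf" "Bf \<subseteq> P"
    "\<And>C. connectedin X C \<Longrightarrow> C \<inter> Bf = {} \<Longrightarrow> \<exists>\<phi>\<in>\<Phi>. \<forall>x\<in>C. f x = \<phi> x"
    using pf unfolding piecewise_in_connected_iff[OF \<Phi>(1)] by metis
  obtain Bg where Bg: "finite Bg" "Bg \<subseteq> P"
    "\<And>C. connectedin X C \<Longrightarrow> C \<inter> Bg = {} \<Longrightarrow> \<exists>\<phi>\<in>\<Phi>. \<forall>x\<in>C. g x = \<phi> x"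
    using pg unfolding piecewise_in_connected_iff[OF \<Phi>(1)] by metis
  define B where "B = Bg \<union> {x \<in> topspace X. g x \<in> Bf}"
  have inj: "inj_on g (topspace X)" using homeomorphic_imp_injective_map[OF g] .
  have "finite {x \<in> topspace X. g x \<in> Bf}"
    using finite_vimage_IntI[OF Bf(1) inj] by (simp add: vimage_def Int_def conj_commute)
  then have "finite B" using Bg by (simp add: B_def)
  moreover have "B \<subseteq> P" using Bf(2) Bg(2) P by (auto simp: B_def)
  moreover have "\<exists>\<phi>\<in>\<Phi>. \<forall>x\<in>C. f (g x) = \<phi> x" if C: "connectedin X C" "C \<inter> B = {}" for C
  proof -
    have CX: "C \<subseteq> topspace X" using connectedin_subset_topspace[OF C(1)] .
    have "C \<inter> Bg = {}" using C by (auto simp: B_def)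
    then obtain \<psi> where \<psi>: "\<psi> \<in> \<Phi>" "\<And>x. x \<in> C \<Longrightarrow> g x = \<psi> x" using Bg(3)[OF C(1)] by metis
    have "connectedin X (g ` C)" using homeomorphic_map_connectedness[OF g CX] C(1) by simp
    moreover have "g ` C \<inter> Bf = {}" using C(2) CX by (auto simp: B_def)
    ultimately obtain \<phi> where \<phi>: "\<phi> \<in> \<Phi>" "\<And>x. x \<in> g ` C \<Longrightarrow> f x = \<phi> x" using Bf(3) by metis
    then show ?thesis using \<psi> by (intro bexI[OF _ \<Phi>(2)[OF \<phi>(1) \<psi>(1)]]) auto
  qed
  ultimately show ?thesis unfolding piecewise_in_connected_iff[OF \<Phi>(1)] by (intro exI[of _ B]) simp
qed

lemma piecewise_in_inverse:
  assumes f: "homeomorphic_maps X X f f'" and pf: "piecewise_in X \<Phi> P f"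
    and P: "\<And>x. x \<in> topspace X \<Longrightarrow> x \<in> P \<Longrightarrow> f x \<in> P" "P \<subseteq> topspace X"
    and \<Phi>: "\<Phi> \<noteq> {}" "\<And>\<phi>. \<phi> \<in> \<Phi> \<Longrightarrow> \<exists>\<psi>\<in>\<Phi>. \<forall>x. \<psi> (\<phi> x) = x"
  shows "piecewise_in X \<Phi> P f'"
proof -
  obtain B where B: "finite B" "B \<subseteq> P"
    "\<And>C. connectedin X C \<Longrightarrow> C \<inter> B = {} \<Longrightarrow> \<exists>\<phi>\<in>\<Phi>. \<forall>x\<in>C. f x = \<phi> x"
    using pf unfolding piecewise_in_connected_iff[OF \<Phi>(1)] by metis
  have f': "homeomorphic_map X X f'" using f homeomorphic_maps_map homeomorphic_maps_sym by blast
  have inv: "\<And>x. x \<in> topspace X \<Longrightarrow> f (f' x) = x" using f by (auto simp: homeomorphic_maps_def)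
  have "finite (f ` B)" "f ` B \<subseteq> P" using B(1,2) P by (simp, blast)
  moreover have "\<exists>\<psi>\<in>\<Phi>. \<forall>y\<in>C. f' y = \<psi> y" if C: "connectedin X C" "C \<inter> f ` B = {}" for C
  proof -
    have CX: "C \<subseteq> topspace X" using connectedin_subset_topspace[OF C(1)] .
    have "connectedin X (f' ` C)" using homeomorphic_map_connectedness[OF f' CX] C(1) by simp
    moreover have "f' y \<notin> B" if "y \<in> C" for y using C(2) CX inv[of y] that by (metis disjoint_iff image_eqI subsetD)
    then have "f' ` C \<inter> B = {}" by blast
    ultimately obtain \<phi> where \<phi>: "\<phi> \<in> \<Phi>" "\<And>x. x \<in> f' ` C \<Longrightarrow> f x = \<phi> x" using B(3) by metis
    obtain \<psi> where \<psi>: "\<psi> \<in> \<Phi>" "\<And>x. \<psi> (\<phi> x) = x" using \<Phi>(2)[OF \<phi>(1)] by metis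
    have "f' y = \<psi> y" if "y \<in> C" for y
      using \<phi>(2)[of "f' y"] \<psi>(2)[of "f' y"] inv[of y] that CX by auto
    then show ?thesis using \<psi>(1) by blast
  qed
  ultimately show ?thesis unfolding piecewise_in_connected_iff[OF \<Phi>(1)] by (intro exI[of _ "f ` B"]) simp
qed

section \<open>Groups of bijections: supports and germs\<close>

lemma disjoint_support_compose_commute:
  assumes "f \<in> Bij S" "g \<in> Bij S" "\<And>x. x \<in> S - A \<Longrightarrow> f x = x" "\<And>x. x \<in> S - B \<Longrightarrow> g x = x" "A \<inter> B = {}"
  shows "compose S f g = compose S g f"
proof
  fix x
  have f: "inj_on f S" "\<And>x. x \<in> S \<Longrightarrow> f x \<in> S" and g: "inj_on g S" "\<And>x. x \<in> S \<Longrightarrow> g x \<in> S"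
    using assms(1,2) by (auto simp: Bij_def bij_betw_def)
  show "compose S f g x = compose S g f x"
  proof (cases "x \<in> S")
    case True
    have "f (g x) = g (f x)"
    proof (cases "f x = x")
      case fx: True
      then show ?thesis
      proof (cases "g x = x")
        case False
        then have "g x \<in> B" using assms(4)[of "g x"] inj_onD[OF g(1), of "g x" x] True g(2) by blast
        then show ?thesis using assms(3)[of "g x"] assms(5) g(2)[OF True] fx by auto
      qed simp
    next
      case False
      then have "x \<in> A" "f x \<in> A"
        using assms(3)[of x] assms(3)[of "f x"] inj_onD[OF f(1), of "f x" x] True f(2) by blast+
      then have "x \<in> S - B" "f x \<in> S - B" using assms(5) True f(2) by auto
      then show ?thesis using assms(4) by simp
    qed
    then show ?thesis using True by (simp add: compose_def)
  qed (simp add: compose_def)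
qed

locale bijection_group =
  fixes S :: "'a set" and K :: "('a \<Rightarrow> 'a) set" and G :: "('a \<Rightarrow> 'a) monoid"
  assumes G_eq: "G = (BijGroup S)\<lparr>carrier := K\<rparr>"
    and K_Bij: "K \<subseteq> Bij S"
    and K_id: "(\<lambda>x\<in>S. x) \<in> K"
    and K_compose: "f \<in> K \<Longrightarrow> g \<in> K \<Longrightarrow> compose S f g \<in> K"
    and K_inverse: "f \<in> K \<Longrightarrow> (\<lambda>x\<in>S. inv_into S f x) \<in> K"
begin

lemma subgroup_K: "subgroup K (BijGroup S)"
proof (rule group.subgroupI[OF group_BijGroup])
  show "K \<subseteq> carrier (BijGroup S)" using K_Bij by (simp add: BijGroup_def)
  show "K \<noteq> {}" using K_id by blast
  show "inv\<^bsub>BijGroup S\<^esub> f \<in> K" if "f \<in> K" for f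
    using K_inverse[OF that] inv_BijGroup[of f S] that K_Bij by auto
  show "f \<otimes>\<^bsub>BijGroup S\<^esub> g \<in> K" if "f \<in> K" "g \<in> K" for f g
    using K_compose[OF that] that K_Bij by (auto simp: BijGroup_def)
qed

lemma group_G: "group G"
  unfolding G_eq by (rule subgroup.subgroup_is_group[OF subgroup_K group_BijGroup])

sublocale group G by (rule group_G)

lemma carrier_G: "carrier G = K" by (simp add: G_eq)

lemma mult_G: "f \<in> K \<Longrightarrow> g \<in> K \<Longrightarrow> f \<otimes>\<^bsub>G\<^esub> g = compose S f g"
  using K_Bij by (auto simp: G_eq BijGroup_def)

lemma mult_apply: "f \<in> K \<Longrightarrow> g \<in> K \<Longrightarrow> x \<in> S \<Longrightarrow> (f \<otimes>\<^bsub>G\<^esub> g) x = f (g x)"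
  by (simp add: mult_G compose_def)

lemma one_apply: "x \<in> S \<Longrightarrow> \<one>\<^bsub>G\<^esub> x = x"
  by (simp add: G_eq BijGroup_def)

lemma K_mem: "f \<in> K \<Longrightarrow> x \<in> S \<Longrightarrow> f x \<in> S"
  using K_Bij Bij_imp_funcset by blast

lemma inv_closed_K: "f \<in> K \<Longrightarrow> inv\<^bsub>G\<^esub> f \<in> K"
  using inv_closed by (simp add: carrier_G)

lemma inv_apply: "f \<in> K \<Longrightarrow> x \<in> S \<Longrightarrow> (inv\<^bsub>G\<^esub> f) (f x) = x" "f \<in> K \<Longrightarrow> x \<in> S \<Longrightarrow> f ((inv\<^bsub>G\<^esub> f) x) = x"
  using mult_apply[of "inv\<^bsub>G\<^esub> f" f x] mult_apply[of f "inv\<^bsub>G\<^esub> f" x] one_apply[of x] inv_closed_K[of f]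
    l_inv[of f] r_inv[of f] carrier_G by auto

lemma comm_closed_K: "f \<in> K \<Longrightarrow> g \<in> K \<Longrightarrow> comm f g \<in> K"
  using carrier_G by (metis comm_def inv_closed m_closed)

lemma comm_apply:
  assumes "f \<in> K" "g \<in> K" "x \<in> S"
  shows "comm f g x = f (g ((inv\<^bsub>G\<^esub> f) ((inv\<^bsub>G\<^esub> g) x)))"
  using assms inv_closed_K K_mem carrier_G m_closed unfolding comm_def
  by (simp add: mult_apply)

text \<open>
  Conjugation by h moves the supports of n and m from A to h A, which is disjoint from A.
\<close>

lemma commuting_conjugates_of_displacement:
  assumes nm: "n \<in> K" "m \<in> K" and supp: "\<And>x f. f \<in> {n, m} \<Longrightarrow> x \<in> S - A \<Longrightarrow> f x = x"
    and h: "h \<in> K" "h ` A \<inter> A = {}" and A: "A \<subseteq> S"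
  shows "has_commuting_conjugates n m"
  unfolding has_commuting_conjugates_def
proof (rule bexI[of _ h], intro ballI)
  show "h \<in> carrier G" using h(1) by (simp add: carrier_G)
  fix x y assume xy: "x \<in> {n, m}" "y \<in> {n, m}"
  then have K: "x \<in> K" "y \<in> K" using nm by auto
  define c where "c = h \<otimes>\<^bsub>G\<^esub> x \<otimes>\<^bsub>G\<^esub> inv\<^bsub>G\<^esub> h"
  have hx: "h \<otimes>\<^bsub>G\<^esub> x \<in> K" and c: "c \<in> K"
    using h K carrier_G m_closed inv_closed unfolding c_def by metis+
  have "c z = z" if z: "z \<in> S - h ` A" for z
  proof -
    have w: "(inv\<^bsub>G\<^esub> h) z \<in> S" using z K_mem[OF inv_closed_K[OF h(1)]] by blast
    have "h ((inv\<^bsub>G\<^esub> h) z) = z" using inv_apply(2)[OF h(1)] z by blast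
    moreover from this have "(inv\<^bsub>G\<^esub> h) z \<notin> A" using z by (metis DiffD2 image_eqI)
    moreover have "c z = h (x ((inv\<^bsub>G\<^esub> h) z))"
      unfolding c_def using mult_apply[OF hx inv_closed_K[OF h(1)]] mult_apply[OF h(1) K(1) w] z by simp
    ultimately show ?thesis using supp[OF xy(1), of "(inv\<^bsub>G\<^esub> h) z"] w by simp
  qed
  moreover have "y z = z" if "z \<in> S - A" for z using supp[OF xy(2) that] .
  ultimately have "compose S c y = compose S y c"
    using disjoint_support_compose_commute[of c S y "h ` A" A] c K K_Bij h(2) by blast
  then show "c \<otimes>\<^bsub>G\<^esub> y = y \<otimes>\<^bsub>G\<^esub> c" using mult_G c K by simp
qed

end

text \<open>
  The filter F stands for the points near one end of the space S, and T a b for the affine map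
  with slope a and translation part b in a coordinate at that end. The set V of admissible
  translation parts makes it possible to treat an end that is a finite point, where V is {0},
  together with the end of a line, where V is everything.
\<close>

locale affine_germs = bijection_group +
  fixes F :: "'a filter" and T :: "real \<Rightarrow> real \<Rightarrow> 'a \<Rightarrow> 'a" and V :: "real set"
  assumes T_one: "T 1 0 z = z"
    and T_mult: "T \<alpha> \<beta> (T \<alpha>' \<beta>' z) = T (\<alpha> * \<alpha>') (\<alpha> * \<beta>' + \<beta>) z"
    and V: "\<beta> \<in> V \<Longrightarrow> \<beta>' \<in> V \<Longrightarrow> c * \<beta>' + \<beta> \<in> V" "0 \<in> V"
    and T_filter: "\<alpha> > 0 \<Longrightarrow> \<beta> \<in> V \<Longrightarrow> filterlim (T \<alpha> \<beta>) F F"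
    and F_S: "eventually (\<lambda>z. z \<in> S) F"
    and germ: "f \<in> K \<Longrightarrow> \<exists>\<alpha>>0. \<exists>\<beta>\<in>V. eventually (\<lambda>z. f z = T \<alpha> \<beta> z) F"
begin

definition has_germ :: "('a \<Rightarrow> 'a) \<Rightarrow> real \<Rightarrow> real \<Rightarrow> bool" where
  "has_germ f \<alpha> \<beta> \<longleftrightarrow> \<alpha> > 0 \<and> \<beta> \<in> V \<and> eventually (\<lambda>z. f z = T \<alpha> \<beta> z) F"

lemma has_germ_exists: "f \<in> K \<Longrightarrow> \<exists>\<alpha> \<beta>. has_germ f \<alpha> \<beta>"
  using germ unfolding has_germ_def by blast

lemma has_germ_compose:
  assumes "has_germ f \<alpha> \<beta>" "has_germ g \<alpha>' \<beta>'"
  shows "has_germ (\<lambda>z. f (g z)) (\<alpha> * \<alpha>') (\<alpha> * \<beta>' + \<beta>)"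
proof -
  have "eventually (\<lambda>z. f (T \<alpha>' \<beta>' z) = T \<alpha> \<beta> (T \<alpha>' \<beta>' z)) F"
    using eventually_compose_filterlim[of "\<lambda>z. f z = T \<alpha> \<beta> z" F "T \<alpha>' \<beta>'" F] assms T_filter[of \<alpha>' \<beta>']
    by (simp add: has_germ_def)
  moreover have "eventually (\<lambda>z. g z = T \<alpha>' \<beta>' z) F" using assms(2) by (simp add: has_germ_def)
  ultimately have "eventually (\<lambda>z. f (g z) = T (\<alpha> * \<alpha>') (\<alpha> * \<beta>' + \<beta>) z) F"
    by eventually_elim (simp add: T_mult)
  then show ?thesis using assms V unfolding has_germ_def by simp
qed

lemma has_germ_inv:
  assumes f: "f \<in> K" and g: "has_germ f \<alpha> \<beta>"
  shows "has_germ (inv\<^bsub>G\<^esub> f) (1 / \<alpha>) (- \<beta> / \<alpha>)"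
proof -
  have \<alpha>: "\<alpha> > 0" and \<beta>: "\<beta> \<in> V" and ev: "eventually (\<lambda>z. f z = T \<alpha> \<beta> z) F"
    using g by (auto simp: has_germ_def)
  have \<beta>': "- \<beta> / \<alpha> \<in> V" using V(1)[OF V(2) \<beta>, of "- 1 / \<alpha>"] by simp
  have lim: "filterlim (T (1 / \<alpha>) (- \<beta> / \<alpha>)) F F" using T_filter \<alpha> \<beta>' by simp
  have "eventually (\<lambda>z. f (T (1 / \<alpha>) (- \<beta> / \<alpha>) z) = z) F"
    using eventually_compose_filterlim[OF ev lim] \<alpha> by (simp add: T_mult T_one)
  moreover have "eventually (\<lambda>z. T (1 / \<alpha>) (- \<beta> / \<alpha>) z \<in> S) F"
    using eventually_compose_filterlim[OF F_S lim] .
  ultimately have "eventually (\<lambda>z. (inv\<^bsub>G\<^esub> f) z = T (1 / \<alpha>) (- \<beta> / \<alpha>) z) F"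
    by eventually_elim (metis inv_apply(1)[OF f])
  then show ?thesis using \<alpha> \<beta>' by (simp add: has_germ_def)
qed

lemma has_germ_comm:
  assumes f: "f \<in> K" "has_germ f \<alpha> \<beta>" and g: "g \<in> K" "has_germ g \<alpha>' \<beta>'"
  shows "has_germ (comm f g) 1 ((\<alpha> - 1) * \<beta>' - (\<alpha>' - 1) * \<beta>)"
proof -
  have pos: "\<alpha> > 0" "\<alpha>' > 0" using f g by (auto simp: has_germ_def)
  let ?h = "\<lambda>z. f (g ((inv\<^bsub>G\<^esub> f) ((inv\<^bsub>G\<^esub> g) z)))"
  have h: "has_germ ?h (\<alpha> * (\<alpha>' * (1 / \<alpha> * (1 / \<alpha>'))))
     (\<alpha> * (\<alpha>' * (1 / \<alpha> * (- \<beta>' / \<alpha>') + - \<beta> / \<alpha>) + \<beta>') + \<beta>)"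
    by (intro has_germ_compose has_germ_inv f g)
  have "\<alpha> * (\<alpha>' * (1 / \<alpha> * (1 / \<alpha>'))) = 1"
    "\<alpha> * (\<alpha>' * (1 / \<alpha> * (- \<beta>' / \<alpha>') + - \<beta> / \<alpha>) + \<beta>') + \<beta> = (\<alpha> - 1) * \<beta>' - (\<alpha>' - 1) * \<beta>"
    using pos by (simp_all add: field_simps)
  then have "has_germ ?h 1 ((\<alpha> - 1) * \<beta>' - (\<alpha>' - 1) * \<beta>)" using h by simp
  moreover have "eventually (\<lambda>z. comm f g z = ?h z) F"
    using F_S by eventually_elim (rule comm_apply[OF f(1) g(1)])
  ultimately show ?thesis unfolding has_germ_def by (auto elim: eventually_elim2)
qed

text \<open>
  Germs at the end are affine, and the affine group is metabelian: commutators have translations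
  as germs, and translations commute.
\<close>

lemma double_comm_eventually_id:
  assumes "n \<in> comms (comms K)"
  shows "eventually (\<lambda>z. n z = z) F"
proof -
  obtain a b c d where n: "n = comm (comm a b) (comm c d)" and K: "a \<in> K" "b \<in> K" "c \<in> K" "d \<in> K"
    using assms by (auto simp: comms_def)
  obtain \<beta> where ab: "has_germ (comm a b) 1 \<beta>" using K has_germ_exists has_germ_comm by metis
  obtain \<beta>' where cd: "has_germ (comm c d) 1 \<beta>'" using K has_germ_exists has_germ_comm by metis
  have "has_germ n 1 0"
    using has_germ_comm[OF comm_closed_K[OF K(1,2)] ab comm_closed_K[OF K(3,4)] cd] by (simp add: n)
  then show ?thesis by (simp add: has_germ_def T_one)
qed

end

section \<open>Moebius transformations over a subring\<close>

lemma subring_real: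
  assumes "subring A (cring_class_ops :: real ring)"
  shows "0 \<in> A" "1 \<in> A" "a \<in> A \<Longrightarrow> - a \<in> A" "a \<in> A \<Longrightarrow> b \<in> A \<Longrightarrow> a + b \<in> A"
    "a \<in> A \<Longrightarrow> b \<in> A \<Longrightarrow> a * b \<in> A" "real k \<in> A"
proof -
  interpret cring "cring_class_ops :: real ring" by (rule cring_class)
  show z: "0 \<in> A" and o: "1 \<in> A" using subringE(2,3)[OF assms] by (simp_all add: zero_class one_class)
  show add: "a \<in> A \<Longrightarrow> b \<in> A \<Longrightarrow> a + b \<in> A" for a b
    using subringE(7)[OF assms, of a b] by (simp add: plus_class)
  show "a \<in> A \<Longrightarrow> - a \<in> A" using subringE(5)[OF assms, of a] by (simp add: uminus_class)
  show "a \<in> A \<Longrightarrow> b \<in> A \<Longrightarrow> a * b \<in> A" using subringE(6)[OF assms, of a b] by (simp add: times_class)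
  show "real k \<in> A" using z o add by (induction k) auto
qed

lemma moebius_P1_mult:
  assumes "det M \<noteq> 0" "det N \<noteq> 0"
  shows "moebius_P1 M (moebius_P1 N z) = moebius_P1 (M ** N) z"
proof -
  obtain a b c d where N: "N$1$1 = a" "N$1$2 = b" "N$2$1 = c" "N$2$2 = d" by blast
  obtain e f g h where M: "M$1$1 = e" "M$1$2 = f" "M$2$1 = g" "M$2$2 = h" by blast
  have MN: "(M ** N)$1$1 = e * a + f * c" "(M ** N)$1$2 = e * b + f * d"
    "(M ** N)$2$1 = g * a + h * c" "(M ** N)$2$2 = g * b + h * d"
    by (simp_all add: matrix_matrix_mult_def sum_2 M N)
  have dN: "a * d - b * c \<noteq> 0" and dM: "e * h - f * g \<noteq> 0" using assms by (simp_all add: det_2 M N)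
  show ?thesis
  proof (cases z)
    case None
    show ?thesis
    proof (cases "c = 0")
      case True
      then have "a \<noteq> 0" using dN by auto
      then show ?thesis using None True by (simp add: moebius_P1_def M N MN)
    next
      case False
      have "g * (a / c) + h = 0 \<longleftrightarrow> g * a + h * c = 0" using False by (simp add: field_simps)
      moreover have "(e * (a / c) + f) / (g * (a / c) + h) = (e * a + f * c) / (g * a + h * c)"
        if "g * a + h * c \<noteq> 0" using False that by (simp add: divide_simps)
      ultimately show ?thesis using None False by (simp add: moebius_P1_def M N MN)
    qed
  next
    case (Some x)
    have num: "(e * a + f * c) * x + (e * b + f * d) = e * (a * x + b) + f * (c * x + d)"
      and den: "(g * a + h * c) * x + (g * b + h * d) = g * (a * x + b) + h * (c * x + d)"
      by (simp_all add: algebra_simps)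
    show ?thesis
    proof (cases "c * x + d = 0")
      case True
      have "a * x + b \<noteq> 0"
      proof
        assume "a * x + b = 0"
        have "(a * d - b * c) * x = d * (a * x + b) - b * (c * x + d)" by (simp add: algebra_simps)
        moreover have "a * d - b * c = a * (c * x + d) - c * (a * x + b)" by (simp add: algebra_simps)
        ultimately show False using True \<open>a * x + b = 0\<close> dN by simp
      qed
      then show ?thesis using Some True by (simp add: moebius_P1_def M N MN num den)
    next
      case False
      define y where "y = (a * x + b) / (c * x + d)"
      have y: "a * x + b = y * (c * x + d)" using False by (simp add: y_def)
      have num': "e * (a * x + b) + f * (c * x + d) = (e * y + f) * (c * x + d)"
        and den': "g * (a * x + b) + h * (c * x + d) = (g * y + h) * (c * x + d)"
        unfolding y by (simp_all add: algebra_simps)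
      have "moebius_P1 N z = Some y" using Some False by (simp add: moebius_P1_def N y_def)
      then show ?thesis using Some False by (simp add: moebius_P1_def M MN num den num' den')
    qed
  qed
qed

lemma moebius_P1_one: "moebius_P1 (mat 1) z = z"
  by (cases z) (simp_all add: moebius_P1_def mat_def)

definition adjugate2 :: "real^2^2 \<Rightarrow> real^2^2" where
  "adjugate2 M = vector [vector [M$2$2, - M$1$2], vector [- M$2$1, M$1$1]]"

lemma adjugate2_mult:
  assumes "det M = 1"
  shows "adjugate2 M ** M = mat 1" "M ** adjugate2 M = mat 1"
  using assms by (auto simp: vec_eq_iff forall_2 matrix_matrix_mult_def sum_2 adjugate2_def mat_def det_2 algebra_simps)

lemma SL2_one: "subring A (cring_class_ops :: real ring) \<Longrightarrow> mat 1 \<in> SL2 A"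
  using subring_real(1,2)[of A] det_I[where 'n=2 and 'a=real] by (simp add: SL2_def) (simp add: mat_def)

lemma SL2_closed:
  assumes A: "subring A (cring_class_ops :: real ring)"
  shows "M \<in> SL2 A \<Longrightarrow> N \<in> SL2 A \<Longrightarrow> M ** N \<in> SL2 A" "M \<in> SL2 A \<Longrightarrow> adjugate2 M \<in> SL2 A"
proof -
  show "M ** N \<in> SL2 A" if "M \<in> SL2 A" "N \<in> SL2 A"
  proof -
    have "det (M ** N) = 1" using that by (simp add: SL2_def det_mul)
    then show ?thesis using that subring_real[OF A] by (simp add: SL2_def matrix_matrix_mult_def sum_2)
  qed
  show "adjugate2 M \<in> SL2 A" if "M \<in> SL2 A"
    using that subring_real[OF A] by (auto simp: SL2_def adjugate2_def forall_2 det_2 algebra_simps)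
qed

lemma moebius_adjugate2: "det M = 1 \<Longrightarrow> moebius_P1 (adjugate2 M) (moebius_P1 M z) = z"
  using adjugate2_mult[of M] det_mul[of "adjugate2 M" M] moebius_P1_mult[of "adjugate2 M" M z] moebius_P1_one
  by (metis det_I mult_cancel_left1 mult_zero_left zero_neq_one)

lemma PSL2_compose:
  assumes A: "subring A (cring_class_ops :: real ring)" and "\<phi> \<in> PSL2 A" "\<psi> \<in> PSL2 A"
  shows "(\<lambda>z. \<phi> (\<psi> z)) \<in> PSL2 A"
proof -
  obtain M N where MN: "M \<in> SL2 A" "N \<in> SL2 A" "\<phi> = moebius_P1 M" "\<psi> = moebius_P1 N"
    using assms by (auto simp: PSL2_def)
  then have "(\<lambda>z. \<phi> (\<psi> z)) = moebius_P1 (M ** N)"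
    by (intro ext) (simp add: moebius_P1_mult SL2_def)
  then show ?thesis using SL2_closed(1)[OF A MN(1,2)] by (simp add: PSL2_def)
qed

lemma PSL2_inverse:
  assumes A: "subring A (cring_class_ops :: real ring)" and "\<phi> \<in> PSL2 A"
  shows "\<exists>\<psi>\<in>PSL2 A. \<forall>z. \<psi> (\<phi> z) = z"
proof -
  obtain M where M: "M \<in> SL2 A" "\<phi> = moebius_P1 M" using assms by (auto simp: PSL2_def)
  then show ?thesis
    using SL2_closed(2)[OF A M(1)] moebius_adjugate2[of M] by (auto simp: PSL2_def SL2_def)
qed

text \<open>
  If h fixes z, then its conjugate by phi fixes phi z and has the same trace.
\<close>

lemma hyperbolic_fixpoints_PSL2_image:
  assumes A: "subring A (cring_class_ops :: real ring)" and \<phi>: "\<phi> \<in> PSL2 A" and z: "z \<in> hyperbolic_fixpoints A"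
  shows "\<phi> z \<in> hyperbolic_fixpoints A"
proof -
  obtain N where N: "N \<in> SL2 A" "\<phi> = moebius_P1 N" using \<phi> by (auto simp: PSL2_def)
  obtain M where M: "M \<in> SL2 A" "\<bar>trace M\<bar> > 2" "moebius_P1 M z = z"
    using z by (auto simp: hyperbolic_fixpoints_def hyperbolic_in_PSL2_def)
  define Q where "Q = N ** M ** adjugate2 N"
  have dets: "det N = 1" "det M = 1" "det (adjugate2 N) = 1"
    using N M SL2_closed(2)[OF A N(1)] by (auto simp: SL2_def)
  have "Q \<in> SL2 A" using SL2_closed[OF A] N(1) M(1) by (simp add: Q_def)
  moreover have "trace Q = trace M"
  proof -
    have "trace Q = trace (adjugate2 N ** (N ** M))" unfolding Q_def by (rule trace_mul_sym)
    also have "\<dots> = trace M" using adjugate2_mult(1)[OF dets(1)] by (simp add: matrix_mul_assoc)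
    finally show ?thesis .
  qed
  moreover have "moebius_P1 Q (\<phi> z) = \<phi> z"
    using dets M(3) moebius_adjugate2[OF dets(1)]
    by (simp add: Q_def N(2) moebius_P1_mult[symmetric] det_mul)
  ultimately show ?thesis
    using M(2) unfolding hyperbolic_fixpoints_def hyperbolic_in_PSL2_def
    by (intro CollectI exI[of _ "moebius_P1 Q"] conjI bexI[of _ Q]) simp_all
qed

lemma hyperbolic_fixpoints_PSL2_iff:
  assumes A: "subring A (cring_class_ops :: real ring)" and \<phi>: "\<phi> \<in> PSL2 A"
  shows "\<phi> z \<in> hyperbolic_fixpoints A \<longleftrightarrow> z \<in> hyperbolic_fixpoints A"
  using PSL2_inverse[OF A \<phi>] hyperbolic_fixpoints_PSL2_image[OF A] \<phi> by metis

section \<open>The group of piecewise projective homeomorphisms of the line\<close>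

lemma topspace_P1 [simp]: "topspace P1 = UNIV"
  by (auto simp: P1_def) (metis not_None_eq rangeI)

text \<open>
  Neighbourhoods of finite points in the projective line are neighbourhoods in the real line, so
  continuity there can be handled with real analysis.
\<close>

lemma fixing_infinity_real_function:
  assumes f: "homeomorphic_map P1 P1 f" "f None = None"
  obtains F where "continuous_on UNIV F" "\<And>x. f (Some x) = Some (F x)"
proof -
  have inj: "inj f" using homeomorphic_imp_injective_map[OF f(1)] by simp
  define F where "F = (\<lambda>x. the (f (Some x)))"
  have F: "f (Some x) = Some (F x)" for x
  proof -
    have "f (Some x) \<noteq> None" using inj f(2) by (metis inj_eq option.distinct(1))
    then show ?thesis by (simp add: F_def)
  qed
  have "open (F -` U)" if "open U" for U
  proof -
    have "openin P1 (Some ` U)" using that by (simp add: P1_def)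
    then have "openin P1 {z \<in> topspace P1. f z \<in> Some ` U}"
      using homeomorphic_imp_continuous_map[OF f(1)] openin_continuous_map_preimage by blast
    moreover have "{z \<in> topspace P1. f z \<in> Some ` U} = Some ` (F -` U)"
    proof -
      have "z \<in> Some ` (F -` U)" if "f z \<in> Some ` U" for z
        using that f(2) F by (cases z) auto
      then show ?thesis using F by auto
    qed
    ultimately show ?thesis by (simp add: P1_def)
  qed
  then have "continuous_on UNIV F" by (simp add: continuous_on_open_vimage)
  then show ?thesis using that F by blast
qed

lemma connectedin_P1_Some: "connected C \<Longrightarrow> connectedin P1 (Some ` C)"
  unfolding P1_def using connectedin_continuous_map_image[OF continuous_map_Some, of euclideanreal C] by simp

definition line_homeos :: "real set \<Rightarrow> (real option \<Rightarrow> real option) set" where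
  "line_homeos A = {f \<in> Bij UNIV. homeomorphic_map P1 P1 f \<and>
     piecewise_in P1 (PSL2 A) (hyperbolic_fixpoints A) f \<and> f None = None}"

lemma piecewise_proj_line_group_eq:
  "piecewise_proj_line_group A = (BijGroup UNIV)\<lparr>carrier := line_homeos A\<rparr>"
proof -
  have "stabilizer (piecewise_proj_group A) (\<lambda>f. f) None = line_homeos A"
    by (auto simp: stabilizer_def piecewise_proj_group_def homeo_group_def line_homeos_def)
  then show ?thesis by (simp add: piecewise_proj_line_group_def piecewise_proj_group_def homeo_group_def)
qed

lemma PSL2_nonempty: "subring A (cring_class_ops :: real ring) \<Longrightarrow> PSL2 A \<noteq> {}"
proof -
  assume A: "subring A (cring_class_ops :: real ring)"
  have "mat 1 \<in> SL2 A" by (rule SL2_one[OF A])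
  then show ?thesis by (auto simp: PSL2_def)
qed

lemma line_homeos_pieces:
  assumes A: "subring A (cring_class_ops :: real ring)" and f: "f \<in> line_homeos A"
  obtains B F where "finite B" "Some ` B \<subseteq> hyperbolic_fixpoints A" "continuous_on UNIV F" "\<And>x. f (Some x) = Some (F x)"
    "\<And>C. connected C \<Longrightarrow> C \<inter> B = {} \<Longrightarrow> \<exists>\<phi>\<in>PSL2 A. \<forall>x\<in>C. Some (F x) = \<phi> (Some x)"
proof -
  obtain B where B: "finite B" "B \<subseteq> hyperbolic_fixpoints A"
    "\<And>C. connectedin P1 C \<Longrightarrow> C \<inter> B = {} \<Longrightarrow> \<exists>\<phi>\<in>PSL2 A. \<forall>x\<in>C. f x = \<phi> x"
    using f piecewise_in_connected_iff[OF PSL2_nonempty[OF A]] unfolding line_homeos_def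
    by (smt (verit) mem_Collect_eq)
  obtain F where F: "continuous_on UNIV F" "\<And>x. f (Some x) = Some (F x)"
    using fixing_infinity_real_function[of f] f unfolding line_homeos_def by blast
  have "finite (Some -` B)" "Some ` (Some -` B) \<subseteq> hyperbolic_fixpoints A"
    using B(1,2) by (auto intro: finite_vimageI)
  moreover have "\<exists>\<phi>\<in>PSL2 A. \<forall>x\<in>C. Some (F x) = \<phi> (Some x)" if C: "connected C" "C \<inter> Some -` B = {}" for C
  proof -
    have "Some ` C \<inter> B = {}" using C(2) by auto
    then obtain \<phi> where "\<phi> \<in> PSL2 A" "\<forall>x\<in>Some ` C. f x = \<phi> x" using B(3) connectedin_P1_Some[OF C(1)] by metis
    then show ?thesis using F(2) by (intro bexI[of _ \<phi>]) auto
  qed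
  ultimately show ?thesis using that[of "Some -` B" F] F by blast
qed

text \<open>
  The value of f at a breakpoint is determined by continuity only. At every real point r,
  breakpoint or not, f agrees with the element of PSL2 A that describes f immediately to the
  right of r, and this element preserves the set of fixed points.
\<close>

lemma line_homeos_fixpoints_iff:
  assumes A: "subring A (cring_class_ops :: real ring)" and f: "f \<in> line_homeos A"
  shows "f z \<in> hyperbolic_fixpoints A \<longleftrightarrow> z \<in> hyperbolic_fixpoints A"
proof (cases z)
  case None then show ?thesis using f by (simp add: line_homeos_def)
next
  case (Some r)
  obtain B F where B: "finite B" "Some ` B \<subseteq> hyperbolic_fixpoints A" and F: "continuous_on UNIV F" "\<And>x. f (Some x) = Some (F x)"
    and piece: "\<And>C. connected C \<Longrightarrow> C \<inter> B = {} \<Longrightarrow> \<exists>\<phi>\<in>PSL2 A. \<forall>x\<in>C. Some (F x) = \<phi> (Some x)"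
    by (rule line_homeos_pieces[OF A f]) (rule that)
  obtain e where e: "e > 0" "\<And>b. b \<in> B \<Longrightarrow> b \<noteq> r \<Longrightarrow> e \<le> dist r b"
    using finite_set_avoid[OF B(1), of r] by metis
  have "{r<..<r + e} \<inter> B = {}" using e(2) by (force simp: dist_real_def)
  then obtain \<phi> where \<phi>: "\<phi> \<in> PSL2 A" "\<And>x. x \<in> {r<..<r + e} \<Longrightarrow> Some (F x) = \<phi> (Some x)"
    using piece[of "{r<..<r + e}"] by auto
  obtain M where M: "M \<in> SL2 A" "\<phi> = moebius_P1 M" using \<phi>(1) by (auto simp: PSL2_def)
  obtain a b c d where abcd: "M$1$1 = a" "M$1$2 = b" "M$2$1 = c" "M$2$2 = d" by blast
  have det: "a * d - b * c = 1" using M(1) by (simp add: SL2_def det_2 abcd)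
  \<comment> \<open>Without denominators, the equation passes to the limit before it is known that r is not a
    pole.\<close>
  have eq: "F x * (c * x + d) = a * x + b" if "x \<in> {r<..<r + e}" for x
    using \<phi>(2)[OF that] by (auto simp: M(2) moebius_P1_def abcd split: if_splits)
  have "F r * (c * r + d) - (a * r + b) = 0"
  proof (rule tendsto_unique)
    show "((\<lambda>x. F x * (c * x + d) - (a * x + b)) \<longlongrightarrow> F r * (c * r + d) - (a * r + b)) (at_right r)"
    proof -
      have "(F \<longlongrightarrow> F r) (at_right r)"
        using F(1) by (metis UNIV_I continuous_on_eq_continuous_within continuous_within tendsto_within_subset top_greatest)
      then show ?thesis by (intro tendsto_intros)
    qed
    have "eventually (\<lambda>x. F x * (c * x + d) - (a * x + b) = 0) (at_right r)"
      using eq e(1) by (intro eventually_at_rightI[of r "r + e"]) auto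
    then show "((\<lambda>x. F x * (c * x + d) - (a * x + b)) \<longlongrightarrow> 0) (at_right r)"
      by (rule tendsto_eventually)
  qed simp
  then have Fr: "F r * (c * r + d) = a * r + b" by simp
  have "c * r + d \<noteq> 0"
  proof
    assume 0: "c * r + d = 0"
    then have "a * r + b = 0" using Fr by simp
    moreover have "a * d - b * c = a * (c * r + d) - c * (a * r + b)" by (simp add: algebra_simps)
    ultimately show False using 0 det by simp
  qed
  then have "f z = \<phi> z" using Fr by (simp add: Some F(2) M(2) moebius_P1_def abcd field_simps)
  then show ?thesis using hyperbolic_fixpoints_PSL2_iff[OF A \<phi>(1)] by simp
qed

lemma line_homeos_bijection_group:
  assumes A: "subring A (cring_class_ops :: real ring)"
  shows "bijection_group UNIV (line_homeos A) (piecewise_proj_line_group A)"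
proof
  note PSL = PSL2_nonempty[OF A]
  show "piecewise_proj_line_group A = (BijGroup UNIV)\<lparr>carrier := line_homeos A\<rparr>"
    by (rule piecewise_proj_line_group_eq)
  show "line_homeos A \<subseteq> Bij UNIV" by (auto simp: line_homeos_def)
  have "mat 1 \<in> SL2 A" by (rule SL2_one[OF A])
  then have id: "moebius_P1 (mat 1) \<in> PSL2 A" by (simp add: PSL2_def)
  have "piecewise_in P1 (PSL2 A) (hyperbolic_fixpoints A) (\<lambda>x. x)"
    unfolding piecewise_in_connected_iff[OF PSL] using id moebius_P1_one by (intro exI[of _ "{}"]) fastforce
  moreover have "(\<lambda>x\<in>UNIV. x) = (\<lambda>x::real option. x)" by auto
  ultimately show "(\<lambda>x\<in>UNIV. x) \<in> line_homeos A"
    using homeomorphic_map_id[of P1 P1] id_Bij[of "UNIV :: real option set"] by (simp add: line_homeos_def id_def)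
  show "compose UNIV f g \<in> line_homeos A" if f: "f \<in> line_homeos A" and g: "g \<in> line_homeos A" for f g
  proof -
    have "compose UNIV f g = f \<circ> g" by (auto simp: compose_def)
    moreover have "piecewise_in P1 (PSL2 A) (hyperbolic_fixpoints A) (\<lambda>x. f (g x))"
    proof (rule piecewise_in_compose[where f = f and g = g])
      show "PSL2 A \<noteq> {}" by (rule PSL)
      show "(\<lambda>x. \<phi> (\<psi> x)) \<in> PSL2 A" if "\<phi> \<in> PSL2 A" "\<psi> \<in> PSL2 A" for \<phi> \<psi>
        by (rule PSL2_compose[OF A that])
      show "homeomorphic_map P1 P1 g" "piecewise_in P1 (PSL2 A) (hyperbolic_fixpoints A) f"
        "piecewise_in P1 (PSL2 A) (hyperbolic_fixpoints A) g" using f g by (simp_all add: line_homeos_def)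
    qed (simp_all add: line_homeos_fixpoints_iff[OF A g])
    moreover have "homeomorphic_map P1 P1 (f \<circ> g)"
      using f g homeomorphic_map_compose[of P1 P1 g P1 f] by (simp add: line_homeos_def)
    moreover have "compose UNIV f g \<in> Bij UNIV" using f g by (intro compose_Bij) (auto simp: line_homeos_def)
    ultimately show ?thesis using f g by (simp add: line_homeos_def o_def)
  qed
  show "(\<lambda>x\<in>UNIV. inv_into UNIV f x) \<in> line_homeos A" if f: "f \<in> line_homeos A" for f
  proof -
    have bij: "bij f" using f by (simp add: line_homeos_def Bij_def)
    have "homeomorphic_map P1 P1 f" using f by (simp add: line_homeos_def)
    then obtain f' where f': "homeomorphic_maps P1 P1 f f'" unfolding homeomorphic_map_maps by blast
    then have "f (f' x) = x" for x by (simp add: homeomorphic_maps_def)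
    then have inv: "inv_into UNIV f = f'" using bij by (intro ext) (simp add: bij_def inv_into_f_eq)
    have "homeomorphic_map P1 P1 f'" using f' homeomorphic_maps_map homeomorphic_maps_sym by blast
    moreover have "piecewise_in P1 (PSL2 A) (hyperbolic_fixpoints A) f'"
    proof (rule piecewise_in_inverse[OF f'])
      show "PSL2 A \<noteq> {}" by (rule PSL)
      show "\<exists>\<psi>\<in>PSL2 A. \<forall>z. \<psi> (\<phi> z) = z" if "\<phi> \<in> PSL2 A" for \<phi>
        by (rule PSL2_inverse[OF A that])
      show "piecewise_in P1 (PSL2 A) (hyperbolic_fixpoints A) f" using f by (simp add: line_homeos_def)
    qed (simp_all add: line_homeos_fixpoints_iff[OF A f])
    moreover have "f' None = None"
    proof -
      have "f' (f None) = None" using f' by (simp add: homeomorphic_maps_def)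
      then show ?thesis using f by (simp add: line_homeos_def)
    qed
    moreover have res: "restrict f' UNIV = f'" by auto
    then have "f' \<in> Bij UNIV" using restrict_inv_into_Bij[of f UNIV] f inv by (simp add: line_homeos_def)
    ultimately show ?thesis unfolding inv res by (simp add: line_homeos_def)
  qed
qed

section \<open>Behaviour at the ends of the line\<close>

text \<open>
  Let L be the filter of one of the ends of the line. Close to that end f is a single Moebius
  map. If it did not fix infinity, then f would have a finite limit a / c at the end, although f
  is proper: the preimage under f of a compact neighbourhood of a / c is bounded. So c = 0, and
  the slope is a / d = a^2 because a * d = 1.
\<close>

lemma line_homeos_germ_at_infinity:
  assumes A: "subring A (cring_class_ops :: real ring)" and f: "f \<in> line_homeos A"
    and L: "L \<le> at_infinity" "L \<noteq> bot"
    and rays: "\<And>B. finite B \<Longrightarrow> \<exists>C. connected C \<and> C \<inter> B = {} \<and> eventually (\<lambda>x. x \<in> C) L"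
  shows "\<exists>\<alpha>>0. \<exists>\<beta>. eventually (\<lambda>x. f (Some x) = Some (\<alpha> * x + \<beta>)) L"
proof -
  obtain B F where B: "finite B" "Some ` B \<subseteq> hyperbolic_fixpoints A" and F: "continuous_on UNIV F" "\<And>x. f (Some x) = Some (F x)"
    and piece: "\<And>C. connected C \<Longrightarrow> C \<inter> B = {} \<Longrightarrow> \<exists>\<phi>\<in>PSL2 A. \<forall>x\<in>C. Some (F x) = \<phi> (Some x)"
    by (rule line_homeos_pieces[OF A f]) (rule that)
  obtain C where C: "connected C" "C \<inter> B = {}" "eventually (\<lambda>x. x \<in> C) L" using rays[OF B(1)] by blast
  obtain \<phi> where \<phi>: "\<phi> \<in> PSL2 A" "\<And>x. x \<in> C \<Longrightarrow> Some (F x) = \<phi> (Some x)" using piece[OF C(1,2)] by blast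
  obtain M where M: "M \<in> SL2 A" "\<phi> = moebius_P1 M" using \<phi>(1) by (auto simp: PSL2_def)
  obtain a b c d where abcd: "M$1$1 = a" "M$1$2 = b" "M$2$1 = c" "M$2$2 = d" by blast
  have det: "a * d - b * c = 1" using M(1) by (simp add: SL2_def det_2 abcd)
  have Fx: "c * x + d \<noteq> 0 \<and> F x = (a * x + b) / (c * x + d)" if "x \<in> C" for x
    using \<phi>(2)[OF that] by (auto simp: M(2) moebius_P1_def abcd split: if_splits)
  have "c = 0"
  proof (rule ccontr)
    assume c: "c \<noteq> 0"
    have inv0: "((\<lambda>x::real. inverse x) \<longlongrightarrow> 0) L"
      using tendsto_mono[OF L(1) tendsto_inverse_0] .
    have "((\<lambda>x. (a + b * inverse x) / (c + d * inverse x)) \<longlongrightarrow> (a + b * 0) / (c + d * 0)) L"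
      using c by (intro tendsto_intros inv0) auto
    moreover have nz: "eventually (\<lambda>x::real. x \<noteq> 0) L"
    proof -
      have "eventually (\<lambda>x::real. x \<noteq> 0) at_infinity" by (auto simp: eventually_at_infinity intro!: exI[of _ 1])
      then show ?thesis using L(1) by (auto simp: le_filter_def)
    qed
    have "eventually (\<lambda>x. (a + b * inverse x) / (c + d * inverse x) = F x) L"
      using nz C(3)
    proof eventually_elim
      case (elim x)
      then have "(a + b * inverse x) = (a * x + b) / x" "(c + d * inverse x) = (c * x + d) / x"
        by (simp_all add: field_simps)
      then show ?case using Fx[OF elim(2)] elim by simp
    qed
    ultimately have "(F \<longlongrightarrow> a / c) L" using tendsto_cong by fastforce
    then have ev: "eventually (\<lambda>x. F x \<in> cball (a / c) 1) L"
      using tendstoD[of F "a / c" L 1] by (auto elim!: eventually_mono simp: dist_commute)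
    have "homeomorphic_map P1 P1 f" using f by (simp add: line_homeos_def)
    then obtain f' where f': "homeomorphic_maps P1 P1 f f'" unfolding homeomorphic_map_maps by blast
    have f'f: "f' (f z) = z" for z using f' by (simp add: homeomorphic_maps_def)
    have "homeomorphic_map P1 P1 f'" using f' homeomorphic_maps_map homeomorphic_maps_sym by blast
    moreover have "f' None = None" using f'f[of None] f by (simp add: line_homeos_def)
    ultimately obtain F' where F': "continuous_on UNIV F'" "\<And>x. f' (Some x) = Some (F' x)"
      by (rule fixing_infinity_real_function) (rule that)
    have F'F: "F' (F x) = x" for x using f'f[of "Some x"] F F' by simp
    have "compact (F' ` cball (a / c) 1)"
      using F'(1) by (intro compact_continuous_image) (auto intro: continuous_on_subset)
    then obtain r where r: "\<And>y. y \<in> F' ` cball (a / c) 1 \<Longrightarrow> norm y \<le> r"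
      using compact_imp_bounded bounded_iff by metis
    have "eventually (\<lambda>x::real. norm x > r) at_infinity"
      by (auto simp: eventually_at_infinity intro!: exI[of _ "r + 1"])
    then have "eventually (\<lambda>x::real. norm x > r) L" using L(1) by (auto simp: le_filter_def)
    then have "eventually (\<lambda>x. False) L"
      using ev
    proof eventually_elim
      case (elim x)
      then have "x \<in> F' ` cball (a / c) 1" using F'F[of x] by (metis image_eqI)
      then show ?case using r[of x] elim by simp
    qed
    then show False using L(2) eventually_False by blast
  qed
  then have ad: "a * d = 1" using det by simp
  then have d: "d \<noteq> 0" by auto
  have "a * d > 0" using ad by simp
  then have "a / d > 0" by (simp add: zero_less_divide_iff zero_less_mult_iff)
  moreover have "eventually (\<lambda>x. f (Some x) = Some (a / d * x + b / d)) L"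
    using C(3) by eventually_elim (use Fx d in \<open>simp add: F(2) \<open>c = 0\<close> add_divide_distrib\<close>)
  ultimately show ?thesis by blast
qed

text \<open>
  Translations preserve both kinds of open sets of the one-point compactification: the open
  subsets of the line, and the complements of compact ones.
\<close>

lemma homeomorphic_map_P1_translation: "homeomorphic_map P1 P1 (map_option (\<lambda>x::real. x + t))"
proof -
  have opn: "openin P1 (map_option (\<lambda>x::real. x + t) ` U)" if U: "openin P1 U" for t U
  proof -
    have tr: "(\<lambda>x. x + t) ` K = (+) t ` K" for K :: "real set" by (auto simp: add.commute)
    have "(\<exists>V. open V \<and> U = Some ` V) \<or> (\<exists>K. compact K \<and> U = insert None (Some ` (UNIV - K)))"
      using U unfolding P1_def openin_Alexandroff_compactification by auto
    then consider V where "open V" "U = Some ` V" | K where "compact K" "U = insert None (Some ` (UNIV - K))"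
      by blast
    then show ?thesis
    proof cases
      case 1
      have "map_option (\<lambda>x. x + t) ` U = Some ` ((\<lambda>x. x + t) ` V)" by (auto simp: 1 image_image)
      moreover have "open ((\<lambda>x. x + t) ` V)" unfolding tr using 1 by (intro open_translation)
      ultimately show ?thesis by (simp add: P1_def)
    next
      case 2
      have eq: "(\<lambda>x. x + t) ` (UNIV - K) = UNIV - (\<lambda>x. x + t) ` K"
        by (rule bij_image_Compl_eq[of "\<lambda>x. x + t" K, unfolded Compl_eq_Diff_UNIV])
          (rule o_bij[of "\<lambda>x. x - t"]; simp add: fun_eq_iff)
      have "map_option (\<lambda>x. x + t) ` U = insert None (Some ` (UNIV - (\<lambda>x. x + t) ` K))"
      proof -
        have "map_option (\<lambda>x. x + t) ` Some ` V = Some ` (\<lambda>x. x + t) ` V" for V by (simp add: image_image)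
        then show ?thesis using eq by (simp only: 2(2) image_insert option.map(1))
      qed
      moreover have "compact ((\<lambda>x. x + t) ` K)" unfolding tr using 2 by (intro compact_translation)
      ultimately show ?thesis
        by (auto simp: P1_def openin_Alexandroff_compactification compact_imp_closed)
    qed
  qed
  have inv: "map_option (\<lambda>x. x - t) (map_option (\<lambda>x. x + t) z) = z"
    "map_option (\<lambda>x. x + t) (map_option (\<lambda>x. x - t) z) = z" for z :: "real option"
    by (simp_all add: option.map_comp o_def option.map_ident)
  have "open_map P1 P1 (map_option (\<lambda>x. x + t))" using opn by (simp add: open_map_def)
  moreover have "continuous_map P1 P1 (map_option (\<lambda>x. x + t))"
    unfolding continuous_map_def
  proof (intro conjI allI impI)
    fix U assume U: "openin P1 U"
    have "{z \<in> topspace P1. map_option (\<lambda>x. x + t) z \<in> U} = map_option (\<lambda>x. x + - t) ` U"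
    proof
      show "{z \<in> topspace P1. map_option (\<lambda>x. x + t) z \<in> U} \<subseteq> map_option (\<lambda>x. x + - t) ` U"
        using inv(1) by (auto intro!: image_eqI[where x = "map_option (\<lambda>x. x + t) z" for z])
      show "map_option (\<lambda>x. x + - t) ` U \<subseteq> {z \<in> topspace P1. map_option (\<lambda>x. x + t) z \<in> U}"
        using inv(2) by auto
    qed
    then show "openin P1 {z \<in> topspace P1. map_option (\<lambda>x. x + t) z \<in> U}" using opn[OF U, of "- t"] by simp
  qed simp
  moreover have "bij (map_option (\<lambda>x::real. x + t))"
    using inv by (intro o_bij[of "map_option (\<lambda>x. x - t)"]) (auto simp: fun_eq_iff)
  ultimately show ?thesis
    by (intro bijective_open_imp_homeomorphic_map) (auto simp: bij_def)
qed

lemma translation_in_line_homeos: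
  assumes A: "subring A (cring_class_ops :: real ring)"
  shows "map_option (\<lambda>x. x + real k) \<in> line_homeos A"
proof -
  let ?\<tau> = "map_option (\<lambda>x. x + real k)"
  define M :: "real^2^2" where "M = vector [vector [1, real k], vector [0, 1]]"
  have "M \<in> SL2 A" using subring_real[OF A] by (auto simp: SL2_def M_def forall_2 det_2)
  moreover have "?\<tau> = moebius_P1 M" by (auto simp: fun_eq_iff moebius_P1_def M_def split: option.splits)
  ultimately have "?\<tau> \<in> PSL2 A" by (simp add: PSL2_def)
  then have "piecewise_in P1 (PSL2 A) (hyperbolic_fixpoints A) ?\<tau>"
    unfolding piecewise_in_connected_iff[OF PSL2_nonempty[OF A]] by (intro exI[of _ "{}"]) auto
  moreover have "?\<tau> \<in> Bij UNIV"
    using homeomorphic_map_P1_translation[of "real k"] homeomorphic_imp_injective_map homeomorphic_imp_surjective_map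
    by (fastforce simp: Bij_def bij_betw_def)
  ultimately show ?thesis using homeomorphic_map_P1_translation by (simp add: line_homeos_def)
qed

lemma line_homeos_affine_germs:
  assumes A: "subring A (cring_class_ops :: real ring)"
    and L: "L \<le> at_infinity" "L \<noteq> bot"
    and rays: "\<And>B. finite B \<Longrightarrow> \<exists>C. connected C \<and> C \<inter> B = {} \<and> eventually (\<lambda>x. x \<in> C) L"
    and affine: "\<And>\<alpha> \<beta>. \<alpha> > 0 \<Longrightarrow> filterlim (\<lambda>x. \<alpha> * x + \<beta>) L L"
  shows "affine_germs UNIV (line_homeos A) (piecewise_proj_line_group A) (filtermap Some L)
    (\<lambda>\<alpha> \<beta>. map_option (\<lambda>x. \<alpha> * x + \<beta>)) UNIV"
proof (intro affine_germs.intro line_homeos_bijection_group[OF A] affine_germs_axioms.intro)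
  show "map_option (\<lambda>x::real. 1 * x + 0) z = z" for z by (simp add: option.map_ident)
  show "map_option (\<lambda>x. \<alpha> * x + \<beta>) (map_option (\<lambda>x. \<alpha>' * x + \<beta>') z) =
    map_option (\<lambda>x. \<alpha> * \<alpha>' * x + (\<alpha> * \<beta>' + \<beta>)) z" for \<alpha> \<beta> \<alpha>' \<beta>' :: real and z
    by (cases z) (simp_all add: algebra_simps)
  show "filterlim (map_option (\<lambda>x. \<alpha> * x + \<beta>)) (filtermap Some L) (filtermap Some L)"
    if "\<alpha> > 0" for \<alpha> \<beta> :: real
    using filtermap_mono[OF affine[OF that, of \<beta>, unfolded filterlim_def], of Some]
    by (simp add: filterlim_def filtermap_filtermap)
  show "\<exists>\<alpha>>0. \<exists>\<beta>\<in>UNIV. eventually (\<lambda>z. f z = map_option (\<lambda>x. \<alpha> * x + \<beta>) z) (filtermap Some L)"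
    if "f \<in> line_homeos A" for f
    using line_homeos_germ_at_infinity[OF A that L rays] by (simp add: eventually_filtermap)
qed auto

lemma affine_filterlim_at_top: "\<alpha> > 0 \<Longrightarrow> filterlim (\<lambda>x::real. \<alpha> * x + \<beta>) at_top at_top"
  unfolding filterlim_at_top_gt[where c = 0] eventually_at_top_linorder
proof (intro allI impI)
  fix Z :: real assume "\<alpha> > 0"
  then show "\<exists>N. \<forall>n\<ge>N. Z \<le> \<alpha> * n + \<beta>"
    by (intro exI[of _ "(Z - \<beta>) / \<alpha>"]) (auto simp: field_simps)
qed

lemma affine_filterlim_at_bot: "\<alpha> > 0 \<Longrightarrow> filterlim (\<lambda>x::real. \<alpha> * x + \<beta>) at_bot at_bot"
  unfolding filterlim_at_bot eventually_at_bot_linorder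
proof (intro allI)
  fix Z :: real assume "\<alpha> > 0"
  then show "\<exists>N. \<forall>n\<le>N. \<alpha> * n + \<beta> \<le> Z"
    by (intro exI[of _ "(Z - \<beta>) / \<alpha>"]) (auto simp: field_simps)
qed

lemma line_double_commutators_bounded_support:
  assumes A: "subring A (cring_class_ops :: real ring)"
    and n: "n \<in> monoid.comms (piecewise_proj_line_group A) (monoid.comms (piecewise_proj_line_group A) (line_homeos A))"
  shows "\<exists>r. \<forall>x. \<bar>x\<bar> > r \<longrightarrow> n (Some x) = Some x"
proof -
  have "\<exists>C. connected C \<and> C \<inter> B = {} \<and> eventually (\<lambda>x. x \<in> C) at_top" if "finite B" for B :: "real set"
  proof -
    obtain r where "\<And>b. b \<in> B \<Longrightarrow> b \<le> r" using bdd_above_finite[OF \<open>finite B\<close>] unfolding bdd_above_def by blast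
    then have "{r<..} \<inter> B = {}" by force
    then show ?thesis by (intro exI[of _ "{r<..}"]) (simp add: eventually_gt_at_top)
  qed
  then interpret top: affine_germs UNIV "line_homeos A" "piecewise_proj_line_group A" "filtermap Some at_top"
    "\<lambda>\<alpha> \<beta>. map_option (\<lambda>x. \<alpha> * x + \<beta>)" UNIV
    by (intro line_homeos_affine_germs[OF A] at_top_le_at_infinity affine_filterlim_at_top) auto
  have "\<exists>C. connected C \<and> C \<inter> B = {} \<and> eventually (\<lambda>x. x \<in> C) at_bot" if "finite B" for B :: "real set"
  proof -
    obtain r where "\<And>b. b \<in> B \<Longrightarrow> r \<le> b" using bdd_below_finite[OF \<open>finite B\<close>] unfolding bdd_below_def by blast
    then have "{..<r} \<inter> B = {}" by force
    then show ?thesis by (intro exI[of _ "{..<r}"]) (simp add: eventually_gt_at_bot)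
  qed
  then interpret bot: affine_germs UNIV "line_homeos A" "piecewise_proj_line_group A" "filtermap Some at_bot"
    "\<lambda>\<alpha> \<beta>. map_option (\<lambda>x. \<alpha> * x + \<beta>)" UNIV
    by (intro line_homeos_affine_germs[OF A] at_bot_le_at_infinity affine_filterlim_at_bot) auto
  obtain p where p: "\<And>x. x \<ge> p \<Longrightarrow> n (Some x) = Some x"
    using top.double_comm_eventually_id[OF n] by (auto simp: eventually_filtermap eventually_at_top_linorder)
  obtain q where q: "\<And>x. x \<le> q \<Longrightarrow> n (Some x) = Some x"
    using bot.double_comm_eventually_id[OF n] by (auto simp: eventually_filtermap eventually_at_bot_linorder)
  show ?thesis
    by (intro exI[of _ "max \<bar>p\<bar> \<bar>q\<bar>"]) (auto intro: p q simp: abs_if split: if_splits)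
qed

text \<open>
  The ring A contains the integers, so a translation by a large integer belongs to the group and
  moves any compact set off itself.
\<close>

lemma piecewise_proj_line_group_commuting_conjugates:
  fixes A :: "real set"
  defines "G \<equiv> piecewise_proj_line_group A"
  assumes A: "subring A (cring_class_ops :: real ring)"
    and n: "n \<in> monoid.comms G (monoid.comms G (carrier G))" and m: "m \<in> monoid.comms G (monoid.comms G (carrier G))"
  shows "monoid.has_commuting_conjugates G n m"
proof -
  interpret bijection_group UNIV "line_homeos A" G
    unfolding G_def by (rule line_homeos_bijection_group[OF A])
  have K: "f \<in> line_homeos A" if "f \<in> comms (comms (line_homeos A))" for f
    using that comm_closed_K by (auto simp: comms_def)
  have nm: "n \<in> comms (comms (line_homeos A))" "m \<in> comms (comms (line_homeos A))"
    using n m by (simp_all add: carrier_G)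
  obtain r s where r: "\<And>x. \<bar>x\<bar> > r \<Longrightarrow> n (Some x) = Some x" and s: "\<And>x. \<bar>x\<bar> > s \<Longrightarrow> m (Some x) = Some x"
    using line_double_commutators_bounded_support[OF A] nm unfolding G_def by metis
  define R where "R = max r s"
  obtain k :: nat where k: "real k > 2 * R" using reals_Archimedean2 by blast
  define Z where "Z = Some ` {-R..R}"
  define h where "h = map_option (\<lambda>x. x + real k)"
  have h: "h \<in> line_homeos A" using translation_in_line_homeos[OF A] by (simp add: h_def)
  have fix_off_Z: "f z = z" if "f \<in> {n, m}" "z \<in> UNIV - Z" for f z
  proof (cases z)
    case None
    have "f \<in> line_homeos A" using that(1) K nm by blast
    then show ?thesis using None by (simp add: line_homeos_def)
  next
    case (Some x)
    then have "x \<notin> {-R..R}" using that(2) unfolding Z_def by blast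
    then have "\<bar>x\<bar> > r" "\<bar>x\<bar> > s" by (auto simp: R_def)
    then show ?thesis using that(1) r[of x] s[of x] Some by blast
  qed
  have "h z \<notin> Z" if "z \<in> Z" for z
  proof -
    obtain x where x: "z = Some x" "- R \<le> x" using \<open>z \<in> Z\<close> unfolding Z_def by force
    have "h z = Some (x + real k)" by (simp add: h_def x(1))
    moreover have "x + real k > R" using k x(2) by linarith
    ultimately show ?thesis unfolding Z_def by force
  qed
  then have "h ` Z \<inter> Z = {}" by blast
  then show ?thesis
    by (intro commuting_conjugates_of_displacement[where A = Z and h = h] K[OF nm(1)] K[OF nm(2)] h fix_off_Z subset_UNIV)
qed

section \<open>Dyadic rationals\<close>

text \<open>
  The dyadic rationals of either sign, a group under addition: translation parts can be
  negative.
\<close>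

definition dyadic_reals :: "real set" where
  "dyadic_reals = {of_int m / 2 ^ k | (m :: int) (k :: nat). True}"

lemma dyadic_reals_0: "0 \<in> dyadic_reals"
  unfolding dyadic_reals_def by (intro CollectI exI[of _ 0]) simp

lemma dyadic_reals_add:
  assumes "x \<in> dyadic_reals" "y \<in> dyadic_reals" shows "x + y \<in> dyadic_reals"
proof -
  obtain m k n l where xy: "x = of_int m / 2 ^ k" "y = of_int n / 2 ^ l"
    using assms unfolding dyadic_reals_def by blast
  have "x + y = of_int (m * 2 ^ l + n * 2 ^ k) / 2 ^ (k + l)" unfolding xy by (simp add: field_simps power_add)
  then show ?thesis unfolding dyadic_reals_def by blast
qed

lemma dyadic_reals_uminus: "x \<in> dyadic_reals \<Longrightarrow> - x \<in> dyadic_reals"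
proof -
  assume "x \<in> dyadic_reals"
  then obtain m k where "x = of_int m / 2 ^ k" by (auto simp: dyadic_reals_def)
  then have "- x = of_int (- m) / 2 ^ k" by simp
  then show ?thesis unfolding dyadic_reals_def by blast
qed

lemma dyadic_reals_powi: "x \<in> dyadic_reals \<Longrightarrow> 2 powi j * x \<in> dyadic_reals"
proof -
  assume "x \<in> dyadic_reals"
  then obtain m k where x: "x = of_int m / 2 ^ k" by (auto simp: dyadic_reals_def)
  show ?thesis
  proof (cases "j \<ge> 0")
    case True
    then have "2 powi j * x = of_int (2 ^ nat j * m) / 2 ^ k" by (simp add: x power_int_def)
    then show ?thesis unfolding dyadic_reals_def by blast
  next
    case False
    then have "2 powi j * x = of_int m / 2 ^ (k + nat (- j))"
      by (simp add: x power_int_def power_add field_simps)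
    then show ?thesis unfolding dyadic_reals_def by blast
  qed
qed

lemma dyadic_reals_affine_iff:
  assumes "c \<in> dyadic_reals"
  shows "2 powi j * x + c \<in> dyadic_reals \<longleftrightarrow> x \<in> dyadic_reals"
proof
  assume "2 powi j * x + c \<in> dyadic_reals"
  then have *: "2 powi (- j) * ((2 powi j * x + c) + - c) \<in> dyadic_reals"
    by (rule dyadic_reals_powi[OF dyadic_reals_add[OF _ dyadic_reals_uminus[OF assms]]])
  have eq: "2 powi (- j) * ((2 powi j * x + c) + - c) = x" by (simp add: power_int_minus)
  show "x \<in> dyadic_reals" using * unfolding eq .
qed (intro dyadic_reals_add dyadic_reals_powi assms)

lemma dyadics_eq: "x \<ge> 0 \<Longrightarrow> x \<in> dyadics \<longleftrightarrow> x \<in> dyadic_reals"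
proof
  assume "x \<in> dyadics"
  then obtain m k where "x = of_nat m / 2 ^ k" by (auto simp: dyadics_def)
  then have "x = of_int (int m) / 2 ^ k" by simp
  then show "x \<in> dyadic_reals" unfolding dyadic_reals_def by blast
next
  assume "x \<ge> 0" "x \<in> dyadic_reals"
  then obtain m k where x: "x = of_int m / 2 ^ k" by (auto simp: dyadic_reals_def)
  then have "real_of_int m = x * 2 ^ k" by simp
  then have "real_of_int m \<ge> 0" using \<open>x \<ge> 0\<close> by simp
  then have "m \<ge> 0" by simp
  then have "x = of_nat (nat m) / 2 ^ k" using x by simp
  then show "x \<in> dyadics" unfolding dyadics_def by blast
qed

section \<open>Thompson's group\<close>

abbreviation dyadic_affine_maps :: "(real \<Rightarrow> real) set" where
  "dyadic_affine_maps \<equiv> {\<lambda>x. 2 powi k * x + c | (k :: int) (c :: real). True}"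

lemma dyadic_affine_maps_nonempty: "dyadic_affine_maps \<noteq> {}" by blast

lemma topspace_unit_interval [simp]: "topspace unit_interval = {0..1}"
  by (simp add: unit_interval_def)

definition F_homeos :: "(real \<Rightarrow> real) set" where
  "F_homeos = {f \<in> Bij {0..1}. homeomorphic_map unit_interval unit_interval f \<and> strict_mono_on {0..1} f \<and>
     piecewise_in unit_interval dyadic_affine_maps ({0..1} \<inter> dyadics) f}"

lemma thompson_F_eq: "thompson_F = (BijGroup {0..1})\<lparr>carrier := F_homeos\<rparr>"
proof -
  have "{f \<in> carrier (homeo_group unit_interval). strict_mono_on {0..1} f \<and>
     piecewise_in unit_interval dyadic_affine_maps ({0..1} \<inter> dyadics) f} = F_homeos"
    by (auto simp: F_homeos_def homeo_group_def)
  then show ?thesis by (simp add: thompson_F_def homeo_group_def)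
qed

lemma F_homeos_ends:
  assumes "f \<in> F_homeos" shows "f 0 = 0" "f 1 = 1"
proof -
  have f: "f ` {0..1} = {0..1}" "strict_mono_on {0..1} f"
    using assms by (auto simp: F_homeos_def Bij_def bij_betw_def)
  have mono: "f x \<le> f y" if "x \<in> {0..1}" "y \<in> {0..1}" "x \<le> y" for x y
    using strict_mono_on_leD[OF f(2)] that by blast
  have rng: "f x \<in> {0..1}" if "x \<in> {0..1}" for x using f(1) that by blast
  have "0 \<in> f ` {0..1}" "1 \<in> f ` {0..1}" using f(1) by auto
  then obtain x y where xy: "x \<in> {0..1}" "f x = 0" "y \<in> {0..1}" "f y = 1" by (elim imageE) auto
  have "f 0 \<le> f x" "f y \<le> f 1" using mono[of 0 x] mono[of y 1] xy by simp_all
  then show "f 0 = 0" "f 1 = 1" using xy rng[of 0] rng[of 1] by auto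
qed

text \<open>
  By continuity the formula on a piece also holds at its two ends.
\<close>

lemma F_homeos_pieces:
  assumes f: "f \<in> F_homeos"
  obtains B where "finite B" "B \<subseteq> {0..1} \<inter> dyadic_reals"
    "\<And>a b. 0 \<le> a \<Longrightarrow> a < b \<Longrightarrow> b \<le> 1 \<Longrightarrow> {a<..<b} \<inter> B = {} \<Longrightarrow> \<exists>k c. \<forall>x\<in>{a..b}. f x = 2 powi k * x + c"
proof -
  have hom: "homeomorphic_map unit_interval unit_interval f"
    and pw: "piecewise_in unit_interval dyadic_affine_maps ({0..1} \<inter> dyadics) f"
    using f by (auto simp: F_homeos_def)
  have cont: "continuous_on {0..1} f"
    using homeomorphic_imp_continuous_map[OF hom] by (simp add: unit_interval_def continuous_map_in_subtopology)
  obtain B where B: "finite B \<and> B \<subseteq> {0..1} \<inter> dyadics \<and>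
    (\<forall>C. connectedin unit_interval C \<and> C \<inter> B = {} \<longrightarrow> (\<exists>\<phi>\<in>dyadic_affine_maps. \<forall>x\<in>C. f x = \<phi> x))"
    using pw[unfolded piecewise_in_connected_iff[OF dyadic_affine_maps_nonempty]] by (rule exE)
  have "\<exists>k c. \<forall>x\<in>{a..b}. f x = 2 powi k * x + c"
    if ab: "0 \<le> a" "a < b" "b \<le> 1" "{a<..<b} \<inter> B = {}" for a b
  proof -
    have "connectedin unit_interval {a<..<b}" using ab by (auto simp: unit_interval_def connectedin_subtopology)
    then obtain \<phi> where \<phi>: "\<phi> \<in> dyadic_affine_maps" "\<forall>x\<in>{a<..<b}. f x = \<phi> x"
      using B ab(4) by meson
    obtain k c where "\<phi> = (\<lambda>x. 2 powi k * x + c)" using \<phi>(1) by blast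
    then have kc: "f x = 2 powi k * x + c" if "x \<in> {a<..<b}" for x using \<phi>(2) that by simp
    have cl: "closure {a<..<b} = {a..b}" using ab(2) by simp
    have "f x - (2 powi k * x + c) = 0" if "x \<in> {a..b}" for x
    proof (rule continuous_constant_on_closure[of "{a<..<b}" "\<lambda>x. f x - (2 powi k * x + c)"])
      show "continuous_on (closure {a<..<b}) (\<lambda>x. f x - (2 powi k * x + c))"
        unfolding cl using ab by (intro continuous_intros continuous_on_subset[OF cont]) auto
    qed (use kc cl that in auto)
    then show ?thesis by (intro exI[of _ k] exI[of _ c]) auto
  qed
  moreover have "B \<subseteq> {0..1} \<inter> dyadic_reals"
  proof
    fix x assume "x \<in> B"
    then have "x \<in> {0..1}" "x \<in> dyadics" using B by blast+
    then show "x \<in> {0..1} \<inter> dyadic_reals" using dyadics_eq[of x] by simp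
  qed
  ultimately show ?thesis using that[of B] B by blast
qed

text \<open>
  The translation parts of the pieces are arbitrary reals by definition; that they are dyadic is
  a consequence. Moving along the breakpoints from 0, where f vanishes, the value at the left
  end of a piece determines its translation part, which determines the value at the right end.
  The induction counts the breakpoints to the left of x.
\<close>

lemma F_homeos_dyadic_iff:
  assumes f: "f \<in> F_homeos" and x: "x \<in> {0..1}"
  shows "f x \<in> dyadic_reals \<longleftrightarrow> x \<in> dyadic_reals"
proof -
  obtain B where B: "finite B" "B \<subseteq> {0..1} \<inter> dyadic_reals"
    "\<And>a b. 0 \<le> a \<Longrightarrow> a < b \<Longrightarrow> b \<le> 1 \<Longrightarrow> {a<..<b} \<inter> B = {} \<Longrightarrow> \<exists>k c. \<forall>x\<in>{a..b}. f x = 2 powi k * x + c"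
    by (rule F_homeos_pieces[OF f]) (rule that)
  show ?thesis using x
  proof (induction "card {y \<in> B. y < x}" arbitrary: x rule: less_induct)
    case less
    show ?case
    proof (cases "x = 0")
      case True then show ?thesis using F_homeos_ends[OF f] dyadic_reals_0 by simp
    next
      case False
      define P where "P = insert 0 {y \<in> B. y < x}"
      define a where "a = Max P"
      have fin: "finite P" "P \<noteq> {}" using B(1) by (auto simp: P_def)
      then have aP: "a \<in> P" and a_max: "\<And>y. y \<in> P \<Longrightarrow> y \<le> a" by (auto simp: a_def)
      have a: "0 \<le> a" "a < x" "a \<le> 1" "a \<in> dyadic_reals"
        using aP B(2) less.prems False dyadic_reals_0 a_max[of 0] by (auto simp: P_def)
      have "{a<..<x} \<inter> B = {}" using a_max by (force simp: P_def)
      then obtain k c where kc: "\<And>y. y \<in> {a..x} \<Longrightarrow> f y = 2 powi k * y + c"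
        using B(3)[of a x] a less.prems by auto
      have "f a \<in> dyadic_reals"
      proof (cases "a = 0")
        case True then show ?thesis using F_homeos_ends[OF f] dyadic_reals_0 by simp
      next
        case False
        then have "a \<in> B" using aP by (simp add: P_def)
        then have "{y \<in> B. y < a} \<subset> {y \<in> B. y < x}" using a by auto
        then have "card {y \<in> B. y < a} < card {y \<in> B. y < x}" using B(1) by (intro psubset_card_mono) auto
        then show ?thesis using less.hyps[of a] a by auto
      qed
      then have "f a + - (2 powi k * a) \<in> dyadic_reals"
        using a(4) by (intro dyadic_reals_add dyadic_reals_uminus dyadic_reals_powi)
      moreover have "f a + - (2 powi k * a) = c" using kc[of a] a by simp
      ultimately have "c \<in> dyadic_reals" by simp
      then show ?thesis using kc[of x] a dyadic_reals_affine_iff by simp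
    qed
  qed
qed

lemma F_homeos_germ_0:
  assumes f: "f \<in> F_homeos"
  shows "\<exists>\<alpha>>0. eventually (\<lambda>x. f x = \<alpha> * x) (at_right 0)"
proof -
  obtain B where B: "finite B"
    "\<And>a b. 0 \<le> a \<Longrightarrow> a < b \<Longrightarrow> b \<le> 1 \<Longrightarrow> {a<..<b} \<inter> B = {} \<Longrightarrow> \<exists>k c. \<forall>x\<in>{a..b}. f x = 2 powi k * x + c"
    by (rule F_homeos_pieces[OF f]) (rule that)
  obtain e where e: "e > 0" "\<And>b. b \<in> B \<Longrightarrow> b \<noteq> 0 \<Longrightarrow> e \<le> dist 0 b"
    using finite_set_avoid[OF B(1), of 0] by metis
  define e' where "e' = min e 1"
  have "{0<..<e'} \<inter> B = {}" using e(2) by (force simp: e'_def dist_real_def)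
  then obtain k c where kc: "\<And>x. x \<in> {0..e'} \<Longrightarrow> f x = 2 powi k * x + c"
    using B(2)[of 0 e'] e(1) by (auto simp: e'_def)
  have "c = 0" using kc[of 0] F_homeos_ends(1)[OF f] e(1) by (simp add: e'_def)
  then have "eventually (\<lambda>x. f x = 2 powi k * x) (at_right 0)"
    using kc e(1) by (intro eventually_at_rightI[of 0 e']) (auto simp: e'_def)
  then show ?thesis by (intro exI[of _ "2 powi k"]) simp
qed

lemma F_homeos_germ_1:
  assumes f: "f \<in> F_homeos"
  shows "\<exists>\<alpha>>0. eventually (\<lambda>x. f x = 1 + \<alpha> * (x - 1)) (at_left 1)"
proof -
  obtain B where B: "finite B"
    "\<And>a b. 0 \<le> a \<Longrightarrow> a < b \<Longrightarrow> b \<le> 1 \<Longrightarrow> {a<..<b} \<inter> B = {} \<Longrightarrow> \<exists>k c. \<forall>x\<in>{a..b}. f x = 2 powi k * x + c"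
    by (rule F_homeos_pieces[OF f]) (rule that)
  obtain e where e: "e > 0" "\<And>b. b \<in> B \<Longrightarrow> b \<noteq> 1 \<Longrightarrow> e \<le> dist 1 b"
    using finite_set_avoid[OF B(1), of 1] by metis
  define e' where "e' = min e 1"
  have "{1 - e'<..<1} \<inter> B = {}" using e(2) by (force simp: e'_def dist_real_def)
  then obtain k c where kc: "\<And>x. x \<in> {1 - e'..1} \<Longrightarrow> f x = 2 powi k * x + c"
    using B(2)[of "1 - e'" 1] e(1) by (auto simp: e'_def)
  have "c = 1 - 2 powi k" using kc[of 1] F_homeos_ends(2)[OF f] e(1) by (simp add: e'_def)
  then have "eventually (\<lambda>x. f x = 1 + 2 powi k * (x - 1)) (at_left 1)"
    using kc e(1) by (intro eventually_at_leftI[of "1 - e'" 1]) (auto simp: e'_def algebra_simps)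
  then show ?thesis by (intro exI[of _ "2 powi k"]) simp
qed

lemma F_homeos_bijection_group: "bijection_group {0..1} F_homeos thompson_F"
proof
  note ne = dyadic_affine_maps_nonempty
  show "thompson_F = (BijGroup {0..1})\<lparr>carrier := F_homeos\<rparr>" by (rule thompson_F_eq)
  show "F_homeos \<subseteq> Bij {0..1}" by (auto simp: F_homeos_def)
  have cong: "restrict f {0..1} \<in> F_homeos"
    if "restrict f {0..1} \<in> Bij {0..1}" "homeomorphic_map unit_interval unit_interval f" "strict_mono_on {0..1} f"
      "piecewise_in unit_interval dyadic_affine_maps ({0..1} \<inter> dyadics) f" for f
  proof -
    have "homeomorphic_map unit_interval unit_interval (restrict f {0..1})"
      using homeomorphic_map_eq[OF that(2)] by simp
    moreover have "strict_mono_on {0..1} (restrict f {0..1})" using that(3) by (auto simp: strict_mono_on_def)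
    moreover have "piecewise_in unit_interval dyadic_affine_maps ({0..1} \<inter> dyadics) (restrict f {0..1})"
      by (rule piecewise_in_cong[OF _ that(4)]) simp
    ultimately show ?thesis using that(1) by (simp add: F_homeos_def)
  qed
  have id: "(\<lambda>x. x) \<in> dyadic_affine_maps" by (intro CollectI exI[of _ 0]) auto
  show "(\<lambda>x\<in>{0..1}. x) \<in> F_homeos"
  proof (rule cong)
    show "(\<lambda>x\<in>{0..1}. x) \<in> Bij {0..1 :: real}" by (rule id_Bij)
    show "homeomorphic_map unit_interval unit_interval (\<lambda>x. x)"
      using homeomorphic_map_id[of unit_interval unit_interval] by (simp add: id_def)
    show "piecewise_in unit_interval dyadic_affine_maps ({0..1} \<inter> dyadics) (\<lambda>x. x)"
      unfolding piecewise_in_connected_iff[OF ne] using id by (intro exI[of _ "{}"]) (auto intro!: bexI[OF _ id])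
  qed (simp add: strict_mono_on_def)
  have dy: "g x \<in> {0..1} \<inter> dyadics \<longleftrightarrow> x \<in> {0..1} \<inter> dyadics" if g: "g \<in> F_homeos" and x: "x \<in> {0..1}" for g x
  proof -
    have "g x \<in> {0..1}" using g x by (auto simp: F_homeos_def Bij_def bij_betw_def)
    then show ?thesis using F_homeos_dyadic_iff[OF g x] x dyadics_eq by auto
  qed
  show "compose {0..1} f g \<in> F_homeos" if f: "f \<in> F_homeos" and g: "g \<in> F_homeos" for f g
    unfolding compose_def
  proof (rule cong)
    show "(\<lambda>x\<in>{0..1}. f (g x)) \<in> Bij {0..1}"
      using compose_Bij[of f "{0..1}" g] f g by (simp add: F_homeos_def compose_def)
    show "homeomorphic_map unit_interval unit_interval (\<lambda>x. f (g x))"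
      using homeomorphic_map_compose[of unit_interval unit_interval g unit_interval f] f g
      by (simp add: F_homeos_def o_def)
    have "g x \<in> {0..1}" if "x \<in> {0..1}" for x using g that by (auto simp: F_homeos_def Bij_def bij_betw_def)
    then show "strict_mono_on {0..1} (\<lambda>x. f (g x))"
      using f g unfolding F_homeos_def strict_mono_on_def by blast
    show "piecewise_in unit_interval dyadic_affine_maps ({0..1} \<inter> dyadics) (\<lambda>x. f (g x))"
    proof (rule piecewise_in_compose[where f = f and g = g])
      show "homeomorphic_map unit_interval unit_interval g"
        "piecewise_in unit_interval dyadic_affine_maps ({0..1} \<inter> dyadics) f"
        "piecewise_in unit_interval dyadic_affine_maps ({0..1} \<inter> dyadics) g"
        using f g by (simp_all add: F_homeos_def)
      show "x \<in> {0..1} \<inter> dyadics" if "x \<in> topspace unit_interval" "g x \<in> {0..1} \<inter> dyadics" for x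
        using dy[OF g] that by simp
      show "(\<lambda>x. \<phi> (\<psi> x)) \<in> dyadic_affine_maps"
        if \<phi>\<psi>: "\<phi> \<in> dyadic_affine_maps" "\<psi> \<in> dyadic_affine_maps" for \<phi> \<psi>
      proof -
        obtain k c l d where "\<phi> = (\<lambda>x. 2 powi k * x + c)" "\<psi> = (\<lambda>x. 2 powi l * x + d)" using \<phi>\<psi> by blast
        then have "(\<lambda>x. \<phi> (\<psi> x)) = (\<lambda>x. 2 powi (k + l) * x + (2 powi k * d + c))"
          by (simp add: power_int_add algebra_simps)
        then show ?thesis by blast
      qed
    qed (rule ne)
  qed
  show "(\<lambda>x\<in>{0..1}. inv_into {0..1} f x) \<in> F_homeos" if f: "f \<in> F_homeos" for f
  proof -
    have bij: "bij_betw f {0..1} {0..1}" and mono: "strict_mono_on {0..1} f" and BijF: "f \<in> Bij {0..1}"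
      using f by (auto simp: F_homeos_def Bij_def)
    have "homeomorphic_map unit_interval unit_interval f" using f by (simp add: F_homeos_def)
    then obtain f' where f': "homeomorphic_maps unit_interval unit_interval f f'"
      unfolding homeomorphic_map_maps by blast
    have f'_hom: "homeomorphic_map unit_interval unit_interval f'"
      using f' homeomorphic_maps_map homeomorphic_maps_sym by blast
    have f'_in: "f' x \<in> {0..1}" and ff': "f (f' x) = x" if "x \<in> {0..1}" for x
      using f' that homeomorphic_imp_surjective_map[OF f'_hom] by (auto simp: homeomorphic_maps_def)
    have inv: "inv_into {0..1} f x = f' x" if "x \<in> {0..1}" for x
      using inv_into_f_eq[of f "{0..1}" "f' x" x] bij f'_in[OF that] ff'[OF that] by (simp add: bij_betw_def)
    then have eq: "(\<lambda>x\<in>{0..1}. inv_into {0..1} f x) = restrict f' {0..1}" by (auto simp: restrict_def)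
    show ?thesis unfolding eq
    proof (rule cong)
      show "restrict f' {0..1} \<in> Bij {0..1}" using restrict_inv_into_Bij[OF BijF] eq by simp
      show "homeomorphic_map unit_interval unit_interval f'" by (rule f'_hom)
      show "strict_mono_on {0..1} f'"
      proof (rule strict_mono_onI)
        fix x y :: real assume xy: "x \<in> {0..1}" "y \<in> {0..1}" "x < y"
        show "f' x < f' y"
        proof (rule ccontr)
          assume "\<not> f' x < f' y"
          then have "f (f' y) \<le> f (f' x)" using strict_mono_on_leD[OF mono] f'_in xy by (metis not_less)
          then show False using ff' xy by simp
        qed
      qed
      show "piecewise_in unit_interval dyadic_affine_maps ({0..1} \<inter> dyadics) f'"
      proof (rule piecewise_in_inverse[OF f'])
        show "piecewise_in unit_interval dyadic_affine_maps ({0..1} \<inter> dyadics) f" using f by (simp add: F_homeos_def)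
        show "f x \<in> {0..1} \<inter> dyadics" if "x \<in> topspace unit_interval" "x \<in> {0..1} \<inter> dyadics" for x
          using dy[OF f] that by simp
        show "\<exists>\<psi>\<in>dyadic_affine_maps. \<forall>x. \<psi> (\<phi> x) = x" if \<phi>: "\<phi> \<in> dyadic_affine_maps" for \<phi>
        proof -
          obtain k c where "\<phi> = (\<lambda>x. 2 powi k * x + c)" using \<phi> by blast
          then have "\<forall>x. 2 powi (- k) * \<phi> x + - (2 powi (- k) * c) = x" by (simp add: power_int_minus field_simps)
          moreover have "(\<lambda>x. 2 powi (- k) * x + - (2 powi (- k) * c)) \<in> dyadic_affine_maps" by blast
          ultimately show ?thesis by (rule bexI)
        qed
        show "{0..1} \<inter> dyadics \<subseteq> topspace unit_interval" by simp
        show "dyadic_affine_maps \<noteq> {}" by (rule ne)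
      qed
    qed
  qed
qed

lemma F_homeos_affine_germs:
  fixes p :: real
  assumes L: "L = at_right p \<and> p = 0 \<or> L = at_left p \<and> p = 1"
  shows "affine_germs {0..1} F_homeos thompson_F L (\<lambda>\<alpha> \<beta> x. p + \<alpha> * (x - p) + \<beta>) {0}"
proof (intro affine_germs.intro F_homeos_bijection_group affine_germs_axioms.intro)
  show "filterlim (\<lambda>x. p + \<alpha> * (x - p) + \<beta>) L L" if "\<alpha> > 0" "\<beta> \<in> {0}" for \<alpha> \<beta>
  proof -
    have lim: "((\<lambda>x. p + \<alpha> * (x - p) + \<beta>) \<longlongrightarrow> p + \<alpha> * (p - p) + \<beta>) (at p within T)" for T
      by (intro tendsto_intros)
    show ?thesis using L
    proof (elim disjE conjE)
      assume 1: "L = at_right p"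
      have "eventually (\<lambda>x. p + \<alpha> * (x - p) + \<beta> \<in> {p<..}) (at_right p)"
        using that by (auto intro: eventually_mono[OF eventually_at_right_less[of p]])
      then show ?thesis using lim[of "{p<..}"] that(2) unfolding 1 filterlim_at
        by (auto elim: eventually_mono)
    next
      assume 1: "L = at_left p"
      have "eventually (\<lambda>x. p + \<alpha> * (x - p) + \<beta> \<in> {..<p}) (at_left p)"
        using that by (auto simp: eventually_at_filter mult_less_0_iff)
      then show ?thesis using lim[of "{..<p}"] that(2) unfolding 1 filterlim_at
        by (auto elim: eventually_mono)
    qed
  qed
  have "eventually (\<lambda>z::real. z \<in> {0..1}) (at_right 0)" by (rule eventually_at_rightI[of 0 1]) auto
  moreover have "eventually (\<lambda>z::real. z \<in> {0..1}) (at_left 1)" by (rule eventually_at_leftI[of 0 1]) auto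
  ultimately show "eventually (\<lambda>z. z \<in> {0..1}) L" using L by blast
  show "\<exists>\<alpha>>0. \<exists>\<beta>\<in>{0}. eventually (\<lambda>z. f z = p + \<alpha> * (z - p) + \<beta>) L" if "f \<in> F_homeos" for f
    using L F_homeos_germ_0[OF that] F_homeos_germ_1[OF that] by auto
qed (auto simp: algebra_simps)

lemma F_double_commutators_support:
  assumes n: "n \<in> monoid.comms thompson_F (monoid.comms thompson_F F_homeos)"
  shows "\<exists>e>0. \<forall>x\<in>{0..1}. x < e \<or> x > 1 - e \<longrightarrow> n x = x"
proof -
  interpret zero: affine_germs "{0..1}" F_homeos thompson_F "at_right 0" "\<lambda>\<alpha> \<beta> x. 0 + \<alpha> * (x - 0) + \<beta>" "{0}"
    by (rule F_homeos_affine_germs) simp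
  interpret one: affine_germs "{0..1}" F_homeos thompson_F "at_left 1" "\<lambda>\<alpha> \<beta> x. 1 + \<alpha> * (x - 1) + \<beta>" "{0}"
    by (rule F_homeos_affine_germs) simp
  have "n \<in> F_homeos" using n zero.comm_closed_K by (auto simp: zero.comms_def)
  then have ends: "n 0 = 0" "n 1 = 1" using F_homeos_ends by auto
  obtain a where a: "a > 0" "\<And>x. 0 < x \<Longrightarrow> x < a \<Longrightarrow> n x = x"
    using zero.double_comm_eventually_id[OF n] by (auto simp: eventually_at_right_field)
  obtain b where b: "b < 1" "\<And>x. b < x \<Longrightarrow> x < 1 \<Longrightarrow> n x = x"
    using one.double_comm_eventually_id[OF n] by (auto simp: eventually_at_left_field)
  show ?thesis
  proof (intro exI[of _ "min a (1 - b)"] conjI ballI impI)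
    show "min a (1 - b) > 0" using a b by simp
    fix x :: real assume x: "x \<in> {0..1}" "x < min a (1 - b) \<or> x > 1 - min a (1 - b)"
    consider "x = 0" | "x = 1" | "0 < x" "x < a" | "b < x" "x < 1" using x by fastforce
    then show "n x = x" by cases (use a b ends in auto)
  qed
qed

text \<open>
  An element of Thompson's group without fixed points in the open interval: slopes 2, 1 and 1/2
  with breakpoints 1/4 and 1/2. The minimum describes it since its graph is concave.
\<close>

definition push_right :: "real \<Rightarrow> real" where
  "push_right x = min (2 * x) (min (x + 1/4) (x / 2 + 1/2))"

lemma push_right_in_F: "restrict push_right {0..1} \<in> F_homeos"
proof -
  \<comment> \<open>The inverse of a minimum of increasing maps is the maximum of their inverses.\<close>
  define q :: "real \<Rightarrow> real" where "q = (\<lambda>y. max (y / 2) (max (y - 1/4) (2 * y - 1)))"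
  have qp: "q (push_right x) = x" for x
  proof -
    consider "x \<le> 1/4" | "1/4 \<le> x" "x \<le> 1/2" | "1/2 \<le> x" by linarith
    then have "push_right x = 2 * x \<and> q (2 * x) = x \<or> push_right x = x + 1/4 \<and> q (x + 1/4) = x \<or>
        push_right x = x / 2 + 1/2 \<and> q (x / 2 + 1/2) = x"
    proof cases
      case 1
      then have "push_right x = 2 * x" "q (2 * x) = x" unfolding push_right_def q_def by linarith+
      then show ?thesis by blast
    next
      case 2
      then have "push_right x = x + 1/4" unfolding push_right_def by linarith
      moreover have "q (x + 1/4) = x" using 2 by (simp add: q_def max_def)
      ultimately show ?thesis by blast
    next
      case 3
      then have "push_right x = x / 2 + 1/2" unfolding push_right_def by linarith
      moreover have "q (x / 2 + 1/2) = x" using 3 by (simp add: q_def max_def field_simps)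
      ultimately show ?thesis by blast
    qed
    then show ?thesis by auto
  qed
  have pq: "push_right (q y) = y" for y
  proof -
    consider "y \<le> 1/2" | "1/2 \<le> y" "y \<le> 3/4" | "3/4 \<le> y" by linarith
    then have "q y = y / 2 \<and> push_right (y / 2) = y \<or> q y = y - 1/4 \<and> push_right (y - 1/4) = y \<or>
        q y = 2 * y - 1 \<and> push_right (2 * y - 1) = y"
    proof cases
      case 1
      then have "q y = y / 2" "push_right (y / 2) = y" unfolding push_right_def q_def by linarith+
      then show ?thesis by blast
    next
      case 2
      then have "q y = y - 1/4" unfolding q_def by linarith
      moreover have "push_right (y - 1/4) = y" using 2 by (simp add: push_right_def min_def field_simps)
      ultimately show ?thesis by blast
    next
      case 3
      then have "q y = 2 * y - 1" unfolding q_def by linarith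
      moreover have "push_right (2 * y - 1) = y" using 3 by (simp add: push_right_def min_def field_simps)
      ultimately show ?thesis by blast
    qed
    then show ?thesis by metis
  qed
  have p01: "push_right x \<in> {0..1}" "q x \<in> {0..1}" if "x \<in> {0..1}" for x
    using that by (simp_all add: q_def push_right_def le_max_iff_disj min_le_iff_disj)
  have "bij_betw (restrict push_right {0..1}) {0..1} {0..1}"
    by (rule bij_betw_byWitness[of _ q]) (use p01 qp pq in auto)
  then have Bij: "restrict push_right {0..1} \<in> Bij {0..1}" by (simp add: Bij_def)
  have "continuous_on {0..1} push_right" "continuous_on {0..1} q"
    unfolding push_right_def q_def by (auto intro!: continuous_intros)
  then have "homeomorphic_maps unit_interval unit_interval push_right q"
    unfolding homeomorphic_maps_def unit_interval_def using p01 qp pq by (auto simp: continuous_map_in_subtopology)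
  then have "homeomorphic_map unit_interval unit_interval push_right" using homeomorphic_maps_map by blast
  then have hom: "homeomorphic_map unit_interval unit_interval (restrict push_right {0..1})"
    by (rule homeomorphic_map_eq) simp
  have mono: "strict_mono_on {0..1} (restrict push_right {0..1})"
    by (auto simp: strict_mono_on_def push_right_def)
  have "\<exists>\<phi>\<in>dyadic_affine_maps. \<forall>x\<in>C. restrict push_right {0..1} x = \<phi> x"
    if C: "connectedin unit_interval C" "C \<inter> {1/4, 1/2} = {}" for C
  proof -
    have C01: "C \<subseteq> {0..1}" and conn: "connected C" using C(1) by (auto simp: unit_interval_def connectedin_subtopology)
    have side: "C \<subseteq> {..<t} \<or> C \<subseteq> {t<..}" if "t \<notin> C" for t
    proof (rule ccontr)
      assume "\<not> (C \<subseteq> {..<t} \<or> C \<subseteq> {t<..})"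
      then obtain x y where "x \<in> C" "\<not> x < t" "y \<in> C" "\<not> t < y" by blast
      moreover from this have "t \<in> {y..x}" by simp
      ultimately show False using connected_contains_Icc[OF conn, of y x] that by blast
    qed
    consider "C \<subseteq> {..<1/4}" | "C \<subseteq> {1/4<..}" "C \<subseteq> {..<1/2}" | "C \<subseteq> {1/2<..}"
      using side[of "1/4"] side[of "1/2"] C(2) by blast
    then show ?thesis
    proof cases
      case 1
      then have "\<forall>x\<in>C. restrict push_right {0..1} x = 2 powi 1 * x + 0" using C01 by (force simp: push_right_def)
      then show ?thesis by (intro bexI[of _ "\<lambda>x. 2 powi 1 * x + 0"]) blast+
    next
      case 2
      then have "\<forall>x\<in>C. restrict push_right {0..1} x = 2 powi 0 * x + 1/4" using C01 by (force simp: push_right_def)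
      then show ?thesis by (intro bexI[of _ "\<lambda>x. 2 powi 0 * x + 1/4"]) blast+
    next
      case 3
      then have "\<forall>x\<in>C. restrict push_right {0..1} x = 2 powi (- 1) * x + 1/2" using C01 by (force simp: push_right_def)
      then show ?thesis by (intro bexI[of _ "\<lambda>x. 2 powi (- 1) * x + 1/2"]) blast+
    qed
  qed
  moreover have "of_int 1 / 2 ^ 2 \<in> dyadic_reals" "of_int 1 / 2 ^ 1 \<in> dyadic_reals"
    unfolding dyadic_reals_def by blast+
  then have "{1/4, 1/2 :: real} \<subseteq> {0..1} \<inter> dyadics" using dyadics_eq[of "1/4"] dyadics_eq[of "1/2"] by simp
  ultimately have "piecewise_in unit_interval dyadic_affine_maps ({0..1} \<inter> dyadics) (restrict push_right {0..1})"
    unfolding piecewise_in_connected_iff[OF dyadic_affine_maps_nonempty] by (intro exI[of _ "{1/4, 1/2}"]) simp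
  then show ?thesis using Bij hom mono by (simp add: F_homeos_def)
qed

lemma push_right_funpow_in_F: "\<exists>g\<in>F_homeos. \<forall>x\<in>{0..1}. g x = (push_right ^^ k) x"
proof (induction k)
  case 0
  interpret bijection_group "{0..1}" F_homeos thompson_F by (rule F_homeos_bijection_group)
  show ?case using K_id by (intro bexI[of _ "\<lambda>x\<in>{0..1}. x"]) auto
next
  case (Suc k)
  interpret bijection_group "{0..1}" F_homeos thompson_F by (rule F_homeos_bijection_group)
  obtain g where g: "g \<in> F_homeos" "\<And>x. x \<in> {0..1} \<Longrightarrow> g x = (push_right ^^ k) x" using Suc by blast
  have "compose {0..1} (restrict push_right {0..1}) g x = (push_right ^^ Suc k) x" if "x \<in> {0..1}" for x
    using that g(2)[OF that] K_mem[OF g(1) that] by (simp add: compose_def)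
  then show ?case using K_compose[OF push_right_in_F g(1)] by blast
qed

text \<open>
  On [e, 1 - e] each step moves points to the right by at least e / 2.
\<close>

lemma push_right_funpow_displaces:
  assumes e: "0 < e" "e \<le> 1/2" and x: "e \<le> x"
  shows "(push_right ^^ k) x > 1 - e \<or> (push_right ^^ k) x \<ge> x + real k * (e / 2)"
proof (induction k)
  case (Suc k)
  let ?y = "(push_right ^^ k) x"
  have "push_right ?y > 1 - e" if "?y > 1 - e"
    using that e by (auto simp: push_right_def)
  moreover have "push_right ?y \<ge> x + real (Suc k) * (e / 2)" if y: "?y \<ge> x + real k * (e / 2)" "?y \<le> 1 - e"
  proof -
    have "0 \<le> real k * (e / 2)" using e by simp
    then have "?y \<ge> e" using y(1) x by linarith
    then have "push_right ?y \<ge> ?y + e / 2" using y(2) e by (auto simp: push_right_def)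
    moreover have "real (Suc k) * (e / 2) = real k * (e / 2) + e / 2" by (simp add: distrib_right add_divide_distrib)
    ultimately show ?thesis using y(1) by linarith
  qed
  ultimately show ?case using Suc by fastforce
qed simp

lemma thompson_F_commuting_conjugates:
  assumes n: "n \<in> monoid.comms thompson_F (monoid.comms thompson_F (carrier thompson_F))"
    and m: "m \<in> monoid.comms thompson_F (monoid.comms thompson_F (carrier thompson_F))"
  shows "monoid.has_commuting_conjugates thompson_F n m"
proof -
  interpret bijection_group "{0..1}" F_homeos thompson_F by (rule F_homeos_bijection_group)
  have K: "f \<in> F_homeos" if "f \<in> comms (comms F_homeos)" for f
    using that comm_closed_K by (auto simp: comms_def)
  have nm: "n \<in> comms (comms F_homeos)" "m \<in> comms (comms F_homeos)"
    using n m by (simp_all add: carrier_G)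
  obtain a b where a: "a > 0" "\<And>x. x \<in> {0..1} \<Longrightarrow> x < a \<or> x > 1 - a \<Longrightarrow> n x = x"
    and b: "b > 0" "\<And>x. x \<in> {0..1} \<Longrightarrow> x < b \<or> x > 1 - b \<Longrightarrow> m x = x"
    using F_double_commutators_support nm by metis
  define e where "e = min (1/2) (min a b)"
  have e: "0 < e" "e \<le> 1/2" "e \<le> a" "e \<le> b" using a b by (auto simp: e_def)
  define Z where "Z = {e..1 - e}"
  obtain k :: nat where k: "real k > 1 / (e / 2)" using reals_Archimedean2 by blast
  obtain h where h: "h \<in> F_homeos" "\<And>x. x \<in> {0..1} \<Longrightarrow> h x = (push_right ^^ k) x" using push_right_funpow_in_F by metis
  have fix_off_Z: "f x = x" if "f \<in> {n, m}" "x \<in> {0..1} - Z" for f x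
  proof -
    have "x < e \<or> x > 1 - e" using that(2) by (auto simp: Z_def)
    then have "x < a \<or> x > 1 - a" "x < b \<or> x > 1 - b" using e by auto
    then show ?thesis using a(2)[of x] b(2)[of x] that by blast
  qed
  have "h x \<notin> Z" if x: "x \<in> Z" for x
  proof -
    have x01: "x \<in> {0..1}" "e \<le> x" using x e by (auto simp: Z_def)
    have "real k * (e / 2) > 1" using k e by (simp add: field_simps)
    then have "h x > 1 - e" using push_right_funpow_displaces[OF e(1,2) x01(2), of k] h(2)[OF x01(1)] e x01 by linarith
    then show ?thesis by (simp add: Z_def)
  qed
  then have "h ` Z \<inter> Z = {}" by blast
  moreover have "Z \<subseteq> {0..1}" using e by (auto simp: Z_def)
  ultimately show ?thesis
    by (intro commuting_conjugates_of_displacement[where A = Z and h = h] K[OF nm(1)] K[OF nm(2)] h(1) fix_off_Z)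
qed

section \<open>Elementarity for both groups\<close>

theorem corollary1p6:
  fixes X :: "'x topology"
  assumes "dendrite X"
  shows "(\<forall>\<phi>. homeo_action thompson_F X \<phi> \<longrightarrow> elementary_action thompson_F X \<phi>) \<and>
    (\<forall>A. subring A (cring_class_ops :: real ring) \<longrightarrow>
      (\<forall>\<phi>. homeo_action (piecewise_proj_line_group A) X \<phi> \<longrightarrow>
        elementary_action (piecewise_proj_line_group A) X \<phi>))"
proof (intro conjI allI impI)
  fix \<phi> assume "homeo_action thompson_F X \<phi>"
  then show "elementary_action thompson_F X \<phi>"
    using elementary_action_of_commuting_conjugates[OF bijection_group.group_G[OF F_homeos_bijection_group] assms]
      thompson_F_commuting_conjugates by blast
next
  fix A \<phi>
  assume A: "subring A (cring_class_ops :: real ring)"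
    and "homeo_action (piecewise_proj_line_group A) X \<phi>"
  then show "elementary_action (piecewise_proj_line_group A) X \<phi>"
    using elementary_action_of_commuting_conjugates[OF bijection_group.group_G[OF line_homeos_bijection_group[OF A]] assms]
      piecewise_proj_line_group_commuting_conjugates[OF A] by blast
qed

end
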